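(* Let $(A, H, \triangleright, \triangleleft)$ and $(A', H', \triangleright', \triangleleft')$ be two matched pairs of Hopf algebras over $k$, with bicrossed products $A \bowtie H$ and $A' \bowtie' H'$. Then there exists a bijective correspondence between the set of all morphisms of Hopf algebras $\psi : A \bowtie H \to A' \bowtie' H'$ and the set of all quadruples $(u, p, r, v)$, where $u: A \to A'$, $p: A \to H'$, $r: H \to A'$, $v: H \to H'$ are unitary coalgebra maps satisfying, for all $a, b \in A$, $g, h \in H$: \begin{align*} u(a_{(1)}) \otimes p(a_{(2)}) &= u(a_{(2)}) \otimes p(a_{(1)})\\ r(h_{(1)}) \otimes v(h_{(2)}) &= r(h_{(2)}) \otimes v(h_{(1)})\\ u(ab) &= u(a_{(1)}) \, \bigl( p (a_{(2)}) \triangleright' u(b) \bigr)\\ p(ab) &= \bigl( p (a) \triangleleft' u(b_{(1)}) \bigr) \, p (b_{(2)})\\ r(hg) &= r(h_{(1)}) \, \bigl(v(h_{(2)}) \triangleright' r(g)\bigr)\\ v(hg) &= \bigl(v(h) \triangleleft' r(g_{(1)})\bigr) \, v(g_{(2)})\\ r(h_{(1)}) \bigl(v(h_{(2)}) \triangleright' u(b) \bigr) &= u (h_{(1)} \triangleright b_{(1)}) \, \Bigl( p (h_{(2)} \triangleright b_{(2)}) \triangleright' r(h_{(3)} \triangleleft b_{(3)}) \Bigr)\\ \bigl (v(h) \triangleleft' u(b_{(1)}) \bigr) \, p (b_{(2)}) &= \Bigl( p (h_{(1)} \triangleright b_{(1)}) \triangleleft' r(h_{(2)} \triangleleft b_{(2)})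 \Bigr) \, v (h_{(3)} \triangleleft b_{(3)}). \end{align*} Under this correspondence the morphism of Hopf algebras $\psi$ corresponding to $(u, p, r, v)$ is given, for all $a \in A$ and $h \in H$, by $$\psi(a \bowtie h) = u(a_{(1)}) \, \bigl( p(a_{(2)}) \triangleright' r(h_{(1)}) \bigr) \; \bowtie' \; \bigl( p(a_{(3)}) \triangleleft' r(h_{(2)}) \bigr) \, v(h_{(3)}).$$
   Context: $k$ is a field; all algebras, coalgebras, Hopf algebras, tensor products and homomorphisms are over $k$. Sweedler notation $\Delta(c) = c_{(1)} \otimes c_{(2)}$ (summation understood) is used. A map $f$ between Hopf algebras is called unitary if $f(1) = 1$. A matched pair of Hopf algebras is a system $(A, H, \triangleleft, \triangleright)$ (also written $(A,H,\triangleright,\triangleleft)$) where $A$, $H$ are Hopf algebras and $\triangleleft : H \otimes A \to H$, $\triangleright: H \otimes A \to A$ are coalgebra maps such that $(A, \triangleright)$ is a left $H$-module, $(H, \triangleleft)$ is a right $A$-module, and for all $a, b \in A$, $g, h \in H$: $h \triangleright 1_A = \varepsilon_H(h) 1_A$, $1_H \triangleleft a = \varepsilon_A(a) 1_H$; $g \triangleright (ab) = (g_{(1)} \triangleright a_{(1)}) \bigl( (g_{(2)} \triangleleft a_{(2)}) \triangleright b \bigr)$; $(gh) \triangleleft a = \bigl( g \triangleleft (h_{(1)} \triangleright a_{(1)}) \bigr)(h_{(2)} \triangleleft a_{(2)})$; $g_{(1)} \triangleleft a_{(1)} \otimes g_{(2)} \triangleright a_{(2)} = g_{(2)} \triangleleft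 a_{(2)} \otimes g_{(1)} \triangleright a_{(1)}$. The bicrossed product $A \bowtie H$ is the vector space $A \otimes H$ (with $a \bowtie h := a \otimes h$), with unit $1_A \bowtie 1_H$, multiplication $(a \bowtie h)(c \bowtie g) = a (h_{(1)} \triangleright c_{(1)}) \bowtie (h_{(2)} \triangleleft c_{(2)}) g$ and the tensor product coalgebra structure; it is a Hopf algebra. $A' \bowtie' H'$ denotes the bicrossed product of $(A', H', \triangleright', \triangleleft')$. *)

theory Defs
  imports "HOL-Algebra.Free_Abelian_Groups" "HOL-Algebra.Generated_Groups" "HOL-Algebra.Module"
begin

section \<open>Tensor products of vector spaces\<close>

text \<open>
  The base field is a ring record \<^term>\<open>K\<close> and vector spaces over it are \<^locale>\<open>module\<close>s.
  The tensor product of \<^term>\<open>A\<close> and \<^term>\<open>B\<close> is the free abelian group on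
  \<^term>\<open>carrier A \<times> carrier B\<close> modulo the bilinearity relations; its elements are cosets.
\<close>

type_synonym ('a, 'b) tensor = "('a \<times> 'b \<Rightarrow>\<^sub>0 int) set"

definition tensor_relations ::
  "('k, 'n) ring_scheme \<Rightarrow> ('k, 'a, 'm) module_scheme \<Rightarrow> ('k, 'b, 'l) module_scheme
    \<Rightarrow> ('a \<times> 'b \<Rightarrow>\<^sub>0 int) set" where
  "tensor_relations K A B =
     {frag_of (a \<oplus>\<^bsub>A\<^esub> a', b) - frag_of (a, b) - frag_of (a', b) | a a' b.
        a \<in> carrier A \<and> a' \<in> carrier A \<and> b \<in> carrier B}
   \<union> {frag_of (a, b \<oplus>\<^bsub>B\<^esub> b') - frag_of (a, b) - frag_of (a, b') | a b b'.
        a \<in> carrier A \<and> b \<in> carrier B \<and> b' \<in> carrier B}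
   \<union> {frag_of (k \<odot>\<^bsub>A\<^esub> a, b) - frag_of (a, k \<odot>\<^bsub>B\<^esub> b) | k a b.
        k \<in> carrier K \<and> a \<in> carrier A \<and> b \<in> carrier B}"

definition tensor_null ::
  "('k, 'n) ring_scheme \<Rightarrow> ('k, 'a, 'm) module_scheme \<Rightarrow> ('k, 'b, 'l) module_scheme
    \<Rightarrow> ('a, 'b) tensor" where
  "tensor_null K A B =
     generate (free_Abelian_group (carrier A \<times> carrier B)) (tensor_relations K A B)"

definition tensor_group ::
  "('k, 'n) ring_scheme \<Rightarrow> ('k, 'a, 'm) module_scheme \<Rightarrow> ('k, 'b, 'l) module_scheme
    \<Rightarrow> ('a, 'b) tensor monoid" where
  "tensor_group K A B = free_Abelian_group (carrier A \<times> carrier B) Mod tensor_null K A B"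

definition tens ::
  "('k, 'n) ring_scheme \<Rightarrow> ('k, 'a, 'm) module_scheme \<Rightarrow> ('k, 'b, 'l) module_scheme
    \<Rightarrow> 'a \<Rightarrow> 'b \<Rightarrow> ('a, 'b) tensor" where
  "tens K A B a b =
     tensor_null K A B #>\<^bsub>free_Abelian_group (carrier A \<times> carrier B)\<^esub> frag_of (a, b)"

text \<open>
  For a balanced biadditive map \<^term>\<open>f\<close> into the (multiplicatively written) abelian group
  \<^term>\<open>G\<close>, \<^term>\<open>group_lift G f\<close> is the induced homomorphism on the tensor product, computed
  on representatives; only the case where the value does not depend on the representative is
  meaningful.
\<close>

definition group_lift ::
  "('v, 'm) monoid_scheme \<Rightarrow> ('a \<Rightarrow> 'b \<Rightarrow> 'v) \<Rightarrow> ('a, 'b) tensor \<Rightarrow> 'v" where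
  "group_lift G f X =
     the_elem ((\<lambda>x. finprod G (\<lambda>(a, b). f a b [^]\<^bsub>G\<^esub> Poly_Mapping.lookup x (a, b))
                            (Poly_Mapping.keys x)) ` X)"

definition tlift ::
  "('v, 'm) ring_scheme \<Rightarrow> ('a \<Rightarrow> 'b \<Rightarrow> 'v) \<Rightarrow> ('a, 'b) tensor \<Rightarrow> 'v" where
  "tlift V = group_lift (add_monoid V)"

text \<open>
  The tensor product carries the componentwise multiplication
  \<open>(a \<otimes> b)(c \<otimes> d) = ac \<otimes> bd\<close> with unit \<open>1 \<otimes> 1\<close>. These two fields are meaningful only if the
  factors are algebras and are irrelevant to the vector space structure.
\<close>

definition tensor_alg ::
  "('k, 'n) ring_scheme \<Rightarrow> ('k, 'a, 'm) module_scheme \<Rightarrow> ('k, 'b, 'l) module_scheme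
    \<Rightarrow> ('k, ('a, 'b) tensor) module" where
  "tensor_alg K A B =
     (let G = tensor_group K A B in
      \<lparr>carrier = carrier G,
       monoid.mult = (\<lambda>X Y. group_lift G (\<lambda>a b. group_lift G (\<lambda>c d.
                 tens K A B (a \<otimes>\<^bsub>A\<^esub> c) (b \<otimes>\<^bsub>B\<^esub> d)) Y) X),
       one = tens K A B \<one>\<^bsub>A\<^esub> \<one>\<^bsub>B\<^esub>,
       zero = \<one>\<^bsub>G\<^esub>,
       add = monoid.mult G,
       smult = (\<lambda>k. group_lift G (\<lambda>a b. tens K A B (k \<odot>\<^bsub>A\<^esub> a) b))\<rparr>)"

section \<open>Hopf algebras\<close>

record ('k, 'a) hopf = "('k, 'a) module" +
  comult :: "'a \<Rightarrow> ('a, 'a) tensor"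
  counit :: "'a \<Rightarrow> 'k"

text \<open>
  Sweedler notation: \<^term>\<open>sweedler2 C V c (\<lambda>x y. f x y)\<close> is the element
  \<open>f c\<^sub>(\<^sub>1\<^sub>) c\<^sub>(\<^sub>2\<^sub>)\<close> of \<^term>\<open>V\<close> (summation understood), for bilinear \<^term>\<open>f\<close>;
  \<^term>\<open>sweedler3\<close> is the analogue for \<open>c\<^sub>(\<^sub>1\<^sub>), c\<^sub>(\<^sub>2\<^sub>), c\<^sub>(\<^sub>3\<^sub>)\<close>, obtained from \<open>(\<Delta> \<otimes> id) \<circ> \<Delta>\<close>.
\<close>

definition sweedler2 ::
  "('k, 'c, 'm) hopf_scheme \<Rightarrow> ('v, 'l) ring_scheme \<Rightarrow> 'c \<Rightarrow> ('c \<Rightarrow> 'c \<Rightarrow> 'v) \<Rightarrow> 'v" where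
  "sweedler2 C V c f = tlift V f (comult C c)"

definition sweedler3 ::
  "('k, 'c, 'm) hopf_scheme \<Rightarrow> ('v, 'l) ring_scheme \<Rightarrow> 'c
    \<Rightarrow> ('c \<Rightarrow> 'c \<Rightarrow> 'c \<Rightarrow> 'v) \<Rightarrow> 'v" where
  "sweedler3 C V c f = sweedler2 C V c (\<lambda>x c3. sweedler2 C V x (\<lambda>c1 c2. f c1 c2 c3))"

definition ground :: "('k, 'n) ring_scheme \<Rightarrow> ('k, 'k) module" where
  "ground K = \<lparr>carrier = carrier K, monoid.mult = monoid.mult K, one = \<one>\<^bsub>K\<^esub>,
               zero = \<zero>\<^bsub>K\<^esub>, add = add K, smult = monoid.mult K\<rparr>"

definition linear_hom ::
  "('k, 'n) ring_scheme \<Rightarrow> ('k, 'v, 'm) module_scheme \<Rightarrow> ('k, 'w, 'l) module_scheme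
    \<Rightarrow> ('v \<Rightarrow> 'w) set" where
  "linear_hom K V W =
     {f \<in> carrier V \<rightarrow> carrier W.
        (\<forall>x\<in>carrier V. \<forall>y\<in>carrier V. f (x \<oplus>\<^bsub>V\<^esub> y) = f x \<oplus>\<^bsub>W\<^esub> f y) \<and>
        (\<forall>k\<in>carrier K. \<forall>x\<in>carrier V. f (k \<odot>\<^bsub>V\<^esub> x) = k \<odot>\<^bsub>W\<^esub> f x)}"

definition alg_hom ::
  "('k, 'n) ring_scheme \<Rightarrow> ('k, 'v, 'm) module_scheme \<Rightarrow> ('k, 'w, 'l) module_scheme
    \<Rightarrow> ('v \<Rightarrow> 'w) set" where
  "alg_hom K V W = linear_hom K V W \<inter> ring_hom V W"

definition coalg_hom ::
  "('k, 'n) ring_scheme \<Rightarrow> ('k, 'c, 'm) hopf_scheme \<Rightarrow> ('k, 'd, 'l) hopf_scheme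
    \<Rightarrow> ('c \<Rightarrow> 'd) set" where
  "coalg_hom K C D =
     {f \<in> linear_hom K C D. \<forall>c\<in>carrier C.
        comult D (f c) = sweedler2 C (tensor_alg K D D) c (\<lambda>c1 c2. tens K D D (f c1) (f c2)) \<and>
        counit D (f c) = counit C c}"

locale k_algebra = field K + module K A + ring A
  for K :: "('k, 'n) ring_scheme" and A :: "('k, 'a, 'm) module_scheme" +
  assumes smult_mult_left:
      "\<lbrakk>k \<in> carrier K; a \<in> carrier A; b \<in> carrier A\<rbrakk>
        \<Longrightarrow> (k \<odot>\<^bsub>A\<^esub> a) \<otimes>\<^bsub>A\<^esub> b = k \<odot>\<^bsub>A\<^esub> (a \<otimes>\<^bsub>A\<^esub> b)"
    and smult_mult_right:
      "\<lbrakk>k \<in> carrier K; a \<in> carrier A; b \<in> carrier A\<rbrakk>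
        \<Longrightarrow> a \<otimes>\<^bsub>A\<^esub> (k \<odot>\<^bsub>A\<^esub> b) = k \<odot>\<^bsub>A\<^esub> (a \<otimes>\<^bsub>A\<^esub> b)"

locale k_coalgebra = field K + module K C
  for K :: "('k, 'n) ring_scheme" and C :: "('k, 'c, 'm) hopf_scheme" +
  assumes comult_linear: "comult C \<in> linear_hom K C (tensor_alg K C C)"
    and counit_linear: "counit C \<in> linear_hom K C (ground K)"
    and coassoc: "c \<in> carrier C \<Longrightarrow>
      (let CC = tensor_alg K C C; CCC = tensor_alg K C CC in
       sweedler2 C CCC c (\<lambda>x c3. sweedler2 C CCC x (\<lambda>c1 c2. tens K C CC c1 (tens K C C c2 c3)))
       = sweedler2 C CCC c (\<lambda>c1 y. sweedler2 C CCC y (\<lambda>c2 c3. tens K C CC c1 (tens K C C c2 c3))))"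
    and counit_left: "c \<in> carrier C \<Longrightarrow> sweedler2 C C c (\<lambda>c1 c2. counit C c1 \<odot>\<^bsub>C\<^esub> c2) = c"
    and counit_right: "c \<in> carrier C \<Longrightarrow> sweedler2 C C c (\<lambda>c1 c2. counit C c2 \<odot>\<^bsub>C\<^esub> c1) = c"

locale k_bialgebra = k_algebra K B + k_coalgebra K B
  for K :: "('k, 'n) ring_scheme" and B :: "('k, 'b, 'm) hopf_scheme" +
  assumes comult_alg_hom: "comult B \<in> alg_hom K B (tensor_alg K B B)"
    and counit_alg_hom: "counit B \<in> alg_hom K B (ground K)"

text \<open>
  The antipode is unique if it exists and is preserved by every bialgebra map, so it is not part
  of the data, and morphisms of Hopf algebras are the bialgebra morphisms.
\<close>

locale hopf_algebra = k_bialgebra K B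
  for K :: "('k, 'n) ring_scheme" and B :: "('k, 'b, 'm) hopf_scheme" +
  assumes antipode: "\<exists>S\<in>linear_hom K B B. \<forall>b\<in>carrier B.
      sweedler2 B B b (\<lambda>b1 b2. S b1 \<otimes>\<^bsub>B\<^esub> b2) = counit B b \<odot>\<^bsub>B\<^esub> \<one>\<^bsub>B\<^esub> \<and>
      sweedler2 B B b (\<lambda>b1 b2. b1 \<otimes>\<^bsub>B\<^esub> S b2) = counit B b \<odot>\<^bsub>B\<^esub> \<one>\<^bsub>B\<^esub>"

text \<open>
  Morphisms are taken extensional, so that each one is represented by exactly one HOL function.
\<close>

definition hopf_hom ::
  "('k, 'n) ring_scheme \<Rightarrow> ('k, 'a, 'm) hopf_scheme \<Rightarrow> ('k, 'b, 'l) hopf_scheme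
    \<Rightarrow> ('a \<Rightarrow> 'b) set" where
  "hopf_hom K A B = extensional (carrier A) \<inter> alg_hom K A B \<inter> coalg_hom K A B"

definition unitary_coalg_hom ::
  "('k, 'n) ring_scheme \<Rightarrow> ('k, 'a, 'm) hopf_scheme \<Rightarrow> ('k, 'b, 'l) hopf_scheme
    \<Rightarrow> ('a \<Rightarrow> 'b) set" where
  "unitary_coalg_hom K A B =
     {f \<in> extensional (carrier A) \<inter> coalg_hom K A B. f \<one>\<^bsub>A\<^esub> = \<one>\<^bsub>B\<^esub>}"

definition tensor_coalg ::
  "('k, 'n) ring_scheme \<Rightarrow> ('k, 'a, 'm) hopf_scheme \<Rightarrow> ('k, 'b, 'l) hopf_scheme
    \<Rightarrow> ('k, ('a, 'b) tensor) hopf" where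
  "tensor_coalg K A B =
     (let T = tensor_alg K A B; TT = tensor_alg K T T in
      \<lparr>carrier = carrier T, monoid.mult = monoid.mult T, one = \<one>\<^bsub>T\<^esub>, zero = \<zero>\<^bsub>T\<^esub>,
       add = add T, smult = smult T,
       comult = tlift TT (\<lambda>a b. sweedler2 A TT a (\<lambda>a1 a2. sweedler2 B TT b (\<lambda>b1 b2.
                  tens K T T (tens K A B a1 b1) (tens K A B a2 b2)))),
       counit = tlift K (\<lambda>a b. counit A a \<otimes>\<^bsub>K\<^esub> counit B b)\<rparr>)"

section \<open>Matched pairs and bicrossed products\<close>

text \<open>
  The actions \<open>\<triangleright> : H \<otimes> A \<rightarrow> A\<close> and \<open>\<triangleleft> : H \<otimes> A \<rightarrow> H\<close> are maps \<^term>\<open>lact\<close>, \<^term>\<open>ract\<close> defined on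
  the tensor product \<open>H \<otimes> A\<close>; on pure tensors they are written infix.
\<close>

locale hopf_actions =
  fixes K :: "('k, 'n) ring_scheme"
    and A :: "('k, 'a, 'm) hopf_scheme" and H :: "('k, 'h, 'l) hopf_scheme"
    and lact :: "('h, 'a) tensor \<Rightarrow> 'a" and ract :: "('h, 'a) tensor \<Rightarrow> 'h"
begin

abbreviation lact_op :: "'h \<Rightarrow> 'a \<Rightarrow> 'a" (infixr \<open>\<triangleright>\<close> 75) where
  "h \<triangleright> a \<equiv> lact (tens K H A h a)"

abbreviation ract_op :: "'h \<Rightarrow> 'a \<Rightarrow> 'h" (infixl \<open>\<triangleleft>\<close> 75) where
  "h \<triangleleft> a \<equiv> ract (tens K H A h a)"

definition bicrossed :: "('k, ('a, 'h) tensor) hopf" where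
  "bicrossed =
     (let T = tensor_coalg K A H in
      T\<lparr>monoid.mult := \<lambda>X Y. tlift T (\<lambda>a h. tlift T (\<lambda>c g.
          sweedler2 H T h (\<lambda>h1 h2. sweedler2 A T c (\<lambda>c1 c2.
            tens K A H (a \<otimes>\<^bsub>A\<^esub> (h1 \<triangleright> c1)) ((h2 \<triangleleft> c2) \<otimes>\<^bsub>H\<^esub> g)))) Y) X\<rparr>)"

end

locale matched_pair = hopf_actions K A H lact ract + A: hopf_algebra K A + H: hopf_algebra K H
  for K :: "('k, 'n) ring_scheme"
    and A :: "('k, 'a, 'm) hopf_scheme" and H :: "('k, 'h, 'l) hopf_scheme"
    and lact :: "('h, 'a) tensor \<Rightarrow> 'a" and ract :: "('h, 'a) tensor \<Rightarrow> 'h" +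
  assumes lact_coalg_hom: "lact \<in> coalg_hom K (tensor_coalg K H A) A"
    and ract_coalg_hom: "ract \<in> coalg_hom K (tensor_coalg K H A) H"
    and lact_one: "a \<in> carrier A \<Longrightarrow> \<one>\<^bsub>H\<^esub> \<triangleright> a = a"
    and lact_mult: "\<lbrakk>g \<in> carrier H; h \<in> carrier H; a \<in> carrier A\<rbrakk>
      \<Longrightarrow> (g \<otimes>\<^bsub>H\<^esub> h) \<triangleright> a = g \<triangleright> (h \<triangleright> a)"
    and ract_one: "h \<in> carrier H \<Longrightarrow> h \<triangleleft> \<one>\<^bsub>A\<^esub> = h"
    and ract_mult: "\<lbrakk>h \<in> carrier H; a \<in> carrier A; b \<in> carrier A\<rbrakk>
      \<Longrightarrow> h \<triangleleft> (a \<otimes>\<^bsub>A\<^esub> b) = (h \<triangleleft> a) \<triangleleft> b"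
    and lact_unit: "h \<in> carrier H \<Longrightarrow> h \<triangleright> \<one>\<^bsub>A\<^esub> = counit H h \<odot>\<^bsub>A\<^esub> \<one>\<^bsub>A\<^esub>"
    and ract_unit: "a \<in> carrier A \<Longrightarrow> \<one>\<^bsub>H\<^esub> \<triangleleft> a = counit A a \<odot>\<^bsub>H\<^esub> \<one>\<^bsub>H\<^esub>"
    and lact_prod: "\<lbrakk>g \<in> carrier H; a \<in> carrier A; b \<in> carrier A\<rbrakk> \<Longrightarrow>
      g \<triangleright> (a \<otimes>\<^bsub>A\<^esub> b) =
        sweedler2 H A g (\<lambda>g1 g2. sweedler2 A A a (\<lambda>a1 a2.
          (g1 \<triangleright> a1) \<otimes>\<^bsub>A\<^esub> ((g2 \<triangleleft> a2) \<triangleright> b)))"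
    and ract_prod: "\<lbrakk>g \<in> carrier H; h \<in> carrier H; a \<in> carrier A\<rbrakk> \<Longrightarrow>
      (g \<otimes>\<^bsub>H\<^esub> h) \<triangleleft> a =
        sweedler2 H H h (\<lambda>h1 h2. sweedler2 A H a (\<lambda>a1 a2.
          (g \<triangleleft> (h1 \<triangleright> a1)) \<otimes>\<^bsub>H\<^esub> (h2 \<triangleleft> a2)))"
    and compat: "\<lbrakk>g \<in> carrier H; a \<in> carrier A\<rbrakk> \<Longrightarrow>
      sweedler2 H (tensor_alg K H A) g (\<lambda>g1 g2. sweedler2 A (tensor_alg K H A) a (\<lambda>a1 a2.
        tens K H A (g1 \<triangleleft> a1) (g2 \<triangleright> a2)))
      = sweedler2 H (tensor_alg K H A) g (\<lambda>g1 g2. sweedler2 A (tensor_alg K H A) a (\<lambda>a1 a2.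
        tens K H A (g2 \<triangleleft> a2) (g1 \<triangleright> a1)))"

abbreviation "bicrossed_product \<equiv> hopf_actions.bicrossed"

locale two_hopf_actions = dom: hopf_actions K A H lact ract + cod: hopf_actions K A' H' lact' ract'
  for K :: "('k, 'n) ring_scheme"
    and A :: "('k, 'a, 'm) hopf_scheme" and H :: "('k, 'h, 'l) hopf_scheme"
    and lact :: "('h, 'a) tensor \<Rightarrow> 'a" and ract :: "('h, 'a) tensor \<Rightarrow> 'h"
    and A' :: "('k, 'a2, 'm2) hopf_scheme" and H' :: "('k, 'h2, 'l2) hopf_scheme"
    and lact' :: "('h2, 'a2) tensor \<Rightarrow> 'a2" and ract' :: "('h2, 'a2) tensor \<Rightarrow> 'h2"
begin

notation dom.lact_op (infixr \<open>\<triangleright>\<close> 75) and dom.ract_op (infixl \<open>\<triangleleft>\<close> 75)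
  and cod.lact_op (infixr \<open>\<triangleright>''\<close> 75) and cod.ract_op (infixl \<open>\<triangleleft>''\<close> 75)

definition compatible_quadruples ::
  "(('a \<Rightarrow> 'a2) \<times> ('a \<Rightarrow> 'h2) \<times> ('h \<Rightarrow> 'a2) \<times> ('h \<Rightarrow> 'h2)) set" where
  "compatible_quadruples = {(u, p, r, v).
     u \<in> unitary_coalg_hom K A A' \<and> p \<in> unitary_coalg_hom K A H' \<and>
     r \<in> unitary_coalg_hom K H A' \<and> v \<in> unitary_coalg_hom K H H' \<and>
     (\<forall>a\<in>carrier A.
        sweedler2 A (tensor_alg K A' H') a (\<lambda>a1 a2. tens K A' H' (u a1) (p a2)) =
        sweedler2 A (tensor_alg K A' H') a (\<lambda>a1 a2. tens K A' H' (u a2) (p a1))) \<and>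
     (\<forall>h\<in>carrier H.
        sweedler2 H (tensor_alg K A' H') h (\<lambda>h1 h2. tens K A' H' (r h1) (v h2)) =
        sweedler2 H (tensor_alg K A' H') h (\<lambda>h1 h2. tens K A' H' (r h2) (v h1))) \<and>
     (\<forall>a\<in>carrier A. \<forall>b\<in>carrier A.
        u (a \<otimes>\<^bsub>A\<^esub> b) = sweedler2 A A' a (\<lambda>a1 a2. u a1 \<otimes>\<^bsub>A'\<^esub> (p a2 \<triangleright>' u b))) \<and>
     (\<forall>a\<in>carrier A. \<forall>b\<in>carrier A.
        p (a \<otimes>\<^bsub>A\<^esub> b) = sweedler2 A H' b (\<lambda>b1 b2. (p a \<triangleleft>' u b1) \<otimes>\<^bsub>H'\<^esub> p b2)) \<and>
     (\<forall>h\<in>carrier H. \<forall>g\<in>carrier H.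
        r (h \<otimes>\<^bsub>H\<^esub> g) = sweedler2 H A' h (\<lambda>h1 h2. r h1 \<otimes>\<^bsub>A'\<^esub> (v h2 \<triangleright>' r g))) \<and>
     (\<forall>h\<in>carrier H. \<forall>g\<in>carrier H.
        v (h \<otimes>\<^bsub>H\<^esub> g) = sweedler2 H H' g (\<lambda>g1 g2. (v h \<triangleleft>' r g1) \<otimes>\<^bsub>H'\<^esub> v g2)) \<and>
     (\<forall>h\<in>carrier H. \<forall>b\<in>carrier A.
        sweedler2 H A' h (\<lambda>h1 h2. r h1 \<otimes>\<^bsub>A'\<^esub> (v h2 \<triangleright>' u b)) =
        sweedler3 H A' h (\<lambda>h1 h2 h3. sweedler3 A A' b (\<lambda>b1 b2 b3.
          u (h1 \<triangleright> b1) \<otimes>\<^bsub>A'\<^esub> (p (h2 \<triangleright> b2) \<triangleright>' r (h3 \<triangleleft> b3))))) \<and>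
     (\<forall>h\<in>carrier H. \<forall>b\<in>carrier A.
        sweedler2 A H' b (\<lambda>b1 b2. (v h \<triangleleft>' u b1) \<otimes>\<^bsub>H'\<^esub> p b2) =
        sweedler3 H H' h (\<lambda>h1 h2 h3. sweedler3 A H' b (\<lambda>b1 b2 b3.
          (p (h1 \<triangleright> b1) \<triangleleft>' r (h2 \<triangleleft> b2)) \<otimes>\<^bsub>H'\<^esub> v (h3 \<triangleleft> b3))))}"

end

end

theory Submission imports Defs
begin

text \<open>
  Coalgebra maps from a coalgebra \<open>C\<close> into \<open>A' \<otimes> H'\<close> are easy to describe. Every \<open>x\<close> in
  \<open>A' \<otimes> H'\<close> equals \<open>\<pi>(x\<^sub>1) \<otimes> \<rho>(x\<^sub>2)\<close> and also \<open>\<pi>(x\<^sub>2) \<otimes> \<rho>(x\<^sub>1)\<close>, where \<open>\<pi> = id \<otimes> \<epsilon>\<close> and \<open>\<rho> = \<epsilon> \<otimes> id\<close> are the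
  two projections. Hence a coalgebra map \<open>f\<close> is \<open>c \<mapsto> \<pi>f(c\<^sub>1) \<otimes> \<rho>f(c\<^sub>2)\<close>, the components \<open>\<pi>f\<close> and \<open>\<rho>f\<close> are
  coalgebra maps that commute with each other, and every commuting pair arises in this way
  (\<open>coalg_hom_components\<close>, \<open>pairing_coalg_hom\<close>). In particular two coalgebra maps into
  \<open>A' \<otimes> H'\<close> are equal as soon as their components agree (\<open>coalg_hom_tensor_eqI\<close>).

  The multiplication of a bicrossed product is itself compatible with the coalgebra structure
  (\<open>sw_bmult\<close>), and its components are \<open>\<pi>(xy) = \<pi>(x\<^sub>1) (\<rho>(x\<^sub>2) \<triangleright> \<pi>(y))\<close> and
  \<open>\<rho>(xy) = (\<rho>(x) \<triangleleft> \<pi>(y\<^sub>1)) \<rho>(y\<^sub>2)\<close> (\<open>fst_bmult\<close>, \<open>snd_bmult\<close>). Associativity also follows from a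
  comparison of components.

  A morphism \<open>\<psi>\<close> of Hopf algebras from \<open>A \<bowtie> H\<close> to \<open>A' \<bowtie> H'\<close> is determined by its restrictions \<open>\<alpha>\<close> to \<open>A\<close>
  and \<open>\<beta>\<close> to \<open>H\<close>, because \<open>a \<bowtie> h = (a \<bowtie> 1)(1 \<bowtie> h)\<close>. Conversely, coalgebra maps \<open>\<alpha>\<close> and \<open>\<beta>\<close> that
  preserve units come from such a morphism exactly when both are multiplicative and
  \<open>\<beta>(h) \<alpha>(b) = \<alpha>(h\<^sub>1 \<triangleright> b\<^sub>1) \<beta>(h\<^sub>2 \<triangleleft> b\<^sub>2)\<close>. Write \<open>(u, p)\<close> and \<open>(r, v)\<close> for the components of \<open>\<alpha>\<close> and \<open>\<beta>\<close>. The
  first two conditions on a quadruple say that these pairs commute, so that \<open>\<alpha>\<close> and \<open>\<beta>\<close> can be rebuilt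
  from them. Both sides of the three algebraic identities are coalgebra maps, so each identity
  is equivalent to the equality of its two components; the resulting six equations are the
  remaining conditions on the quadruple (\<open>compatible_iff\<close>). The formula for
  \<open>\<psi>(a \<bowtie> h) = \<alpha>(a) \<beta>(h)\<close> is the product written out (\<open>product_formula\<close>).
\<close>

section \<open>The tensor product of modules\<close>

definition balanced ::
  "('k, 'n) ring_scheme \<Rightarrow> ('k, 'a, 'm) module_scheme \<Rightarrow> ('k, 'b, 'l) module_scheme
    \<Rightarrow> ('v, 'o) monoid_scheme \<Rightarrow> ('a \<Rightarrow> 'b \<Rightarrow> 'v) \<Rightarrow> bool" where
  "balanced K A B G f \<longleftrightarrow>
     (\<forall>a\<in>carrier A. \<forall>b\<in>carrier B. f a b \<in> carrier G) \<and>
     (\<forall>a\<in>carrier A. \<forall>a'\<in>carrier A. \<forall>b\<in>carrier B. f (a \<oplus>\<^bsub>A\<^esub> a') b = f a b \<otimes>\<^bsub>G\<^esub> f a' b) \<and>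
     (\<forall>a\<in>carrier A. \<forall>b\<in>carrier B. \<forall>b'\<in>carrier B. f a (b \<oplus>\<^bsub>B\<^esub> b') = f a b \<otimes>\<^bsub>G\<^esub> f a b') \<and>
     (\<forall>k\<in>carrier K. \<forall>a\<in>carrier A. \<forall>b\<in>carrier B. f (k \<odot>\<^bsub>A\<^esub> a) b = f a (k \<odot>\<^bsub>B\<^esub> b))"

text \<open>
  The value that \<^const>\<open>group_lift\<close> assigns to a single representative.
\<close>

definition frag_eval :: "('v, 'o) monoid_scheme \<Rightarrow> ('a \<Rightarrow> 'b \<Rightarrow> 'v) \<Rightarrow> ('a \<times> 'b \<Rightarrow>\<^sub>0 int) \<Rightarrow> 'v" where
  "frag_eval G f x = finprod G (\<lambda>(a, b). f a b [^]\<^bsub>G\<^esub> Poly_Mapping.lookup x (a, b))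
                            (Poly_Mapping.keys x)"

lemma group_lift_frag_eval: "group_lift G f X = the_elem (frag_eval G f ` X)"
  unfolding group_lift_def frag_eval_def ..

text \<open>
  The product may be taken over any larger finite set, since the additional exponents are zero.
  This brings the values at \<open>x\<close>, \<open>y\<close> and \<open>x + y\<close> to a common index set.
\<close>

lemma (in comm_group) frag_eval_superset:
  assumes f: "\<And>a b. (a, b) \<in> S \<Longrightarrow> f a b \<in> carrier G"
    and S: "finite S" "Poly_Mapping.keys x \<subseteq> S"
  shows "frag_eval G f x = finprod G (\<lambda>(a, b). f a b [^] Poly_Mapping.lookup x (a, b)) S"
  unfolding frag_eval_def
  by (rule finprod_mono_neutral_cong_left)
     (use f S in \<open>auto simp: in_keys_iff intro: int_pow_closed\<close>)

lemma (in comm_group) frag_eval_hom: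
  assumes f: "\<And>a b. (a, b) \<in> S \<Longrightarrow> f a b \<in> carrier G"
  shows "frag_eval G f \<in> hom (free_Abelian_group S) G"
proof (rule homI)
  fix x assume "x \<in> carrier (free_Abelian_group S)"
  then show "frag_eval G f x \<in> carrier G"
    unfolding frag_eval_def by (intro finprod_closed) (use f in \<open>auto intro: int_pow_closed\<close>)
next
  fix x y assume xy: "x \<in> carrier (free_Abelian_group S)" "y \<in> carrier (free_Abelian_group S)"
  let ?S = "Poly_Mapping.keys x \<union> Poly_Mapping.keys y"
  have S: "f a b \<in> carrier G" if "(a, b) \<in> ?S" for a b
    using that f xy by auto
  have "frag_eval G f (x + y)
      = finprod G (\<lambda>(a, b). f a b [^] Poly_Mapping.lookup (x + y) (a, b)) ?S"
    by (rule frag_eval_superset) (use S Poly_Mapping.keys_add[of x y] in auto)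
  also have "\<dots> = finprod G (\<lambda>z. (\<lambda>(a, b). f a b [^] Poly_Mapping.lookup x (a, b)) z
                 \<otimes> (\<lambda>(a, b). f a b [^] Poly_Mapping.lookup y (a, b)) z) ?S"
    by (rule finprod_cong') (use S in \<open>auto simp: lookup_add int_pow_mult\<close>)
  also have "\<dots> = finprod G (\<lambda>(a, b). f a b [^] Poly_Mapping.lookup x (a, b)) ?S
      \<otimes> finprod G (\<lambda>(a, b). f a b [^] Poly_Mapping.lookup y (a, b)) ?S"
    by (rule finprod_multf) (use S in auto)
  also have "\<dots> = frag_eval G f x \<otimes> frag_eval G f y"
    using frag_eval_superset[of ?S f x] frag_eval_superset[of ?S f y] S by simp
  finally show "frag_eval G f (x \<otimes>\<^bsub>free_Abelian_group S\<^esub> y) = frag_eval G f x \<otimes> frag_eval G f y"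
    by simp
qed

lemma (in comm_group) frag_eval_frag_of:
  assumes "f a b \<in> carrier G"
  shows "frag_eval G f (frag_of (a, b)) = f a b"
  using frag_eval_superset[of "{(a, b)}" f "frag_of (a, b)"] assms
  by (simp add: finprod_singleton[of "(a, b)" "{(a, b)}" "\<lambda>(a, b). f a b [^] (1::int)"])

locale tensor_product = A: module K A + B: module K B
  for K :: "('k, 'n) ring_scheme" and A :: "('k, 'a, 'm) module_scheme"
    and B :: "('k, 'b, 'l) module_scheme"
begin

abbreviation "F \<equiv> free_Abelian_group (carrier A \<times> carrier B)"
abbreviation "N \<equiv> tensor_null K A B"
abbreviation "TG \<equiv> tensor_group K A B"

sublocale F: comm_group F by (rule abelian_free_Abelian_group)

lemma relations_subset: "tensor_relations K A B \<subseteq> carrier F"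
  unfolding tensor_relations_def
  by (auto dest!: subsetD[OF keys_diff])

lemma null_normal: "N \<lhd> F"
  unfolding tensor_null_def
  by (rule F.subgroup_imp_normal[OF F.generate_is_subgroup[OF relations_subset]])

lemma tensor_comm_group: "comm_group TG"
  unfolding tensor_group_def
  by (rule comm_group.abelian_FactGroup[OF F.comm_group_axioms])
     (use null_normal in \<open>simp add: normal_imp_subgroup\<close>)

sublocale TG: comm_group TG by (rule tensor_comm_group)

lemma coset_closed: "x \<in> carrier F \<Longrightarrow> N #>\<^bsub>F\<^esub> x \<in> carrier TG"
  unfolding tensor_group_def FactGroup_def RCOSETS_def by auto

lemma tens_group_closed: "\<lbrakk>a \<in> carrier A; b \<in> carrier B\<rbrakk> \<Longrightarrow> tens K A B a b \<in> carrier TG"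
  unfolding tens_def by (rule coset_closed) simp

lemma coset_mult:
  "\<lbrakk>x \<in> carrier F; y \<in> carrier F\<rbrakk>
    \<Longrightarrow> (N #>\<^bsub>F\<^esub> x) \<otimes>\<^bsub>TG\<^esub> (N #>\<^bsub>F\<^esub> y) = N #>\<^bsub>F\<^esub> (x + y)"
  using normal.rcos_sum[OF null_normal] unfolding tensor_group_def FactGroup_def by simp

lemma coset_eqI:
  assumes "x \<in> carrier F" "y \<in> carrier F" "x - y \<in> N"
  shows "N #>\<^bsub>F\<^esub> x = N #>\<^bsub>F\<^esub> y"
proof -
  have "x = (x - y) \<otimes>\<^bsub>F\<^esub> y" by simp
  then have "x \<in> N #>\<^bsub>F\<^esub> y"
    using assms(3) unfolding r_coset_def by blast
  then show ?thesis
    using F.repr_independence[OF _ assms(2) normal_imp_subgroup[OF null_normal]] by simp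
qed

lemma relation_in_null: "x \<in> tensor_relations K A B \<Longrightarrow> x \<in> N"
  unfolding tensor_null_def by (rule generate.incl)

lemma tens_add_left_group:
  assumes "a \<in> carrier A" "a' \<in> carrier A" "b \<in> carrier B"
  shows "tens K A B (a \<oplus>\<^bsub>A\<^esub> a') b = tens K A B a b \<otimes>\<^bsub>TG\<^esub> tens K A B a' b"
proof -
  have "frag_of (a \<oplus>\<^bsub>A\<^esub> a', b) - (frag_of (a, b) + frag_of (a', b)) \<in> tensor_relations K A B"
    using assms unfolding tensor_relations_def diff_diff_eq[symmetric] by blast
  from coset_eqI[OF _ _ relation_in_null[OF this]] show ?thesis
    using F.m_closed[of "frag_of (a, b)" "frag_of (a', b)"] assms
    unfolding tens_def by (simp add: coset_mult)
qed

lemma tens_add_right_group: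
  assumes "a \<in> carrier A" "b \<in> carrier B" "b' \<in> carrier B"
  shows "tens K A B a (b \<oplus>\<^bsub>B\<^esub> b') = tens K A B a b \<otimes>\<^bsub>TG\<^esub> tens K A B a b'"
proof -
  have "frag_of (a, b \<oplus>\<^bsub>B\<^esub> b') - (frag_of (a, b) + frag_of (a, b')) \<in> tensor_relations K A B"
    using assms unfolding tensor_relations_def diff_diff_eq[symmetric] by blast
  from coset_eqI[OF _ _ relation_in_null[OF this]] show ?thesis
    using F.m_closed[of "frag_of (a, b)" "frag_of (a, b')"] assms
    unfolding tens_def by (simp add: coset_mult)
qed

lemma tens_smult_swap:
  assumes "k \<in> carrier K" "a \<in> carrier A" "b \<in> carrier B"
  shows "tens K A B (k \<odot>\<^bsub>A\<^esub> a) b = tens K A B a (k \<odot>\<^bsub>B\<^esub> b)"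
proof -
  have "frag_of (k \<odot>\<^bsub>A\<^esub> a, b) - frag_of (a, k \<odot>\<^bsub>B\<^esub> b) \<in> tensor_relations K A B"
    using assms unfolding tensor_relations_def by blast
  from coset_eqI[OF _ _ relation_in_null[OF this]] show ?thesis
    using assms unfolding tens_def by simp
qed

text \<open>
  Cosets of generators of the free abelian group are pure tensors, so the subgroup generated by
  the pure tensors is everything.
\<close>

lemma tensor_group_induct [consumes 1, case_names tens mult inv]:
  assumes X: "X \<in> carrier TG"
    and t: "\<And>a b. \<lbrakk>a \<in> carrier A; b \<in> carrier B\<rbrakk> \<Longrightarrow> P (tens K A B a b)"
    and m: "\<And>X Y. \<lbrakk>X \<in> carrier TG; Y \<in> carrier TG; P X; P Y\<rbrakk> \<Longrightarrow> P (X \<otimes>\<^bsub>TG\<^esub> Y)"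
    and i: "\<And>X. \<lbrakk>X \<in> carrier TG; P X\<rbrakk> \<Longrightarrow> P (inv\<^bsub>TG\<^esub> X)"
  shows "P X"
proof -
  obtain x where x: "x \<in> carrier F" and X: "X = N #>\<^bsub>F\<^esub> x"
    using X unfolding tensor_group_def FactGroup_def RCOSETS_def by auto
  let ?q = "\<lambda>x. N #>\<^bsub>F\<^esub> x"
  interpret q: group_hom F TG ?q
    by (unfold_locales, rule homI) (use coset_closed coset_mult in auto)
  have "P (?q x)"
    using x[unfolded carrier_free_Abelian_group_iff]
  proof (induction x rule: free_Abelian_group_induct[consumes 1, case_names zero diff of])
    case zero
    have "P (tens K A B \<zero>\<^bsub>A\<^esub> \<zero>\<^bsub>B\<^esub> \<otimes>\<^bsub>TG\<^esub> inv\<^bsub>TG\<^esub> tens K A B \<zero>\<^bsub>A\<^esub> \<zero>\<^bsub>B\<^esub>)"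
      by (intro t m i tens_group_closed TG.inv_closed) auto
    then show ?case
      using q.hom_one by (simp add: tens_group_closed)
  next
    case (diff x y)
    have "?q (x \<otimes>\<^bsub>F\<^esub> inv\<^bsub>F\<^esub> y) = ?q x \<otimes>\<^bsub>TG\<^esub> inv\<^bsub>TG\<^esub> (?q y)"
      using diff q.hom_mult[of x "inv\<^bsub>F\<^esub> y"] q.hom_inv[of y] by simp
    moreover have "P (?q x \<otimes>\<^bsub>TG\<^esub> inv\<^bsub>TG\<^esub> (?q y))"
      using diff by (intro m i TG.inv_closed coset_closed) auto
    ultimately show ?case using diff by simp
  next
    case (of p)
    then show ?case using t[of "fst p" "snd p"] unfolding tens_def by auto
  qed
  with X show ?thesis by simp
qed

text \<open>
  Universal property of the tensor product: evaluation of representatives kills the bilinearity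
  relations, hence is constant on cosets, and the quotient map that it induces is
  \<^const>\<open>group_lift\<close>.
\<close>

lemma
  assumes G: "comm_group G" and f: "balanced K A B G f"
  shows group_lift_hom: "group_lift G f \<in> hom TG G"
    and group_lift_tens: "\<And>a b. \<lbrakk>a \<in> carrier A; b \<in> carrier B\<rbrakk> \<Longrightarrow> group_lift G f (tens K A B a b) = f a b"
proof -
  interpret G: comm_group G by (rule G)
  let ?e = "frag_eval G f"
  have cl: "f a b \<in> carrier G" if "a \<in> carrier A" "b \<in> carrier B" for a b
    using f that unfolding balanced_def by blast
  interpret e: group_hom F G ?e
    using G.frag_eval_hom[of "carrier A \<times> carrier B" f] cl
    by unfold_locales auto
  have fr: "?e (frag_of (a, b)) = f a b" if "a \<in> carrier A" "b \<in> carrier B" for a b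
    by (rule G.frag_eval_frag_of) (rule cl[OF that])
  have di: "?e (x - y) = ?e x \<otimes>\<^bsub>G\<^esub> inv\<^bsub>G\<^esub> (?e y)" if "x \<in> carrier F" "y \<in> carrier F" for x y
    using that e.hom_mult[of x "inv\<^bsub>F\<^esub> y"] e.hom_inv[of y] by simp
  have k2: "?e (x - y - z) = \<one>\<^bsub>G\<^esub>"
    if "x \<in> carrier F" "y \<in> carrier F" "z \<in> carrier F" "?e x = ?e y \<otimes>\<^bsub>G\<^esub> ?e z" for x y z
  proof -
    have "x - y \<in> carrier F" using that F.m_closed[of x "inv\<^bsub>F\<^esub> y"] by simp
    then have "?e (x - y - z) = ?e y \<otimes>\<^bsub>G\<^esub> ?e z \<otimes>\<^bsub>G\<^esub> inv\<^bsub>G\<^esub> (?e y \<otimes>\<^bsub>G\<^esub> ?e z)"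
      using that e.hom_closed
      by (simp add: di G.inv_mult G.m_assoc del: carrier_free_Abelian_group_iff)
    then show ?thesis
      using that e.hom_closed G.r_inv by (simp del: carrier_free_Abelian_group_iff)
  qed
  have "tensor_relations K A B \<subseteq> kernel F G ?e"
  proof
    fix x assume x: "x \<in> tensor_relations K A B"
    then have xF: "x \<in> carrier F" using relations_subset by blast
    from x have "?e x = \<one>\<^bsub>G\<^esub>"
      unfolding tensor_relations_def
    proof (elim UnE CollectE exE conjE)
      fix a a' b assume *: "x = frag_of (a \<oplus>\<^bsub>A\<^esub> a', b) - frag_of (a, b) - frag_of (a', b)"
        "a \<in> carrier A" "a' \<in> carrier A" "b \<in> carrier B"
      then show ?thesis
        unfolding *(1) by (intro k2) (use f in \<open>auto simp: fr balanced_def\<close>)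
    next
      fix a b b' assume *: "x = frag_of (a, b \<oplus>\<^bsub>B\<^esub> b') - frag_of (a, b) - frag_of (a, b')"
        "a \<in> carrier A" "b \<in> carrier B" "b' \<in> carrier B"
      then show ?thesis
        unfolding *(1) by (intro k2) (use f in \<open>auto simp: fr balanced_def\<close>)
    next
      fix k a b assume *: "x = frag_of (k \<odot>\<^bsub>A\<^esub> a, b) - frag_of (a, k \<odot>\<^bsub>B\<^esub> b)"
        "k \<in> carrier K" "a \<in> carrier A" "b \<in> carrier B"
      then show ?thesis
        unfolding *(1) by (subst di) (use f cl in \<open>auto simp: fr balanced_def\<close>)
    qed
    with xF show "x \<in> kernel F G ?e" unfolding kernel_def by simp
  qed
  then have N: "N \<subseteq> kernel F G ?e"
    unfolding tensor_null_def
    by (rule F.generate_subgroup_incl) (rule e.subgroup_kernel)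
  have val: "group_lift G f (N #>\<^bsub>F\<^esub> x) = ?e x" if x: "x \<in> carrier F" for x
    unfolding group_lift_frag_eval
  proof (rule the_elem_image_unique)
    show "N #>\<^bsub>F\<^esub> x \<noteq> {}"
      using F.rcos_self[OF x normal_imp_subgroup[OF null_normal]] by blast
    fix y assume "y \<in> N #>\<^bsub>F\<^esub> x"
    then obtain n where n: "n \<in> N" "y = n \<otimes>\<^bsub>F\<^esub> x" unfolding r_coset_def by blast
    with N have "n \<in> carrier F" "?e n = \<one>\<^bsub>G\<^esub>" unfolding kernel_def by auto
    then show "?e y = ?e x"
      unfolding n(2) using x by (simp del: carrier_free_Abelian_group_iff mult_free_Abelian_group)
  qed
  obtain g where g: "g \<in> hom TG G" "\<And>x. x \<in> carrier F \<Longrightarrow> g (N #>\<^bsub>F\<^esub> x) = ?e x"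
    using e.FactGroup_universal_kernel[OF null_normal N] unfolding tensor_group_def by metis
  have ge: "group_lift G f X = g X" if "X \<in> carrier TG" for X
    using that g(2) val unfolding tensor_group_def FactGroup_def RCOSETS_def by auto
  show "group_lift G f \<in> hom TG G"
  proof (rule homI)
    fix X Y assume XY: "X \<in> carrier TG" "Y \<in> carrier TG"
    then show "group_lift G f X \<in> carrier G" using ge g(1) hom_in_carrier by metis
    show "group_lift G f (X \<otimes>\<^bsub>TG\<^esub> Y) = group_lift G f X \<otimes>\<^bsub>G\<^esub> group_lift G f Y"
      using XY ge g(1) hom_mult[OF g(1)] TG.m_closed by metis
  qed
  show "group_lift G f (tens K A B a b) = f a b" if "a \<in> carrier A" "b \<in> carrier B" for a b
    unfolding tens_def using val[of "frag_of (a, b)"] fr that by simp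
qed

lemma hom_eq_on_tens:
  assumes G: "group G" and h: "h \<in> hom TG G" "h' \<in> hom TG G"
    and eq: "\<And>a b. \<lbrakk>a \<in> carrier A; b \<in> carrier B\<rbrakk> \<Longrightarrow> h (tens K A B a b) = h' (tens K A B a b)"
    and X: "X \<in> carrier TG"
  shows "h X = h' X"
proof -
  interpret h: group_hom TG G h using G h by (simp add: group_hom_def group_hom_axioms_def)
  interpret h': group_hom TG G h' using G h by (simp add: group_hom_def group_hom_axioms_def)
  from X show ?thesis
    by (induction X rule: tensor_group_induct) (auto simp: eq)
qed

subsection \<open>Module structure\<close>

lemma tensor_alg_sel:
  "carrier (tensor_alg K A B) = carrier TG"
  "zero (tensor_alg K A B) = \<one>\<^bsub>TG\<^esub>"
  "add (tensor_alg K A B) = monoid.mult TG"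
  "smult (tensor_alg K A B) = (\<lambda>k. group_lift TG (\<lambda>a b. tens K A B (k \<odot>\<^bsub>A\<^esub> a) b))"
  by (simp_all add: tensor_alg_def Let_def)

text \<open>
  Commutativity of the scalars is what makes scalar multiplication on the left factor balanced.
\<close>

lemma smult_balanced:
  assumes k: "k \<in> carrier K"
  shows "balanced K A B TG (\<lambda>a b. tens K A B (k \<odot>\<^bsub>A\<^esub> a) b)"
  unfolding balanced_def
proof (intro conjI ballI)
  fix l a b assume *: "l \<in> carrier K" "a \<in> carrier A" "b \<in> carrier B"
  have "k \<odot>\<^bsub>A\<^esub> (l \<odot>\<^bsub>A\<^esub> a) = l \<odot>\<^bsub>A\<^esub> (k \<odot>\<^bsub>A\<^esub> a)"
    using * k by (metis A.smult_assoc1 A.R.m_comm)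
  then show "tens K A B (k \<odot>\<^bsub>A\<^esub> (l \<odot>\<^bsub>A\<^esub> a)) b = tens K A B (k \<odot>\<^bsub>A\<^esub> a) (l \<odot>\<^bsub>B\<^esub> b)"
    using * k tens_smult_swap[of l "k \<odot>\<^bsub>A\<^esub> a" b] by simp
qed (use k in \<open>auto simp: tens_group_closed A.smult_r_distr tens_add_left_group tens_add_right_group\<close>)

lemma smult_hom: "k \<in> carrier K \<Longrightarrow> smult (tensor_alg K A B) k \<in> hom TG TG"
  unfolding tensor_alg_sel by (rule group_lift_hom[OF tensor_comm_group smult_balanced])

lemma smult_tens_left:
  "\<lbrakk>k \<in> carrier K; a \<in> carrier A; b \<in> carrier B\<rbrakk>
    \<Longrightarrow> k \<odot>\<^bsub>tensor_alg K A B\<^esub> tens K A B a b = tens K A B (k \<odot>\<^bsub>A\<^esub> a) b"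
  unfolding tensor_alg_sel by (rule group_lift_tens[OF tensor_comm_group smult_balanced])

lemma add_monoid_tensor: "comm_group (add_monoid (tensor_alg K A B))"
proof (rule comm_groupI)
  fix X assume "X \<in> carrier (add_monoid (tensor_alg K A B))"
  then show "\<exists>Y\<in>carrier (add_monoid (tensor_alg K A B)).
      Y \<otimes>\<^bsub>add_monoid (tensor_alg K A B)\<^esub> X = \<one>\<^bsub>add_monoid (tensor_alg K A B)\<^esub>"
    using TG.l_inv_ex by (simp add: tensor_alg_sel)
qed (simp_all add: tensor_alg_sel TG.m_ac)

text \<open>
  All module laws are equalities between additive maps, so they need to be checked on pure
  tensors only, where they are inherited from the left factor.
\<close>

lemma module_tensor: "module K (tensor_alg K A B)"
proof -
  let ?T = "tensor_alg K A B"
  have "abelian_group ?T"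
    using add_monoid_tensor
    by (simp add: abelian_group_def abelian_group_axioms_def abelian_monoid_def comm_group_def)
  moreover note sh = smult_hom[THEN hom_in_carrier] smult_hom[THEN hom_mult]
  have c: "comp (smult ?T k) (smult ?T l) \<in> hom TG TG" if "k \<in> carrier K" "l \<in> carrier K" for k l
    using that smult_hom by (meson hom_compose)
  have s: "(\<lambda>X. smult ?T k X \<otimes>\<^bsub>TG\<^esub> smult ?T l X) \<in> hom TG TG"
    if "k \<in> carrier K" "l \<in> carrier K" for k l
    by (rule homI) (use that sh in \<open>auto simp: TG.m_ac\<close>)
  have i: "(\<lambda>X. X) \<in> hom TG TG" by (rule homI) auto
  note E = hom_eq_on_tens[OF TG.is_group]
  show ?thesis
  proof (rule moduleI)
    fix k l X assume *: "k \<in> carrier K" "l \<in> carrier K" "X \<in> carrier ?T"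
    then have X: "X \<in> carrier TG" by (simp add: tensor_alg_sel)
    show "(k \<oplus>\<^bsub>K\<^esub> l) \<odot>\<^bsub>?T\<^esub> X = k \<odot>\<^bsub>?T\<^esub> X \<oplus>\<^bsub>?T\<^esub> l \<odot>\<^bsub>?T\<^esub> X"
      using E[OF smult_hom s _ X, of "k \<oplus>\<^bsub>K\<^esub> l" k l] *
      by (simp add: smult_tens_left A.smult_l_distr tens_add_left_group tensor_alg_sel(3))
    show "(k \<otimes>\<^bsub>K\<^esub> l) \<odot>\<^bsub>?T\<^esub> X = k \<odot>\<^bsub>?T\<^esub> (l \<odot>\<^bsub>?T\<^esub> X)"
      using E[OF smult_hom c _ X, of "k \<otimes>\<^bsub>K\<^esub> l" k l] *
      by (simp add: smult_tens_left A.smult_assoc1)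
  next
    fix X assume *: "X \<in> carrier ?T"
    then have X: "X \<in> carrier TG" by (simp add: tensor_alg_sel)
    show "\<one>\<^bsub>K\<^esub> \<odot>\<^bsub>?T\<^esub> X = X"
      using E[OF smult_hom i _ X, of "\<one>\<^bsub>K\<^esub>"] by (simp add: smult_tens_left)
  qed (use sh in \<open>auto simp: tensor_alg_sel(1-3) A.R.cring_axioms \<open>abelian_group ?T\<close>\<close>)
qed

end

section \<open>Linear and bilinear maps\<close>

definition bilin ::
  "('k, 'n) ring_scheme \<Rightarrow> ('k, 'a, 'm) module_scheme \<Rightarrow> ('k, 'b, 'l) module_scheme
    \<Rightarrow> ('k, 'v, 'o) module_scheme \<Rightarrow> ('a \<Rightarrow> 'b \<Rightarrow> 'v) \<Rightarrow> bool" where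
  "bilin K A B V f \<longleftrightarrow>
     (\<forall>a\<in>carrier A. (\<lambda>b. f a b) \<in> linear_hom K B V) \<and>
     (\<forall>b\<in>carrier B. (\<lambda>a. f a b) \<in> linear_hom K A V)"

text \<open>
  The part of the coalgebra structure that makes Sweedler sums well behaved. It is kept apart from
  coassociativity and counitality because these laws, for a tensor product of coalgebras, are
  proved by calculations with Sweedler sums over that tensor product.
\<close>

definition comultiplication ::
  "('k, 'n) ring_scheme \<Rightarrow> ('k, 'c, 'm) hopf_scheme \<Rightarrow> bool" where
  "comultiplication K C \<longleftrightarrow> module K C \<and> comult C \<in> linear_hom K C (tensor_alg K C C)"

abbreviation "sw \<equiv> sweedler2"

locale over_ring = cring K for K :: "('k, 'n) ring_scheme"
begin

lemmas scalar_ac = m_ac m_closed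

lemma linear_homI:
  assumes "\<And>x. x \<in> carrier V \<Longrightarrow> f x \<in> carrier W"
    and "\<And>x y. \<lbrakk>x \<in> carrier V; y \<in> carrier V\<rbrakk> \<Longrightarrow> f (x \<oplus>\<^bsub>V\<^esub> y) = f x \<oplus>\<^bsub>W\<^esub> f y"
    and "\<And>k x. \<lbrakk>k \<in> carrier K; x \<in> carrier V\<rbrakk> \<Longrightarrow> f (k \<odot>\<^bsub>V\<^esub> x) = k \<odot>\<^bsub>W\<^esub> f x"
  shows "f \<in> linear_hom K V W"
  using assms unfolding linear_hom_def by auto

lemma linear_hom_closed: "\<lbrakk>f \<in> linear_hom K V W; x \<in> carrier V\<rbrakk> \<Longrightarrow> f x \<in> carrier W"
  unfolding linear_hom_def by auto

lemma linear_hom_add: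
  "\<lbrakk>f \<in> linear_hom K V W; x \<in> carrier V; y \<in> carrier V\<rbrakk> \<Longrightarrow> f (x \<oplus>\<^bsub>V\<^esub> y) = f x \<oplus>\<^bsub>W\<^esub> f y"
  unfolding linear_hom_def by auto

lemma linear_hom_smult:
  "\<lbrakk>f \<in> linear_hom K V W; k \<in> carrier K; x \<in> carrier V\<rbrakk> \<Longrightarrow> f (k \<odot>\<^bsub>V\<^esub> x) = k \<odot>\<^bsub>W\<^esub> f x"
  unfolding linear_hom_def by auto

lemma linear_hom_id: "(\<lambda>x. x) \<in> linear_hom K V V"
  by (rule linear_homI) auto

lemma linear_hom_comp:
  "\<lbrakk>f \<in> linear_hom K V W; g \<in> linear_hom K X V\<rbrakk> \<Longrightarrow> (\<lambda>x. f (g x)) \<in> linear_hom K X W"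
  by (rule linear_homI) (simp_all add: linear_hom_closed linear_hom_add linear_hom_smult)

lemma linear_hom_cong_on:
  assumes "f \<in> linear_hom K V W" "module K V" "\<And>x. x \<in> carrier V \<Longrightarrow> g x = f x"
  shows "g \<in> linear_hom K V W"
proof -
  interpret V: module K V by fact
  from assms(1,3) show ?thesis unfolding linear_hom_def by auto
qed

lemma linear_hom_cong_structure:
  assumes "carrier V' = carrier V" "add V' = add V" "smult V' = smult V"
    and "carrier W' = carrier W" "add W' = add W" "smult W' = smult W"
  shows "linear_hom K V' W' = linear_hom K V W"
  unfolding linear_hom_def assms ..

lemma module_cong_structure:
  assumes "module K V" "carrier W = carrier V" "add W = add V" "zero W = zero V" "smult W = smult V"
  shows "module K W"
proof -
  interpret V: module K V by fact
  have "abelian_group W"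
    by (rule abelian_groupI) (simp_all add: assms V.M.a_ac V.M.add.l_inv_ex)
  then show ?thesis
    by (intro moduleI)
       (simp_all add: assms cring_axioms V.smult_l_distr V.smult_r_distr V.smult_assoc1)
qed

lemma module_ground: "module K (ground K)"
proof -
  have "abelian_group (ground K)"
    by (rule abelian_groupI) (simp_all add: ground_def a_ac add.l_inv_ex)
  then show ?thesis
    by (intro moduleI) (simp_all add: ground_def cring_axioms l_distr r_distr m_assoc)
qed

lemma carrier_ground [simp]: "carrier (ground K) = carrier K"
  by (simp add: ground_def)

lemma linear_hom_plus:
  assumes "module K V" "f \<in> linear_hom K X V" "g \<in> linear_hom K X V"
  shows "(\<lambda>x. f x \<oplus>\<^bsub>V\<^esub> g x) \<in> linear_hom K X V"
proof -
  interpret V: module K V by fact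
  note c = assms(2,3)[THEN linear_hom_closed]
  show ?thesis
    by (rule linear_homI)
       (simp_all add: assms(2,3)[THEN linear_hom_add] assms(2,3)[THEN linear_hom_smult]
         c V.smult_r_distr V.M.add.m_ac)
qed

lemma bilinI:
  assumes "\<And>a. a \<in> carrier A \<Longrightarrow> (\<lambda>b. f a b) \<in> linear_hom K B V"
    and "\<And>b. b \<in> carrier B \<Longrightarrow> (\<lambda>a. f a b) \<in> linear_hom K A V"
  shows "bilin K A B V f"
  using assms unfolding bilin_def by auto

lemma bilin_right: "\<lbrakk>bilin K A B V f; a \<in> carrier A\<rbrakk> \<Longrightarrow> (\<lambda>b. f a b) \<in> linear_hom K B V"
  and bilin_left: "\<lbrakk>bilin K A B V f; b \<in> carrier B\<rbrakk> \<Longrightarrow> (\<lambda>a. f a b) \<in> linear_hom K A V"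
  unfolding bilin_def by auto

lemma bilin_closed: "\<lbrakk>bilin K A B V f; a \<in> carrier A; b \<in> carrier B\<rbrakk> \<Longrightarrow> f a b \<in> carrier V"
  by (drule bilin_right) (auto dest: linear_hom_closed)

lemma bilin_compose:
  "\<lbrakk>g \<in> linear_hom K V W; bilin K A B V f\<rbrakk> \<Longrightarrow> bilin K A B W (\<lambda>a b. g (f a b))"
  unfolding bilin_def by (auto intro: linear_hom_comp)

lemma bilin_cong_on:
  assumes "bilin K A B V f" "module K A" "module K B"
    and "\<And>a b. \<lbrakk>a \<in> carrier A; b \<in> carrier B\<rbrakk> \<Longrightarrow> g a b = f a b"
  shows "bilin K A B V g"
  using assms unfolding bilin_def by (auto intro: linear_hom_cong_on)

lemma bilin_balanced:
  assumes "bilin K A B V f"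
  shows "balanced K A B (add_monoid V) f"
  using assms unfolding bilin_def balanced_def linear_hom_def by (auto simp: Pi_def)

subsection \<open>Linear maps out of a tensor product\<close>

lemma tensor_alg_module: "\<lbrakk>module K A; module K B\<rbrakk> \<Longrightarrow> module K (tensor_alg K A B)"
  by (intro tensor_product.module_tensor tensor_product.intro)

lemma tens_closed:
  assumes "module K A" "module K B" "a \<in> carrier A" "b \<in> carrier B"
  shows "tens K A B a b \<in> carrier (tensor_alg K A B)"
  by (simp add: assms tensor_product.tens_group_closed tensor_product.intro
      tensor_product.tensor_alg_sel)

lemma bilin_tens:
  assumes "module K A" "module K B"
  shows "bilin K A B (tensor_alg K A B) (tens K A B)"
proof -
  interpret tensor_product K A B using assms by (rule tensor_product.intro)
  show ?thesis
    by (intro bilinI linear_homI)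
      (simp_all add: tens_closed assms tens_add_left_group tens_add_right_group
        tensor_alg_sel(3) smult_tens_left tens_smult_swap)
qed

lemma tlift_linear:
  assumes "module K A" "module K B" "module K V" "bilin K A B V f"
  shows "tlift V f \<in> linear_hom K (tensor_alg K A B) V" (is ?lin)
    and "\<And>a b. \<lbrakk>a \<in> carrier A; b \<in> carrier B\<rbrakk> \<Longrightarrow> tlift V f (tens K A B a b) = f a b"
proof -
  interpret tensor_product K A B using assms(1,2) by (rule tensor_product.intro)
  interpret V: module K V by fact
  note cg = V.M.a_comm_group
  note b = bilin_balanced[OF assms(4)]
  note h = group_lift_hom[OF cg b]
  show t: "tlift V f (tens K A B a b) = f a b" if "a \<in> carrier A" "b \<in> carrier B" for a b
    unfolding tlift_def by (rule group_lift_tens[OF cg b that])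
  show ?lin
  proof (rule linear_homI)
    fix X assume "X \<in> carrier (tensor_alg K A B)"
    then show "tlift V f X \<in> carrier V"
      using hom_in_carrier[OF h] by (simp add: tlift_def tensor_alg_sel)
  next
    fix X Y assume "X \<in> carrier (tensor_alg K A B)" "Y \<in> carrier (tensor_alg K A B)"
    then show "tlift V f (X \<oplus>\<^bsub>tensor_alg K A B\<^esub> Y) = tlift V f X \<oplus>\<^bsub>V\<^esub> tlift V f Y"
      using hom_mult[OF h] by (simp add: tlift_def tensor_alg_sel)
  next
    fix k X assume k: "k \<in> carrier K" and X: "X \<in> carrier (tensor_alg K A B)"
    have s: "smult V k \<in> hom (add_monoid V) (add_monoid V)"
      by (rule homI) (simp_all add: k V.smult_r_distr)
    have "(tlift V f \<circ> smult (tensor_alg K A B) k) X = (smult V k \<circ> tlift V f) X"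
    proof (rule hom_eq_on_tens[where G="add_monoid V"])
      show "group (add_monoid V)" using cg by (simp add: comm_group_def)
      show "tlift V f \<circ> (\<odot>\<^bsub>tensor_alg K A B\<^esub>) k \<in> hom TG (add_monoid V)"
        unfolding tlift_def by (rule hom_compose[OF smult_hom[OF k] h])
      show "(\<odot>\<^bsub>V\<^esub>) k \<circ> tlift V f \<in> hom TG (add_monoid V)"
        unfolding tlift_def by (rule hom_compose[OF h s])
      show "X \<in> carrier TG" using X by (simp add: tensor_alg_sel)
      show "(tlift V f \<circ> (\<odot>\<^bsub>tensor_alg K A B\<^esub>) k) (tens K A B a b) =
          ((\<odot>\<^bsub>V\<^esub>) k \<circ> tlift V f) (tens K A B a b)" if ab: "a \<in> carrier A" "b \<in> carrier B" for a b
        using ab k linear_hom_smult[OF bilin_left[OF assms(4) ab(2)] k ab(1)]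
        by (simp add: smult_tens_left t)
    qed
    then show "tlift V f (k \<odot>\<^bsub>tensor_alg K A B\<^esub> X) = k \<odot>\<^bsub>V\<^esub> tlift V f X" by simp
  qed
qed

text \<open>
  Additive inverses need no separate case: the inverse of \<open>a \<otimes> b\<close> is the pure tensor \<open>(-a) \<otimes> b\<close>.
\<close>

lemma tensor_induct [consumes 3, case_names tens add]:
  assumes mA: "module K A" and mB: "module K B" and X: "X \<in> carrier (tensor_alg K A B)"
    and t: "\<And>a b. \<lbrakk>a \<in> carrier A; b \<in> carrier B\<rbrakk> \<Longrightarrow> P (tens K A B a b)"
    and p: "\<And>X Y. \<lbrakk>X \<in> carrier (tensor_alg K A B); Y \<in> carrier (tensor_alg K A B); P X; P Y\<rbrakk>
        \<Longrightarrow> P (X \<oplus>\<^bsub>tensor_alg K A B\<^esub> Y)"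
  shows "P X"
proof -
  interpret tensor_product K A B using mA mB by (rule tensor_product.intro)
  have inv: "inv\<^bsub>TG\<^esub> tens K A B a b = tens K A B (\<ominus>\<^bsub>A\<^esub> a) b"
    if ab: "a \<in> carrier A" "b \<in> carrier B" for a b
  proof (rule TG.inv_equality)
    have "tens K A B \<zero>\<^bsub>A\<^esub> b \<otimes>\<^bsub>TG\<^esub> tens K A B \<zero>\<^bsub>A\<^esub> b = tens K A B \<zero>\<^bsub>A\<^esub> b"
      using tens_add_left_group[of "\<zero>\<^bsub>A\<^esub>" "\<zero>\<^bsub>A\<^esub>" b] ab by simp
    then have "tens K A B \<zero>\<^bsub>A\<^esub> b = \<one>\<^bsub>TG\<^esub>"
      using TG.l_cancel_one tens_group_closed[OF A.M.zero_closed ab(2)] by blast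
    then show "tens K A B (\<ominus>\<^bsub>A\<^esub> a) b \<otimes>\<^bsub>TG\<^esub> tens K A B a b = \<one>\<^bsub>TG\<^esub>"
      using tens_add_left_group[of "\<ominus>\<^bsub>A\<^esub> a" a b] ab by (simp add: A.M.l_neg)
  qed (simp_all add: tens_group_closed ab)
  have p': "P (X \<otimes>\<^bsub>TG\<^esub> Y)" if "X \<in> carrier TG" "Y \<in> carrier TG" "P X" "P Y" for X Y
    using p[of X Y] that by (simp add: tensor_alg_sel)
  have "X \<in> carrier TG" using X by (simp add: tensor_alg_sel)
  then have "P X \<and> P (inv\<^bsub>TG\<^esub> X)"
    by (induction X rule: tensor_group_induct) (simp_all add: t inv p' TG.inv_mult)
  then show ?thesis ..
qed

lemma linear_ext:
  assumes "module K A" "module K B"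
    and "f \<in> linear_hom K (tensor_alg K A B) V" "g \<in> linear_hom K (tensor_alg K A B) V"
    and "\<And>a b. \<lbrakk>a \<in> carrier A; b \<in> carrier B\<rbrakk> \<Longrightarrow> f (tens K A B a b) = g (tens K A B a b)"
    and "X \<in> carrier (tensor_alg K A B)"
  shows "f X = g X"
  using assms(1,2,6)
  by (induction X rule: tensor_induct) (simp_all add: assms(3,4)[THEN linear_hom_add] assms(5))

lemma tlift_cong:
  assumes mA: "module K A" and mB: "module K B" and mV: "module K V"
    and X: "X \<in> carrier (tensor_alg K A B)" and g: "bilin K A B V g"
    and eq: "\<And>a b. \<lbrakk>a \<in> carrier A; b \<in> carrier B\<rbrakk> \<Longrightarrow> f a b = g a b"
  shows "tlift V f X = tlift V g X"
proof -
  have f: "bilin K A B V f" by (rule bilin_cong_on[OF g mA mB eq])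
  show ?thesis
    by (rule linear_ext[OF mA mB tlift_linear(1)[OF mA mB mV f] tlift_linear(1)[OF mA mB mV g] _ X])
       (simp add: tlift_linear(2)[OF mA mB mV f] tlift_linear(2)[OF mA mB mV g] eq)
qed

lemma tlift_push:
  assumes mA: "module K A" and mB: "module K B" and mV: "module K V" and mW: "module K W"
    and X: "X \<in> carrier (tensor_alg K A B)" and f: "bilin K A B V f" and h: "h \<in> linear_hom K V W"
  shows "h (tlift V f X) = tlift W (\<lambda>a b. h (f a b)) X"
proof -
  note g = bilin_compose[OF h f]
  show ?thesis
    by (rule linear_ext[OF mA mB linear_hom_comp[OF h tlift_linear(1)[OF mA mB mV f]]
          tlift_linear(1)[OF mA mB mW g] _ X])
       (simp add: tlift_linear(2)[OF mA mB mV f] tlift_linear(2)[OF mA mB mW g])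
qed

lemma tlift_param:
  assumes mA: "module K A" and mB: "module K B" and mV: "module K V" and mW: "module K W"
    and X: "X \<in> carrier (tensor_alg K A B)"
    and f: "\<And>w. w \<in> carrier W \<Longrightarrow> bilin K A B V (\<lambda>a b. f a b w)"
    and l: "\<And>a b. \<lbrakk>a \<in> carrier A; b \<in> carrier B\<rbrakk> \<Longrightarrow> (\<lambda>w. f a b w) \<in> linear_hom K W V"
  shows "(\<lambda>w. tlift V (\<lambda>a b. f a b w) X) \<in> linear_hom K W V"
  using mA mB X
proof (induction X rule: tensor_induct)
  case (tens a b)
  then show ?case
    using tlift_linear(2)[OF mA mB mV f] by (intro linear_hom_cong_on[OF l mW]) auto
next
  case (add X Y)
  then show ?case
    using linear_hom_add[OF tlift_linear(1)[OF mA mB mV f]]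
    by (intro linear_hom_cong_on[OF linear_hom_plus[OF mV add(3,4)] mW]) auto
qed

text \<open>
  Both sides are linear in \<open>X\<close>, which reduces the claim to pure \<open>X\<close>, where the lift over \<open>X\<close>
  disappears.
\<close>

lemma tlift_swap:
  assumes mA: "module K A" and mB: "module K B" and mC: "module K C" and mD: "module K D"
    and mV: "module K V"
    and X: "X \<in> carrier (tensor_alg K A B)" and Y: "Y \<in> carrier (tensor_alg K C D)"
    and f1: "\<And>c d. \<lbrakk>c \<in> carrier C; d \<in> carrier D\<rbrakk> \<Longrightarrow> bilin K A B V (\<lambda>a b. f a b c d)"
    and f2: "\<And>a b. \<lbrakk>a \<in> carrier A; b \<in> carrier B\<rbrakk> \<Longrightarrow> bilin K C D V (\<lambda>c d. f a b c d)"
  shows "tlift V (\<lambda>a b. tlift V (\<lambda>c d. f a b c d) Y) X = tlift V (\<lambda>c d. tlift V (\<lambda>a b. f a b c d) X) Y"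
proof (rule linear_ext[OF mA mB _ _ _ X])
  let ?T = "tensor_alg K A B"
  note lf1 = tlift_linear(1)[OF mA mB mV f1] tlift_linear(1)[OF mC mD mV f2]
  have p1: "bilin K A B V (\<lambda>a b. tlift V (\<lambda>c d. f a b c d) Y)"
    by (intro bilinI tlift_param[OF mC mD mV _ Y] mA mB)
       (auto intro: f2 f1[THEN bilin_right] f1[THEN bilin_left] f2[THEN bilin_right] f2[THEN bilin_left])
  have p2: "bilin K C D V (\<lambda>c d. tlift V (\<lambda>a b. f a b c d) Z)" if "Z \<in> carrier ?T" for Z
    by (intro bilinI tlift_param[OF mA mB mV _ that] mC mD)
       (auto intro: f1 f2[THEN bilin_right] f2[THEN bilin_left] f1[THEN bilin_right] f1[THEN bilin_left])
  show "tlift V (\<lambda>a b. tlift V (f a b) Y) \<in> linear_hom K ?T V"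
    by (rule tlift_linear(1)[OF mA mB mV p1])
  show "(\<lambda>X. tlift V (\<lambda>c d. tlift V (\<lambda>a b. f a b c d) X) Y) \<in> linear_hom K ?T V"
    by (rule tlift_param[OF mC mD mV tensor_alg_module[OF mA mB] Y p2]) (auto intro: lf1)
  show "tlift V (\<lambda>a b. tlift V (f a b) Y) (tens K A B a b) =
      tlift V (\<lambda>c d. tlift V (\<lambda>a b. f a b c d) (tens K A B a b)) Y"
    if "a \<in> carrier A" "b \<in> carrier B" for a b
    unfolding tlift_linear(2)[OF mA mB mV p1 that]
    by (rule sym, rule tlift_cong[OF mC mD mV Y f2[OF that]])
       (simp add: tlift_linear(2)[OF mA mB mV f1] that)
qed

section \<open>Sweedler calculus\<close>

lemma coalgebra_comultiplication: "k_coalgebra K C \<Longrightarrow> comultiplication K C"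
  unfolding comultiplication_def k_coalgebra_def k_coalgebra_axioms_def by blast

lemma coalgebra_module: "k_coalgebra K C \<Longrightarrow> module K C"
  unfolding k_coalgebra_def by blast

lemma comultiplication_module: "comultiplication K C \<Longrightarrow> module K C"
  unfolding comultiplication_def by blast

lemma comult_closed:
  "\<lbrakk>comultiplication K C; c \<in> carrier C\<rbrakk> \<Longrightarrow> comult C c \<in> carrier (tensor_alg K C C)"
  unfolding comultiplication_def by (blast intro: linear_hom_closed)

lemma sw_closed:
  assumes "comultiplication K C" "module K V" "c \<in> carrier C" "bilin K C C V f"
  shows "sw C V c f \<in> carrier V"
  unfolding sweedler2_def
  by (rule linear_hom_closed[OF tlift_linear(1)[OF _ _ assms(2,4)] comult_closed])
     (rule assms comultiplication_module)+

lemma sw_cong: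
  assumes "comultiplication K C" "module K V" "c \<in> carrier C" "bilin K C C V g"
    and "\<And>c1 c2. \<lbrakk>c1 \<in> carrier C; c2 \<in> carrier C\<rbrakk> \<Longrightarrow> f c1 c2 = g c1 c2"
  shows "sw C V c f = sw C V c g"
  unfolding sweedler2_def
  by (rule tlift_cong[OF _ _ assms(2) comult_closed[OF assms(1,3)] assms(4,5)])
     (rule assms comultiplication_module | assumption)+

lemma sw_push:
  assumes "comultiplication K C" "module K V" "module K W" "c \<in> carrier C"
    and "bilin K C C V f" "h \<in> linear_hom K V W"
  shows "h (sw C V c f) = sw C W c (\<lambda>c1 c2. h (f c1 c2))"
  unfolding sweedler2_def
  by (rule tlift_push[OF _ _ assms(2,3) comult_closed[OF assms(1,4)] assms(5,6)])
     (rule assms comultiplication_module)+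

text \<open>
  A linear map passes through two nested sums over independent elements, the shape in which the
  comultiplication of products and of pure tensors appears.
\<close>

lemma sw_push2:
  assumes C: "comultiplication K C" and D: "comultiplication K D" and V: "module K V" and W: "module K W"
    and c: "c \<in> carrier C" and d: "d \<in> carrier D"
    and b: "bilin K C C V (\<lambda>c1 c2. sw D V d (\<lambda>d1 d2. f c1 c2 d1 d2))"
    and b': "\<And>c1 c2. \<lbrakk>c1 \<in> carrier C; c2 \<in> carrier C\<rbrakk> \<Longrightarrow> bilin K D D V (\<lambda>d1 d2. f c1 c2 d1 d2)"
    and h: "h \<in> linear_hom K V W"
  shows "h (sw C V c (\<lambda>c1 c2. sw D V d (\<lambda>d1 d2. f c1 c2 d1 d2)))
    = sw C W c (\<lambda>c1 c2. sw D W d (\<lambda>d1 d2. h (f c1 c2 d1 d2)))"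
proof -
  note p = sw_push[OF D V W d b' h]
  have "bilin K C C W (\<lambda>c1 c2. sw D W d (\<lambda>d1 d2. h (f c1 c2 d1 d2)))"
    using C by (intro bilin_cong_on[OF bilin_compose[OF h b]]) (simp_all add: comultiplication_module p)
  then show ?thesis
    unfolding sw_push[OF C V W c b h] by (intro sw_cong[OF C W c]) (simp_all add: p)
qed

lemma sw_swap:
  assumes "comultiplication K C" "comultiplication K D" "module K V"
    and "c \<in> carrier C" "d \<in> carrier D"
    and "\<And>d1 d2. \<lbrakk>d1 \<in> carrier D; d2 \<in> carrier D\<rbrakk> \<Longrightarrow> bilin K C C V (\<lambda>c1 c2. f c1 c2 d1 d2)"
    and "\<And>c1 c2. \<lbrakk>c1 \<in> carrier C; c2 \<in> carrier C\<rbrakk> \<Longrightarrow> bilin K D D V (\<lambda>d1 d2. f c1 c2 d1 d2)"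
  shows "sw C V c (\<lambda>c1 c2. sw D V d (\<lambda>d1 d2. f c1 c2 d1 d2))
    = sw D V d (\<lambda>d1 d2. sw C V c (\<lambda>c1 c2. f c1 c2 d1 d2))"
  unfolding sweedler2_def
  by (rule tlift_swap[OF _ _ _ _ assms(3) comult_closed[OF assms(1,4)] comult_closed[OF assms(2,5)]])
     (rule assms(1,2) comultiplication_module | rule assms(6,7); assumption)+

subsection \<open>Linearity of composite expressions\<close>

lemma lin_tens_left:
  assumes "module K A" "module K B" "F \<in> linear_hom K X A" "b \<in> carrier B"
  shows "(\<lambda>x. tens K A B (F x) b) \<in> linear_hom K X (tensor_alg K A B)"
  by (rule linear_hom_comp[OF bilin_left[OF bilin_tens]]) (rule assms)+

lemma lin_tens_right:
  assumes "module K A" "module K B" "a \<in> carrier A" "F \<in> linear_hom K X B"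
  shows "(\<lambda>x. tens K A B a (F x)) \<in> linear_hom K X (tensor_alg K A B)"
  by (rule linear_hom_comp[OF bilin_right[OF bilin_tens]]) (rule assms)+

lemma lin_smult_right:
  assumes "module K V" "k \<in> carrier K" "F \<in> linear_hom K X V"
  shows "(\<lambda>x. k \<odot>\<^bsub>V\<^esub> F x) \<in> linear_hom K X V"
proof -
  interpret V: module K V by fact
  show ?thesis
    by (rule linear_hom_comp[OF _ assms(3)], rule linear_homI)
       (use assms in \<open>simp_all add: V.smult_r_distr m_comm flip: V.smult_assoc1\<close>)
qed

lemma lin_smult_left:
  assumes "module K V" "F \<in> linear_hom K X (ground K)" "v \<in> carrier V"
  shows "(\<lambda>x. F x \<odot>\<^bsub>V\<^esub> v) \<in> linear_hom K X V"
proof -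
  interpret V: module K V by fact
  show ?thesis
    by (rule linear_hom_comp[OF _ assms(2)], rule linear_homI)
       (use assms in \<open>simp_all add: ground_def V.smult_l_distr V.smult_assoc1\<close>)
qed

lemma lin_ground_left:
  assumes "F \<in> linear_hom K X (ground K)" "k \<in> carrier K"
  shows "(\<lambda>x. F x \<otimes>\<^bsub>K\<^esub> k) \<in> linear_hom K X (ground K)"
  using lin_smult_left[OF module_ground assms(1), of k] assms(2) by (simp add: ground_def)

lemma lin_ground_right:
  assumes "k \<in> carrier K" "F \<in> linear_hom K X (ground K)"
  shows "(\<lambda>x. k \<otimes>\<^bsub>K\<^esub> F x) \<in> linear_hom K X (ground K)"
  using lin_smult_right[OF module_ground, of k F X] assms by (simp add: ground_def)

lemma lin_tlift:
  assumes "module K A" "module K B" "module K V" "F \<in> linear_hom K X (tensor_alg K A B)" "bilin K A B V f"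
  shows "(\<lambda>x. tlift V f (F x)) \<in> linear_hom K X V"
  by (rule linear_hom_comp[OF tlift_linear(1)]) (rule assms)+

lemma lin_sw:
  assumes "comultiplication K C" "module K V" "F \<in> linear_hom K X C" "bilin K C C V f"
  shows "(\<lambda>x. sw C V (F x) f) \<in> linear_hom K X V"
  unfolding sweedler2_def
  by (rule lin_tlift[OF _ _ assms(2) linear_hom_comp[OF _ assms(3)] assms(4)])
     (use assms(1) in \<open>auto simp: comultiplication_def\<close>)

lemma lin_sw_param:
  assumes "comultiplication K C" "module K V" "module K X" "c \<in> carrier C"
    and "\<And>x. x \<in> carrier X \<Longrightarrow> bilin K C C V (\<lambda>c1 c2. f c1 c2 x)"
    and "\<And>c1 c2. \<lbrakk>c1 \<in> carrier C; c2 \<in> carrier C\<rbrakk> \<Longrightarrow> (\<lambda>x. f c1 c2 x) \<in> linear_hom K X V"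
  shows "(\<lambda>x. sw C V c (\<lambda>c1 c2. f c1 c2 x)) \<in> linear_hom K X V"
  unfolding sweedler2_def
  by (rule tlift_param[where A=C and B=C])
     (rule assms comult_closed comultiplication_module | assumption)+

lemma counit_lin:
  assumes "k_coalgebra K C" "F \<in> linear_hom K X C"
  shows "(\<lambda>x. counit C (F x)) \<in> linear_hom K X (ground K)"
  by (rule linear_hom_comp[OF k_coalgebra.counit_linear]) (rule assms)+

lemma counit_closed: "\<lbrakk>k_coalgebra K C; c \<in> carrier C\<rbrakk> \<Longrightarrow> counit C c \<in> carrier K"
  using linear_hom_closed[OF k_coalgebra.counit_linear] by fastforce

lemma smult_closed': "\<lbrakk>module K V; k \<in> carrier K; v \<in> carrier V\<rbrakk> \<Longrightarrow> k \<odot>\<^bsub>V\<^esub> v \<in> carrier V"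
  by (rule module.smult_closed)

lemma tlift_closed:
  assumes "module K A" "module K B" "module K V" "X \<in> carrier (tensor_alg K A B)" "bilin K A B V f"
  shows "tlift V f X \<in> carrier V"
  by (rule linear_hom_closed[OF tlift_linear(1)]) (rule assms)+

lemma lin_mult_left:
  assumes "k_algebra K A" "F \<in> linear_hom K X A" "b \<in> carrier A"
  shows "(\<lambda>x. F x \<otimes>\<^bsub>A\<^esub> b) \<in> linear_hom K X A"
proof -
  interpret k_algebra K A by fact
  show ?thesis
    by (rule linear_hom_comp[OF _ assms(2)], rule linear_homI)
       (use assms in \<open>simp_all add: l_distr smult_mult_left\<close>)
qed

lemma lin_mult_right:
  assumes "k_algebra K A" "a \<in> carrier A" "F \<in> linear_hom K X A"
  shows "(\<lambda>x. a \<otimes>\<^bsub>A\<^esub> F x) \<in> linear_hom K X A"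
proof -
  interpret k_algebra K A by fact
  show ?thesis
    by (rule linear_hom_comp[OF _ assms(3)], rule linear_homI)
       (use assms in \<open>simp_all add: r_distr smult_mult_right\<close>)
qed

lemma mult_closed: "\<lbrakk>k_algebra K A; a \<in> carrier A; b \<in> carrier A\<rbrakk> \<Longrightarrow> a \<otimes>\<^bsub>A\<^esub> b \<in> carrier A"
  unfolding k_algebra_def by (meson ring.ring_simprules(5))

text \<open>
  These rules are directed by syntax: the head symbol of a term determines the rule, and each
  rule leaves as premises the same kind of claim for the arguments. Applied repeatedly they decide
  whether a composite expression is linear in a variable, bilinear in two, or lies in a carrier.
  Facts about the particular maps at hand are added to the list where they occur. All side
  conditions of the Sweedler calculations below are discharged in this way.
\<close>

lemmas lin_intros = linear_hom_id bilinI lin_tens_left lin_tens_right lin_smult_left lin_smult_right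
  lin_ground_left lin_ground_right
  lin_tlift lin_sw lin_sw_param counit_lin lin_mult_left lin_mult_right
  tens_closed smult_closed' tlift_closed sw_closed counit_closed mult_closed
  tensor_alg_module module_ground

subsection \<open>Coalgebra laws in Sweedler notation\<close>

lemma sw_counit_left:
  assumes C: "k_coalgebra K C" and V: "module K V" and c: "c \<in> carrier C" and f: "f \<in> linear_hom K C V"
  shows "sw C V c (\<lambda>c1 c2. counit C c1 \<odot>\<^bsub>V\<^esub> f c2) = f c"
proof -
  note mC = coalgebra_module[OF C] and cC = coalgebra_comultiplication[OF C]
  note I = linear_hom_comp[OF f] linear_hom_closed[OF f] C cC V mC c f
  have "f c = f (sw C C c (\<lambda>c1 c2. counit C c1 \<odot>\<^bsub>C\<^esub> c2))"
    by (simp add: k_coalgebra.counit_left[OF C c])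
  also have "\<dots> = sw C V c (\<lambda>c1 c2. f (counit C c1 \<odot>\<^bsub>C\<^esub> c2))"
    by (rule sw_push) (rule lin_intros I | assumption)+
  also have "\<dots> = sw C V c (\<lambda>c1 c2. counit C c1 \<odot>\<^bsub>V\<^esub> f c2)"
    by (rule sw_cong) (rule lin_intros I linear_hom_smult[OF f] | assumption)+
  finally show ?thesis ..
qed

lemma sw_counit_right:
  assumes C: "k_coalgebra K C" and V: "module K V" and c: "c \<in> carrier C" and f: "f \<in> linear_hom K C V"
  shows "sw C V c (\<lambda>c1 c2. counit C c2 \<odot>\<^bsub>V\<^esub> f c1) = f c"
proof -
  note mC = coalgebra_module[OF C] and cC = coalgebra_comultiplication[OF C]
  note I = linear_hom_comp[OF f] linear_hom_closed[OF f] C cC V mC c f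
  have "f c = f (sw C C c (\<lambda>c1 c2. counit C c2 \<odot>\<^bsub>C\<^esub> c1))"
    by (simp add: k_coalgebra.counit_right[OF C c])
  also have "\<dots> = sw C V c (\<lambda>c1 c2. f (counit C c2 \<odot>\<^bsub>C\<^esub> c1))"
    by (rule sw_push) (rule lin_intros I | assumption)+
  also have "\<dots> = sw C V c (\<lambda>c1 c2. counit C c2 \<odot>\<^bsub>V\<^esub> f c1)"
    by (rule sw_cong) (rule lin_intros I linear_hom_smult[OF f] | assumption)+
  finally show ?thesis ..
qed

text \<open>
  A trilinear map is a linear map on \<open>C \<otimes> (C \<otimes> C)\<close>; applying it to the coassociativity law, which is an
  equation in that space, gives the law for arbitrary summands.
\<close>

lemma sw_coassoc:
  assumes C: "k_coalgebra K C" and V: "module K V" and c: "c \<in> carrier C"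
    and f1: "\<And>y z. \<lbrakk>y \<in> carrier C; z \<in> carrier C\<rbrakk> \<Longrightarrow> (\<lambda>x. f x y z) \<in> linear_hom K C V"
    and f2: "\<And>x z. \<lbrakk>x \<in> carrier C; z \<in> carrier C\<rbrakk> \<Longrightarrow> (\<lambda>y. f x y z) \<in> linear_hom K C V"
    and f3: "\<And>x y. \<lbrakk>x \<in> carrier C; y \<in> carrier C\<rbrakk> \<Longrightarrow> (\<lambda>z. f x y z) \<in> linear_hom K C V"
  shows "sw C V c (\<lambda>x c3. sw C V x (\<lambda>c1 c2. f c1 c2 c3))
    = sw C V c (\<lambda>c1 y. sw C V y (\<lambda>c2 c3. f c1 c2 c3))"
proof -
  note mC = coalgebra_module[OF C] and cC = coalgebra_comultiplication[OF C]
  let ?CC = "tensor_alg K C C"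
  let ?CCC = "tensor_alg K C ?CC"
  \<comment> \<open>The trilinear map as a linear map on the threefold tensor product.\<close>
  define h where "h = tlift V (\<lambda>c1. tlift V (\<lambda>c2 c3. f c1 c2 c3))"
  have b1: "bilin K C C V (\<lambda>c2 c3. f c1 c2 c3)" if "c1 \<in> carrier C" for c1
    by (rule bilinI f2 f3 that | assumption)+
  have b2: "bilin K C ?CC V (\<lambda>c1. tlift V (\<lambda>c2 c3. f c1 c2 c3))"
    by (rule bilinI tlift_linear(1)[OF mC mC V] b1 tlift_param[OF mC mC V mC] f1 | assumption)+
  have h: "h \<in> linear_hom K ?CCC V"
    unfolding h_def by (rule tlift_linear(1)[OF mC tensor_alg_module[OF mC mC] V b2])
  have ht: "h (tens K C ?CC c1 (tens K C C c2 c3)) = f c1 c2 c3"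
    if "c1 \<in> carrier C" "c2 \<in> carrier C" "c3 \<in> carrier C" for c1 c2 c3
    unfolding h_def using that
    by (simp add: tlift_linear(2)[OF mC tensor_alg_module[OF mC mC] V b2] tens_closed mC
        tlift_linear(2)[OF mC mC V b1])
  note I = linear_hom_comp[OF h] linear_hom_closed[OF h] C cC V mC c
  have mCCC: "module K ?CCC" by (rule lin_intros I)+
  have "sw C V c (\<lambda>x c3. sw C V x (\<lambda>c1 c2. f c1 c2 c3))
      = h (sw C ?CCC c (\<lambda>x c3. sw C ?CCC x (\<lambda>c1 c2. tens K C ?CC c1 (tens K C C c2 c3))))"
    (is "_ = h ?L")
  proof -
    have "h ?L = sw C V c (\<lambda>x c3. h (sw C ?CCC x (\<lambda>c1 c2. tens K C ?CC c1 (tens K C C c2 c3))))"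
      by (rule sw_push) (rule lin_intros I h | assumption)+
    also have "\<dots> = sw C V c (\<lambda>x c3. sw C V x (\<lambda>c1 c2. f c1 c2 c3))"
    proof (rule sw_cong)
      fix x z assume xz: "x \<in> carrier C" "z \<in> carrier C"
      have "h (sw C ?CCC x (\<lambda>c1 c2. tens K C ?CC c1 (tens K C C c2 z)))
         = sw C V x (\<lambda>c1 c2. h (tens K C ?CC c1 (tens K C C c2 z)))" (is "?l = _")
        by (rule sw_push) (rule lin_intros I h xz | assumption)+
      also have "\<dots> = sw C V x (\<lambda>c1 c2. f c1 c2 z)" (is "_ = ?r")
        by (rule sw_cong) (rule lin_intros I f1 f2 f3 xz ht | assumption)+
      finally show "?l = ?r" .
    qed (rule lin_intros I f1 f2 f3 | assumption)+
    finally show ?thesis ..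
  qed
  also have "?L = sw C ?CCC c (\<lambda>c1 y. sw C ?CCC y (\<lambda>c2 c3. tens K C ?CC c1 (tens K C C c2 c3)))"
    using k_coalgebra.coassoc[OF C c] by (simp add: Let_def)
  also have "h \<dots> = sw C V c (\<lambda>c1 y. h (sw C ?CCC y (\<lambda>c2 c3. tens K C ?CC c1 (tens K C C c2 c3))))"
    by (rule sw_push) (rule lin_intros I h | assumption)+
  also have "\<dots> = sw C V c (\<lambda>c1 y. sw C V y (\<lambda>c2 c3. f c1 c2 c3))"
  proof (rule sw_cong)
    fix x y assume xy: "x \<in> carrier C" "y \<in> carrier C"
    have "h (sw C ?CCC y (\<lambda>c2 c3. tens K C ?CC x (tens K C C c2 c3)))
       = sw C V y (\<lambda>c2 c3. h (tens K C ?CC x (tens K C C c2 c3)))" (is "?l = _")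
      by (rule sw_push) (rule lin_intros I h xy | assumption)+
    also have "\<dots> = sw C V y (\<lambda>c2 c3. f x c2 c3)" (is "_ = ?r")
      by (rule sw_cong) (rule lin_intros I f1 f2 f3 xy ht | assumption)+
    finally show "?l = ?r" .
  qed (rule lin_intros I f1 f2 f3 | assumption)+
  finally show ?thesis .
qed

subsection \<open>Coalgebra maps\<close>

lemma coalg_hom_lin: "f \<in> coalg_hom K C D \<Longrightarrow> f \<in> linear_hom K C D"
  unfolding coalg_hom_def by auto

lemma coalg_hom_counit: "\<lbrakk>f \<in> coalg_hom K C D; c \<in> carrier C\<rbrakk> \<Longrightarrow> counit D (f c) = counit C c"
  unfolding coalg_hom_def by auto

lemma coalg_hom_closed: "\<lbrakk>f \<in> coalg_hom K C D; c \<in> carrier C\<rbrakk> \<Longrightarrow> f c \<in> carrier D"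
  by (rule linear_hom_closed[OF coalg_hom_lin])

lemma coalg_hom_comult:
  "\<lbrakk>f \<in> coalg_hom K C D; c \<in> carrier C\<rbrakk>
    \<Longrightarrow> comult D (f c) = sw C (tensor_alg K D D) c (\<lambda>c1 c2. tens K D D (f c1) (f c2))"
  unfolding coalg_hom_def by auto

lemma coalg_homI:
  assumes "f \<in> linear_hom K C D"
    and "\<And>c. c \<in> carrier C \<Longrightarrow>
      comult D (f c) = sw C (tensor_alg K D D) c (\<lambda>c1 c2. tens K D D (f c1) (f c2))"
    and "\<And>c. c \<in> carrier C \<Longrightarrow> counit D (f c) = counit C c"
  shows "f \<in> coalg_hom K C D"
  using assms unfolding coalg_hom_def by auto

lemma sw_tens: "comultiplication K C \<Longrightarrow> c \<in> carrier C \<Longrightarrow>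
  sw C (tensor_alg K C C) c (\<lambda>c1 c2. tens K C C c1 c2) = comult C c"
  unfolding sweedler2_def comultiplication_def
  by (rule linear_ext[where f="tlift (tensor_alg K C C) (tens K C C)" and g="\<lambda>x. x" and A=C and B=C])
     (auto intro: tlift_linear linear_hom_id tensor_alg_module bilin_tens simp: tlift_linear(2) tensor_alg_module bilin_tens
        intro: linear_hom_closed)

text \<open>
  The linear map induced by \<open>g\<close> is applied to both sides of the comultiplication law for \<open>f\<close>.
\<close>

lemma sw_coalg_hom:
  assumes C: "comultiplication K C" and D: "comultiplication K D" and V: "module K V"
    and f: "f \<in> coalg_hom K C D" and c: "c \<in> carrier C" and g: "bilin K D D V g"
  shows "sw D V (f c) g = sw C V c (\<lambda>c1 c2. g (f c1) (f c2))"
proof -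
  note mC = comultiplication_module[OF C] and mD = comultiplication_module[OF D]
  note fl = coalg_hom_lin[OF f]
  note I = linear_hom_comp[OF fl] linear_hom_closed[OF fl] C D V mC mD c g
  note gl = tlift_linear[OF mD mD V g]
  have "sw D V (f c) g = tlift V g (sw C (tensor_alg K D D) c (\<lambda>c1 c2. tens K D D (f c1) (f c2)))"
    unfolding sweedler2_def[of D] coalg_hom_comult[OF f c] ..
  also have "\<dots> = sw C V c (\<lambda>c1 c2. tlift V g (tens K D D (f c1) (f c2)))"
    by (rule sw_push) (rule lin_intros I gl | assumption)+
  also have "\<dots> = sw C V c (\<lambda>c1 c2. g (f c1) (f c2))"
    by (rule sw_cong)
       (rule C V c bilinI linear_hom_comp[OF bilin_left[OF g]] linear_hom_comp[OF bilin_right[OF g]]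
          gl fl linear_hom_closed[OF fl] | assumption)+
  finally show ?thesis .
qed

lemma coalg_hom_comp:
  assumes C: "comultiplication K C" and D: "comultiplication K D" and E: "module K E"
    and f: "f \<in> coalg_hom K C D" and g: "g \<in> coalg_hom K D E"
  shows "(\<lambda>c. g (f c)) \<in> coalg_hom K C E"
proof (rule coalg_homI)
  note gl = coalg_hom_lin[OF g]
  note I = linear_hom_comp[OF gl] linear_hom_closed[OF gl] C D E
  show "(\<lambda>c. g (f c)) \<in> linear_hom K C E"
    by (rule linear_hom_comp[OF gl coalg_hom_lin[OF f]])
  fix c assume c: "c \<in> carrier C"
  show "counit E (g (f c)) = counit C c"
    by (simp add: coalg_hom_counit[OF g coalg_hom_closed[OF f c]] coalg_hom_counit[OF f c])
  show "comult E (g (f c)) = sw C (tensor_alg K E E) c (\<lambda>c1 c2. tens K E E (g (f c1)) (g (f c2)))"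
    unfolding coalg_hom_comult[OF g coalg_hom_closed[OF f c]]
    by (rule sw_coalg_hom[OF C D _ f c]) (rule lin_intros I | assumption)+
qed

subsection \<open>Structures that differ only in their multiplication\<close>

lemma tensor_group_cong_structure:
  assumes "carrier A' = carrier A" "add A' = add A" "smult A' = smult A"
    and "carrier B' = carrier B" "add B' = add B" "smult B' = smult B"
  shows "tensor_group K A' B' = tensor_group K A B" and "tens K A' B' = tens K A B"
proof -
  have "tensor_null K A' B' = tensor_null K A B"
    unfolding tensor_null_def tensor_relations_def assms ..
  then show "tensor_group K A' B' = tensor_group K A B" "tens K A' B' = tens K A B"
    unfolding tensor_group_def tens_def[abs_def] assms by simp_all
qed

lemma group_lift_cong_structure:
  assumes "carrier G' = carrier G" "monoid.mult G' = monoid.mult G" "one G' = one G"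
  shows "group_lift G' = group_lift G"
  unfolding group_lift_def[abs_def] finprod_def int_pow_def nat_pow_def m_inv_def assms ..

lemma tlift_cong_structure:
  assumes "carrier V' = carrier V" "add V' = add V" "zero V' = zero V"
  shows "tlift V' = tlift V"
  unfolding tlift_def by (rule group_lift_cong_structure) (simp_all add: assms)

lemma sweedler2_cong_structure:
  assumes "carrier V' = carrier V" "add V' = add V" "zero V' = zero V"
  shows "sw C V' = sw C V"
  unfolding sweedler2_def[abs_def] tlift_cong_structure[OF assms] ..

subsection \<open>The tensor product coalgebra\<close>

lemma tensor_coalg_sel:
  "carrier (tensor_coalg K A B) = carrier (tensor_alg K A B)"
  "zero (tensor_coalg K A B) = zero (tensor_alg K A B)"
  "add (tensor_coalg K A B) = add (tensor_alg K A B)"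
  "smult (tensor_coalg K A B) = smult (tensor_alg K A B)"
  "monoid.mult (tensor_coalg K A B) = monoid.mult (tensor_alg K A B)"
  "one (tensor_coalg K A B) = one (tensor_alg K A B)"
  by (simp_all add: tensor_coalg_def Let_def)

text \<open>
  The tensor product coalgebra and the tensor product algebra have the same underlying vector space.
  The equations replace the former by the latter wherever only that space matters.
\<close>

lemma tensor_coalg_simps:
  "carrier (tensor_coalg K A B) = carrier (tensor_alg K A B)"
  "linear_hom K (tensor_coalg K A B) W = linear_hom K (tensor_alg K A B) W"
  "linear_hom K X (tensor_coalg K A B) = linear_hom K X (tensor_alg K A B)"
  "tens K (tensor_coalg K A B) (tensor_coalg K A B) = tens K (tensor_alg K A B) (tensor_alg K A B)"
  "tensor_alg K (tensor_coalg K A B) (tensor_coalg K A B) = tensor_alg K (tensor_alg K A B) (tensor_alg K A B)"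
  "tlift (tensor_coalg K A B) = tlift (tensor_alg K A B)"
  "sw C (tensor_coalg K A B) = sw C (tensor_alg K A B)"
  "bilin K (tensor_coalg K A B) (tensor_coalg K A B) V = bilin K (tensor_alg K A B) (tensor_alg K A B) V"
proof -
  note E = tensor_group_cong_structure[OF tensor_coalg_sel(1,3,4) tensor_coalg_sel(1,3,4)]
  show "linear_hom K (tensor_coalg K A B) W = linear_hom K (tensor_alg K A B) W"
    "linear_hom K X (tensor_coalg K A B) = linear_hom K X (tensor_alg K A B)"
    by (intro linear_hom_cong_structure tensor_coalg_sel refl)+
  then show "bilin K (tensor_coalg K A B) (tensor_coalg K A B) V = bilin K (tensor_alg K A B) (tensor_alg K A B) V"
    unfolding bilin_def[abs_def] tensor_coalg_sel by (simp add: linear_hom_def tensor_coalg_sel)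
  show "tens K (tensor_coalg K A B) (tensor_coalg K A B) = tens K (tensor_alg K A B) (tensor_alg K A B)"
    by (rule E)
  show "tensor_alg K (tensor_coalg K A B) (tensor_coalg K A B) = tensor_alg K (tensor_alg K A B) (tensor_alg K A B)"
    unfolding tensor_alg_def[of K "tensor_coalg K A B"] tensor_alg_def[of K "tensor_alg K A B"] E tensor_coalg_sel ..
  show "tlift (tensor_coalg K A B) = tlift (tensor_alg K A B)"
    "sw C (tensor_coalg K A B) = sw C (tensor_alg K A B)"
    by (intro tlift_cong_structure sweedler2_cong_structure tensor_coalg_sel)+
qed (rule tensor_coalg_sel)

text \<open>
  Scalar-valued lifts are formed in the ring \<open>K\<close>, while linear maps take values in the module
  \<^term>\<open>ground K\<close>; the two have the same additive group.
\<close>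

lemma ground_sweedler: "tlift K = tlift (ground K)" "sw C K = sw C (ground K)"
  by (intro tlift_cong_structure sweedler2_cong_structure; simp add: ground_def)+

lemma tensor_coalg_module:
  assumes "module K A" "module K B" shows "module K (tensor_coalg K A B)"
  by (rule module_cong_structure[OF tensor_alg_module[OF assms]]) (simp_all add: tensor_coalg_sel)

context
  fixes A :: "('k, 'a, 'm) hopf_scheme" and B :: "('k, 'b, 'l) hopf_scheme"
  assumes cA: "comultiplication K A" and cB: "comultiplication K B"
begin

private abbreviation "AB \<equiv> tensor_alg K A B"
private abbreviation "ABAB \<equiv> tensor_alg K AB AB"

private lemma mA: "module K A" and mB: "module K B"
  using cA cB by (simp_all add: comultiplication_module)

private lemma comult_bilin:
  "bilin K A B ABAB (\<lambda>a b. sw A ABAB a (\<lambda>a1 a2. sw B ABAB b (\<lambda>b1 b2.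
      tens K AB AB (tens K A B a1 b1) (tens K A B a2 b2))))"
  by (rule lin_intros mA mB cA cB | assumption)+

lemma tensor_coalg_comultiplication: "comultiplication K (tensor_coalg K A B)"
proof -
  have e: "comult (tensor_coalg K A B)
    = tlift ABAB (\<lambda>a b. sw A ABAB a (\<lambda>a1 a2. sw B ABAB b (\<lambda>b1 b2.
      tens K AB AB (tens K A B a1 b1) (tens K A B a2 b2))))"
    by (simp add: tensor_coalg_def Let_def)
  show ?thesis
    unfolding comultiplication_def tensor_coalg_simps e
    by (intro conjI tensor_coalg_module tlift_linear(1) comult_bilin tensor_alg_module mA mB)
qed

lemma sw_tensor:
  assumes V: "module K V" and f: "bilin K AB AB V f" and a: "a \<in> carrier A" and b: "b \<in> carrier B"
  shows "sw (tensor_coalg K A B) V (tens K A B a b) f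
    = sw A V a (\<lambda>a1 a2. sw B V b (\<lambda>b1 b2. f (tens K A B a1 b1) (tens K A B a2 b2)))"
proof -
  have mT: "module K AB" and mTT: "module K ABAB" by (simp_all add: tensor_alg_module mA mB)
  note f' = linear_hom_comp[OF bilin_left[OF f]] linear_hom_comp[OF bilin_right[OF f]]
  note fl = tlift_linear[OF mT mT V f]
  note I = lin_intros mA mB cA cB V f' a b
  have "comult (tensor_coalg K A B) (tens K A B a b)
    = sw A ABAB a (\<lambda>a1 a2. sw B ABAB b (\<lambda>b1 b2.
        tens K AB AB (tens K A B a1 b1) (tens K A B a2 b2)))"
    using tlift_linear(2)[OF mA mB mTT comult_bilin a b] by (simp add: tensor_coalg_def Let_def)
  then have "sw (tensor_coalg K A B) V (tens K A B a b) f
    = tlift V f (sw A ABAB a (\<lambda>a1 a2. sw B ABAB b (\<lambda>b1 b2.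
        tens K AB AB (tens K A B a1 b1) (tens K A B a2 b2))))"
    by (simp add: sweedler2_def[of "tensor_coalg K A B"])
  also have "\<dots> = sw A V a (\<lambda>a1 a2. sw B V b (\<lambda>b1 b2. tlift V f (tens K AB AB (tens K A B a1 b1) (tens K A B a2 b2))))"
    by (rule sw_push2) (rule I fl | assumption)+
  also have "\<dots> = sw A V a (\<lambda>a1 a2. sw B V b (\<lambda>b1 b2. f (tens K A B a1 b1) (tens K A B a2 b2)))"
    by (rule sw_cong) (rule sw_cong I fl | assumption)+
  finally show ?thesis .
qed

end

lemmas sw_tensor_closed = sw_closed[where C="tensor_coalg K A B" for A B, unfolded tensor_coalg_simps]
lemmas sw_tensor_cong = sw_cong[where C="tensor_coalg K A B" for A B, unfolded tensor_coalg_simps]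
lemmas sw_from_tensor = sw_coalg_hom[where C="tensor_coalg K A B" for A B, unfolded tensor_coalg_simps]
lemmas sw_tensor_push = sw_push[where C="tensor_coalg K A B" for A B, unfolded tensor_coalg_simps]
lemmas lin_sw_tensor = lin_sw[where C="tensor_coalg K A B" for A B, unfolded tensor_coalg_simps]
lemmas lin_sw_tensor_param = lin_sw_param[where C="tensor_coalg K A B" for A B, unfolded tensor_coalg_simps]

lemma tensor_counit:
  assumes A: "k_coalgebra K A" and B: "k_coalgebra K B"
  shows "counit (tensor_coalg K A B) \<in> linear_hom K (tensor_alg K A B) (ground K)"
    and "\<And>a b. \<lbrakk>a \<in> carrier A; b \<in> carrier B\<rbrakk>
      \<Longrightarrow> counit (tensor_coalg K A B) (tens K A B a b) = counit A a \<otimes>\<^bsub>K\<^esub> counit B b"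
proof -
  note m = coalgebra_module[OF A] coalgebra_module[OF B]
  have b: "bilin K A B (ground K) (\<lambda>a b. counit A a \<otimes>\<^bsub>K\<^esub> counit B b)"
    by (rule lin_intros A B | assumption)+
  have e: "counit (tensor_coalg K A B) = tlift (ground K) (\<lambda>a b. counit A a \<otimes>\<^bsub>K\<^esub> counit B b)"
    by (simp add: tensor_coalg_def Let_def ground_sweedler)
  show "counit (tensor_coalg K A B) \<in> linear_hom K (tensor_alg K A B) (ground K)"
    unfolding e by (rule tlift_linear(1)[OF m module_ground b])
  show "counit (tensor_coalg K A B) (tens K A B a b) = counit A a \<otimes>\<^bsub>K\<^esub> counit B b"
    if "a \<in> carrier A" "b \<in> carrier B" for a b
    unfolding e by (rule tlift_linear(2)[OF m module_ground b that])
qed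

text \<open>
  Two applications of the rule for pure tensors produce the sums over \<open>a\<close> and \<open>b\<close> in alternating
  order; interchanging the middle two separates them.
\<close>

lemma sweedler3_tensor:
  assumes A: "comultiplication K A" and B: "comultiplication K B" and V: "module K V"
    and g1: "\<And>y z. \<lbrakk>y \<in> carrier (tensor_alg K A B); z \<in> carrier (tensor_alg K A B)\<rbrakk>
      \<Longrightarrow> (\<lambda>x. G x y z) \<in> linear_hom K (tensor_alg K A B) V"
    and g2: "\<And>x z. \<lbrakk>x \<in> carrier (tensor_alg K A B); z \<in> carrier (tensor_alg K A B)\<rbrakk>
      \<Longrightarrow> (\<lambda>y. G x y z) \<in> linear_hom K (tensor_alg K A B) V"
    and g3: "\<And>x y. \<lbrakk>x \<in> carrier (tensor_alg K A B); y \<in> carrier (tensor_alg K A B)\<rbrakk>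
      \<Longrightarrow> (\<lambda>z. G x y z) \<in> linear_hom K (tensor_alg K A B) V"
    and ab: "a \<in> carrier A" "b \<in> carrier B"
  shows "sweedler3 (tensor_coalg K A B) V (tens K A B a b) G
    = sweedler3 A V a (\<lambda>a1 a2 a3. sweedler3 B V b (\<lambda>b1 b2 b3.
        G (tens K A B a1 b1) (tens K A B a2 b2) (tens K A B a3 b3)))"
  unfolding sweedler3_def
proof -
  let ?T = "tensor_alg K A B" and ?TC = "tensor_coalg K A B" and ?t = "tens K A B"
  note mA = comultiplication_module[OF A] and mB = comultiplication_module[OF B]
  note cT = tensor_coalg_comultiplication[OF A B]
  have g: "G x y z \<in> carrier V" if "x \<in> carrier ?T" "y \<in> carrier ?T" "z \<in> carrier ?T" for x y z
    by (rule linear_hom_closed[OF g1]) (rule that)+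
  note I = sw_tensor_closed lin_sw_tensor lin_sw_tensor_param lin_intros
    linear_hom_comp[OF g1] linear_hom_comp[OF g2] linear_hom_comp[OF g3] g
    mA mB A B cT V
  have "sw ?TC V (?t a b) (\<lambda>x z3. sw ?TC V x (\<lambda>z1 z2. G z1 z2 z3))
    = sw A V a (\<lambda>ax a3. sw B V b (\<lambda>bx b3.
        sw ?TC V (?t ax bx) (\<lambda>z1 z2. G z1 z2 (?t a3 b3))))"
    by (rule sw_tensor) (rule I ab | assumption)+
  also have "\<dots> = sw A V a (\<lambda>ax a3. sw B V b (\<lambda>bx b3. sw A V ax (\<lambda>a1 a2. sw B V bx (\<lambda>b1 b2.
        G (?t a1 b1) (?t a2 b2) (?t a3 b3)))))"
    by (rule sw_cong) (rule sw_tensor sw_cong I ab | assumption)+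
  also have "\<dots> = sw A V a (\<lambda>ax a3. sw A V ax (\<lambda>a1 a2.
    sw B V b (\<lambda>bx b3. sw B V bx (\<lambda>b1 b2. G (?t a1 b1) (?t a2 b2) (?t a3 b3)))))"
    by (rule sw_cong) (rule sw_swap I ab | assumption)+
  finally show "sw ?TC V (?t a b) (\<lambda>x z3. sw ?TC V x (\<lambda>z1 z2. G z1 z2 z3))
    = sw A V a (\<lambda>x a3. sw A V x (\<lambda>a1 a2.
    sw B V b (\<lambda>x b3. sw B V x (\<lambda>b1 b2. G (?t a1 b1) (?t a2 b2) (?t a3 b3)))))" .
qed

text \<open>
  On a pure tensor both sides are iterated sums over its two factors, and coassociativity
  of each factor identifies them.
\<close>

lemma tensor_coalg_coassoc:
  assumes A: "k_coalgebra K A" and B: "k_coalgebra K B" and V: "module K V"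
    and g1: "\<And>y z. \<lbrakk>y \<in> carrier (tensor_alg K A B); z \<in> carrier (tensor_alg K A B)\<rbrakk>
      \<Longrightarrow> (\<lambda>x. G x y z) \<in> linear_hom K (tensor_alg K A B) V"
    and g2: "\<And>x z. \<lbrakk>x \<in> carrier (tensor_alg K A B); z \<in> carrier (tensor_alg K A B)\<rbrakk>
      \<Longrightarrow> (\<lambda>y. G x y z) \<in> linear_hom K (tensor_alg K A B) V"
    and g3: "\<And>x y. \<lbrakk>x \<in> carrier (tensor_alg K A B); y \<in> carrier (tensor_alg K A B)\<rbrakk>
      \<Longrightarrow> (\<lambda>z. G x y z) \<in> linear_hom K (tensor_alg K A B) V"
    and X: "X \<in> carrier (tensor_alg K A B)"
  shows "sw (tensor_coalg K A B) V X (\<lambda>x z3. sw (tensor_coalg K A B) V x (\<lambda>z1 z2. G z1 z2 z3))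
    = sw (tensor_coalg K A B) V X (\<lambda>z1 y. sw (tensor_coalg K A B) V y (\<lambda>z2 z3. G z1 z2 z3))"
    (is "?L X = ?R X")
proof (rule linear_ext[OF _ _ _ _ _ X, where f="?L" and g="?R"])
  let ?T = "tensor_alg K A B" and ?TC = "tensor_coalg K A B" and ?t = "tens K A B"
  note mA = coalgebra_module[OF A] and mB = coalgebra_module[OF B]
    and cA = coalgebra_comultiplication[OF A] and cB = coalgebra_comultiplication[OF B]
  note cT = tensor_coalg_comultiplication[OF cA cB]
  have g: "G x y z \<in> carrier V" if "x \<in> carrier ?T" "y \<in> carrier ?T" "z \<in> carrier ?T" for x y z
    by (rule linear_hom_closed[OF g1]) (rule that)+
  note I = sw_tensor_closed lin_sw_tensor lin_sw_tensor_param lin_intros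
    linear_hom_comp[OF g1] linear_hom_comp[OF g2] linear_hom_comp[OF g3] g
    mA mB cA cB cT V
  show "module K A" "module K B" by (rule mA mB)+
  show "?L \<in> linear_hom K ?T V" "?R \<in> linear_hom K ?T V" by (rule I | assumption)+
  fix a b assume ab: "a \<in> carrier A" "b \<in> carrier B"
  have "?L (?t a b) = sw A V a (\<lambda>ax a3. sw A V ax (\<lambda>a1 a2.
      sw B V b (\<lambda>bx b3. sw B V bx (\<lambda>b1 b2. G (?t a1 b1) (?t a2 b2) (?t a3 b3)))))"
    by (rule sweedler3_tensor[OF cA cB V g1 g2 g3 ab, unfolded sweedler3_def])
  also have "\<dots> = sw A V a (\<lambda>ax a3. sw A V ax (\<lambda>a1 a2.
      sw B V b (\<lambda>b1 y. sw B V y (\<lambda>b2 b3. G (?t a1 b1) (?t a2 b2) (?t a3 b3)))))"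
    by (rule sw_cong) (rule sw_coassoc sw_cong I ab B | assumption)+
  finally have L: "?L (?t a b) = sw A V a (\<lambda>ax a3. sw A V ax (\<lambda>a1 a2.
      sw B V b (\<lambda>b1 y. sw B V y (\<lambda>b2 b3. G (?t a1 b1) (?t a2 b2) (?t a3 b3)))))" .
  have "?R (?t a b) = sw A V a (\<lambda>a1 ay. sw B V b (\<lambda>b1 y.
      sw ?TC V (?t ay y) (\<lambda>z2 z3. G (?t a1 b1) z2 z3)))"
    by (rule sw_tensor) (rule I ab | assumption)+
  also have "\<dots> = sw A V a (\<lambda>a1 ay. sw B V b (\<lambda>b1 y. sw A V ay (\<lambda>a2 a3. sw B V y (\<lambda>b2 b3.
        G (?t a1 b1) (?t a2 b2) (?t a3 b3)))))"
    by (rule sw_cong) (rule sw_tensor sw_cong I ab | assumption)+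
  also have "\<dots> = sw A V a (\<lambda>a1 ay. sw A V ay (\<lambda>a2 a3.
    sw B V b (\<lambda>b1 y. sw B V y (\<lambda>b2 b3. G (?t a1 b1) (?t a2 b2) (?t a3 b3)))))"
    by (rule sw_cong) (rule sw_swap I ab | assumption)+
  also have "\<dots> = ?L (?t a b)"
    unfolding L by (rule sym, rule sw_coassoc) (rule I ab A | assumption)+
  finally show "?L (?t a b) = ?R (?t a b)" ..
qed

lemma smult_left_commute:
  assumes "module K V" "k \<in> carrier K" "l \<in> carrier K" "v \<in> carrier V"
  shows "k \<odot>\<^bsub>V\<^esub> (l \<odot>\<^bsub>V\<^esub> v) = l \<odot>\<^bsub>V\<^esub> (k \<odot>\<^bsub>V\<^esub> v)"
  using assms module.smult_assoc1[OF assms(1)] m_comm by metis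

lemma tensor_coalgebra:
  assumes A: "k_coalgebra K A" and B: "k_coalgebra K B"
  shows "k_coalgebra K (tensor_coalg K A B)"
proof -
  let ?T = "tensor_alg K A B" and ?TC = "tensor_coalg K A B" and ?t = "tens K A B"
  let ?TT = "tensor_alg K ?T ?T"
  let ?TTT = "tensor_alg K ?T ?TT"
  note mA = coalgebra_module[OF A] and mB = coalgebra_module[OF B]
    and cA = coalgebra_comultiplication[OF A] and cB = coalgebra_comultiplication[OF B]
  note cT = tensor_coalg_comultiplication[OF cA cB]
  note eT = tensor_counit[OF A B]
  note I = sw_tensor_closed lin_sw_tensor lin_sw_tensor_param lin_intros
    linear_hom_comp[OF eT(1)] linear_hom_closed[OF eT(1), unfolded carrier_ground]
    mA mB cA cB cT A B
  have tt: "tens K ?TC ?TT = tens K ?T ?TT" "tensor_alg K ?TC ?TT = ?TTT"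
    using tensor_group_cong_structure[OF tensor_coalg_sel(1,3,4) refl refl refl, of A B ?TT]
    unfolding tensor_alg_def[of K ?TC ?TT] tensor_alg_def[of K ?T ?TT] tensor_coalg_sel by simp_all
  have mT: "module K ?T" by (rule I)+
  have co: "sw ?TC ?TTT c (\<lambda>x c3. sw ?TC ?TTT x (\<lambda>c1 c2. tens K ?T ?TT c1 (tens K ?T ?T c2 c3)))
       = sw ?TC ?TTT c (\<lambda>c1 y. sw ?TC ?TTT y (\<lambda>c2 c3. tens K ?T ?TT c1 (tens K ?T ?T c2 c3)))"
    if "c \<in> carrier ?T" for c
    by (rule tensor_coalg_coassoc[OF A B]) (rule I that | assumption)+
  note S = eT(2) module.smult_assoc1[OF mT] smult_left_commute[OF mT] counit_closed[OF A] counit_closed[OF B]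
    tens_closed mA mB smult_closed'[OF mT]
  have l: "sw ?TC ?T c (\<lambda>c1 c2. counit ?TC c1 \<odot>\<^bsub>?T\<^esub> c2) = c" (is "?l c = c")
    and r: "sw ?TC ?T c (\<lambda>c1 c2. counit ?TC c2 \<odot>\<^bsub>?T\<^esub> c1) = c" (is "?r c = c") if c: "c \<in> carrier ?T" for c
  proof -
    show "?l c = c"
    proof (rule linear_ext[OF mA mB _ linear_hom_id _ c])
      show "?l \<in> linear_hom K ?T ?T" by (rule I | assumption)+
      fix a b assume ab: "a \<in> carrier A" "b \<in> carrier B"
      have "?l (?t a b) = sw A ?T a (\<lambda>a1 a2. sw B ?T b (\<lambda>b1 b2. counit ?TC (?t a1 b1) \<odot>\<^bsub>?T\<^esub> ?t a2 b2))"
        by (rule sw_tensor) (rule I ab | assumption)+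
      also have "\<dots> = sw A ?T a (\<lambda>a1 a2. sw B ?T b (\<lambda>b1 b2. counit B b1 \<odot>\<^bsub>?T\<^esub> (counit A a1 \<odot>\<^bsub>?T\<^esub> ?t a2 b2)))"
        by (rule sw_cong) (rule sw_cong I ab | assumption | (simp add: S; fail))+
      also have "\<dots> = sw A ?T a (\<lambda>a1 a2. counit A a1 \<odot>\<^bsub>?T\<^esub> ?t a2 b)"
        by (rule sw_cong) (rule sw_counit_left I ab | assumption)+
      also have "\<dots> = ?t a b"
        by (rule sw_counit_left) (rule I ab | assumption)+
      finally show "?l (?t a b) = ?t a b" .
    qed
    show "?r c = c"
    proof (rule linear_ext[OF mA mB _ linear_hom_id _ c])
      show "?r \<in> linear_hom K ?T ?T" by (rule I | assumption)+
      fix a b assume ab: "a \<in> carrier A" "b \<in> carrier B"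
      have "?r (?t a b) = sw A ?T a (\<lambda>a1 a2. sw B ?T b (\<lambda>b1 b2. counit ?TC (?t a2 b2) \<odot>\<^bsub>?T\<^esub> ?t a1 b1))"
        by (rule sw_tensor) (rule I ab | assumption)+
      also have "\<dots> = sw A ?T a (\<lambda>a1 a2. sw B ?T b (\<lambda>b1 b2. counit B b2 \<odot>\<^bsub>?T\<^esub> (counit A a2 \<odot>\<^bsub>?T\<^esub> ?t a1 b1)))"
        by (rule sw_cong) (rule sw_cong I ab | assumption | (simp add: S; fail))+
      also have "\<dots> = sw A ?T a (\<lambda>a1 a2. counit A a2 \<odot>\<^bsub>?T\<^esub> ?t a1 b)"
        by (rule sw_cong) (rule sw_counit_right I ab | assumption)+
      also have "\<dots> = ?t a b"
        by (rule sw_counit_right) (rule I ab | assumption)+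
      finally show "?r (?t a b) = ?t a b" .
    qed
  qed
  show ?thesis
  proof (intro k_coalgebra.intro k_coalgebra_axioms.intro, unfold tensor_coalg_simps tensor_coalg_sel tt Let_def)
    show "field K" using A by (simp add: k_coalgebra_def)
    show "module K ?TC" by (rule tensor_coalg_module[OF mA mB])
    show "comult ?TC \<in> linear_hom K ?T ?TT"
      using cT unfolding comultiplication_def tensor_coalg_simps by simp
  qed (rule co l r eT | assumption)+
qed

end

section \<open>Coalgebra maps into a tensor product\<close>

text \<open>
  The map \<open>id \<otimes> \<epsilon>\<close>.
\<close>

definition tensor_fst ::
  "('k, 'a, 'm) hopf_scheme \<Rightarrow> ('k, 'b, 'l) hopf_scheme \<Rightarrow> ('a, 'b) tensor \<Rightarrow> 'a" where
  "tensor_fst A B = tlift A (\<lambda>a b. counit B b \<odot>\<^bsub>A\<^esub> a)"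

text \<open>
  The map \<open>\<epsilon> \<otimes> id\<close>.
\<close>

definition tensor_snd ::
  "('k, 'a, 'm) hopf_scheme \<Rightarrow> ('k, 'b, 'l) hopf_scheme \<Rightarrow> ('a, 'b) tensor \<Rightarrow> 'b" where
  "tensor_snd A B = tlift B (\<lambda>a b. counit A a \<odot>\<^bsub>B\<^esub> b)"

text \<open>
  The map \<open>(f \<otimes> g) \<circ> \<Delta>\<close>.
\<close>

definition pairing ::
  "('k, 'n) ring_scheme \<Rightarrow> ('k, 'c, 'o) hopf_scheme \<Rightarrow> ('k, 'a, 'm) hopf_scheme \<Rightarrow> ('k, 'b, 'l) hopf_scheme
    \<Rightarrow> ('c \<Rightarrow> 'a) \<Rightarrow> ('c \<Rightarrow> 'b) \<Rightarrow> 'c \<Rightarrow> ('a, 'b) tensor" where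
  "pairing K C A B f g c = sw C (tensor_alg K A B) c (\<lambda>c1 c2. tens K A B (f c1) (g c2))"

text \<open>
  The condition that makes \<open>(f \<otimes> g) \<circ> \<Delta>\<close> a coalgebra map; it is automatic for cocommutative \<open>C\<close>.
\<close>

definition commuting ::
  "('k, 'n) ring_scheme \<Rightarrow> ('k, 'c, 'o) hopf_scheme \<Rightarrow> ('k, 'a, 'm) hopf_scheme \<Rightarrow> ('k, 'b, 'l) hopf_scheme
    \<Rightarrow> ('c \<Rightarrow> 'a) \<Rightarrow> ('c \<Rightarrow> 'b) \<Rightarrow> bool" where
  "commuting K C A B f g \<longleftrightarrow> (\<forall>c\<in>carrier C.
     sw C (tensor_alg K A B) c (\<lambda>c1 c2. tens K A B (f c1) (g c2)) =
     sw C (tensor_alg K A B) c (\<lambda>c1 c2. tens K A B (f c2) (g c1)))"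

context over_ring
begin

text \<open>
  Splitting both legs of \<open>c\<close> gives the same four legs as splitting off the outer two and then splitting
  the middle one. In the second form the two middle legs come from a single element.
\<close>

lemma sw_middle:
  assumes C: "k_coalgebra K C" and V: "module K V" and c: "c \<in> carrier C"
    and g1: "\<And>x y z. \<lbrakk>x \<in> carrier C; y \<in> carrier C; z \<in> carrier C\<rbrakk> \<Longrightarrow> (\<lambda>w. G w x y z) \<in> linear_hom K C V"
    and g2: "\<And>x y z. \<lbrakk>x \<in> carrier C; y \<in> carrier C; z \<in> carrier C\<rbrakk> \<Longrightarrow> (\<lambda>w. G x w y z) \<in> linear_hom K C V"
    and g3: "\<And>x y z. \<lbrakk>x \<in> carrier C; y \<in> carrier C; z \<in> carrier C\<rbrakk> \<Longrightarrow> (\<lambda>w. G x y w z) \<in> linear_hom K C V"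
    and g4: "\<And>x y z. \<lbrakk>x \<in> carrier C; y \<in> carrier C; z \<in> carrier C\<rbrakk> \<Longrightarrow> (\<lambda>w. G x y z w) \<in> linear_hom K C V"
  shows "sw C V c (\<lambda>x y. sw C V x (\<lambda>c1 c2. sw C V y (\<lambda>c3 c4. G c1 c2 c3 c4)))
    = sw C V c (\<lambda>c1 y. sw C V y (\<lambda>w c4. sw C V w (\<lambda>c2 c3. G c1 c2 c3 c4)))"
proof -
  note mC = coalgebra_module[OF C] and cC = coalgebra_comultiplication[OF C]
  note I = lin_intros C cC V mC c g1 g2 g3 g4
  have "sw C V c (\<lambda>x y. sw C V x (\<lambda>c1 c2. sw C V y (\<lambda>c3 c4. G c1 c2 c3 c4)))
    = sw C V c (\<lambda>c1 w. sw C V w (\<lambda>c2 y. sw C V y (\<lambda>c3 c4. G c1 c2 c3 c4)))"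
    by (rule sw_coassoc) (rule I | assumption)+
  also have "\<dots> = sw C V c (\<lambda>c1 y. sw C V y (\<lambda>w c4. sw C V w (\<lambda>c2 c3. G c1 c2 c3 c4)))"
    by (rule sw_cong) (rule I sw_coassoc[symmetric] | assumption)+
  finally show ?thesis .
qed

lemma tens_smult_left:
  assumes "module K A" "module K B" "k \<in> carrier K" "a \<in> carrier A" "b \<in> carrier B"
  shows "tens K A B (k \<odot>\<^bsub>A\<^esub> a) b = k \<odot>\<^bsub>tensor_alg K A B\<^esub> tens K A B a b"
  by (rule linear_hom_smult[OF bilin_left[OF bilin_tens]]) (rule assms)+

lemma tens_smult_right:
  assumes "module K A" "module K B" "k \<in> carrier K" "a \<in> carrier A" "b \<in> carrier B"
  shows "tens K A B a (k \<odot>\<^bsub>B\<^esub> b) = k \<odot>\<^bsub>tensor_alg K A B\<^esub> tens K A B a b"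
  by (rule linear_hom_smult[OF bilin_right[OF bilin_tens]]) (rule assms)+

lemma tensor_fst_linear:
  assumes A: "k_coalgebra K A" and B: "k_coalgebra K B"
  shows "tensor_fst A B \<in> linear_hom K (tensor_alg K A B) A"
    and "\<And>a b. \<lbrakk>a \<in> carrier A; b \<in> carrier B\<rbrakk> \<Longrightarrow> tensor_fst A B (tens K A B a b) = counit B b \<odot>\<^bsub>A\<^esub> a"
proof -
  note mA = coalgebra_module[OF A] and mB = coalgebra_module[OF B]
  have "bilin K A B A (\<lambda>a b. counit B b \<odot>\<^bsub>A\<^esub> a)"
    by (rule lin_intros A B mA mB | assumption)+
  note t = tlift_linear[OF mA mB mA this]
  show "tensor_fst A B \<in> linear_hom K (tensor_alg K A B) A"
    "\<And>a b. \<lbrakk>a \<in> carrier A; b \<in> carrier B\<rbrakk> \<Longrightarrow> tensor_fst A B (tens K A B a b) = counit B b \<odot>\<^bsub>A\<^esub> a"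
    unfolding tensor_fst_def by (rule t; assumption)+
qed

lemma tensor_snd_linear:
  assumes A: "k_coalgebra K A" and B: "k_coalgebra K B"
  shows "tensor_snd A B \<in> linear_hom K (tensor_alg K A B) B"
    and "\<And>a b. \<lbrakk>a \<in> carrier A; b \<in> carrier B\<rbrakk> \<Longrightarrow> tensor_snd A B (tens K A B a b) = counit A a \<odot>\<^bsub>B\<^esub> b"
proof -
  note mA = coalgebra_module[OF A] and mB = coalgebra_module[OF B]
  have "bilin K A B B (\<lambda>a b. counit A a \<odot>\<^bsub>B\<^esub> b)"
    by (rule lin_intros A B mA mB | assumption)+
  note t = tlift_linear[OF mA mB mB this]
  show "tensor_snd A B \<in> linear_hom K (tensor_alg K A B) B"
    "\<And>a b. \<lbrakk>a \<in> carrier A; b \<in> carrier B\<rbrakk> \<Longrightarrow> tensor_snd A B (tens K A B a b) = counit A a \<odot>\<^bsub>B\<^esub> b"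
    unfolding tensor_snd_def by (rule t; assumption)+
qed

lemma tensor_fst_coalg_hom:
  assumes A: "k_coalgebra K A" and B: "k_coalgebra K B"
  shows "tensor_fst A B \<in> coalg_hom K (tensor_coalg K A B) A"
proof (rule coalg_homI, unfold tensor_coalg_simps)
  let ?T = "tensor_alg K A B" and ?TC = "tensor_coalg K A B" and ?t = "tens K A B" and ?p = "tensor_fst A B"
  let ?AA = "tensor_alg K A A" and ?tA = "tens K A A"
  note mA = coalgebra_module[OF A] and mB = coalgebra_module[OF B]
    and cA = coalgebra_comultiplication[OF A] and cB = coalgebra_comultiplication[OF B]
  note cT = tensor_coalg_comultiplication[OF cA cB]
  note eT = tensor_counit[OF A B] and p = tensor_fst_linear[OF A B]
  have lA: "comult A \<in> linear_hom K A ?AA" using cA by (simp add: comultiplication_def)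
  note I = sw_tensor_closed lin_sw_tensor lin_sw_tensor_param lin_intros p(1)
    linear_hom_comp[OF p(1)] linear_hom_closed[OF p(1)]
    mA mB cA cB cT A B
  show p': "?p \<in> linear_hom K ?T A" by (rule p)
  fix X assume X: "X \<in> carrier ?T"
  show "counit A (?p X) = counit ?TC X"
  proof (rule linear_ext[OF mA mB _ eT(1) _ X])
    show "(\<lambda>X. counit A (?p X)) \<in> linear_hom K ?T (ground K)" by (rule I)+
    show "counit A (?p (?t a b)) = counit ?TC (?t a b)" if ab: "a \<in> carrier A" "b \<in> carrier B" for a b
    proof -
      have c: "counit A a \<in> carrier K" "counit B b \<in> carrier K" by (rule I ab)+
      show ?thesis
        unfolding p(2)[OF ab] eT(2)[OF ab] linear_hom_smult[OF k_coalgebra.counit_linear[OF A] c(2) ab(1)]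
        using c by (simp add: ground_def m_comm)
    qed
  qed
  show "comult A (?p X) = sw ?TC ?AA X (\<lambda>x y. ?tA (?p x) (?p y))"
  proof (rule linear_ext[OF mA mB _ _ _ X])
    show "(\<lambda>X. comult A (?p X)) \<in> linear_hom K ?T ?AA" by (rule linear_hom_comp[OF lA p(1)])
    show "(\<lambda>X. sw ?TC ?AA X (\<lambda>x y. ?tA (?p x) (?p y))) \<in> linear_hom K ?T ?AA"
      by (rule I | assumption)+
    fix a b assume ab: "a \<in> carrier A" "b \<in> carrier B"
    have eb: "counit B b \<in> carrier K" by (rule I ab)+
    have "sw ?TC ?AA (?t a b) (\<lambda>x y. ?tA (?p x) (?p y))
      = sw A ?AA a (\<lambda>a1 a2. sw B ?AA b (\<lambda>b1 b2. ?tA (?p (?t a1 b1)) (?p (?t a2 b2))))"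
      by (rule sw_tensor) (rule I ab | assumption)+
    also have "\<dots> = sw A ?AA a (\<lambda>a1 a2. sw B ?AA b (\<lambda>b1 b2. counit B b1 \<odot>\<^bsub>?AA\<^esub> (counit B b2 \<odot>\<^bsub>?AA\<^esub> ?tA a1 a2)))"
      by (rule sw_cong) (rule sw_cong I ab | assumption | (simp add: p(2) tens_smult_left tens_smult_right mA
        smult_closed' counit_closed[OF B] smult_left_commute tensor_alg_module tens_closed; fail))+
    also have "\<dots> = sw A ?AA a (\<lambda>a1 a2. counit B b \<odot>\<^bsub>?AA\<^esub> ?tA a1 a2)"
      by (rule sw_cong) (rule sw_counit_left I ab | assumption)+
    also have "\<dots> = counit B b \<odot>\<^bsub>?AA\<^esub> sw A ?AA a (\<lambda>a1 a2. ?tA a1 a2)"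
      by (rule sym, rule sw_push[where h="\<lambda>x. counit B b \<odot>\<^bsub>?AA\<^esub> x"]) (rule I ab | assumption)+
    also have "\<dots> = comult A (?p (?t a b))"
      unfolding p(2)[OF ab] linear_hom_smult[OF lA eb ab(1)] sw_tens[OF cA ab(1)] ..
    finally show "comult A (?p (?t a b)) = sw ?TC ?AA (?t a b) (\<lambda>x y. ?tA (?p x) (?p y))" ..
  qed
qed

lemma tensor_snd_coalg_hom:
  assumes A: "k_coalgebra K A" and B: "k_coalgebra K B"
  shows "tensor_snd A B \<in> coalg_hom K (tensor_coalg K A B) B"
proof (rule coalg_homI, unfold tensor_coalg_simps)
  let ?T = "tensor_alg K A B" and ?TC = "tensor_coalg K A B" and ?t = "tens K A B" and ?q = "tensor_snd A B"
  let ?BB = "tensor_alg K B B" and ?tB = "tens K B B"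
  note mA = coalgebra_module[OF A] and mB = coalgebra_module[OF B]
    and cA = coalgebra_comultiplication[OF A] and cB = coalgebra_comultiplication[OF B]
  note cT = tensor_coalg_comultiplication[OF cA cB]
  note eT = tensor_counit[OF A B] and q = tensor_snd_linear[OF A B]
  have lB: "comult B \<in> linear_hom K B ?BB" using cB by (simp add: comultiplication_def)
  note I = sw_tensor_closed lin_sw_tensor lin_sw_tensor_param lin_intros q(1)
    linear_hom_comp[OF q(1)] linear_hom_closed[OF q(1)]
    mA mB cA cB cT A B
  show q': "?q \<in> linear_hom K ?T B" by (rule q)
  fix X assume X: "X \<in> carrier ?T"
  show "counit B (?q X) = counit ?TC X"
  proof (rule linear_ext[OF mA mB _ eT(1) _ X])
    show "(\<lambda>X. counit B (?q X)) \<in> linear_hom K ?T (ground K)" by (rule I)+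
    show "counit B (?q (?t a b)) = counit ?TC (?t a b)" if ab: "a \<in> carrier A" "b \<in> carrier B" for a b
    proof -
      have c: "counit A a \<in> carrier K" "counit B b \<in> carrier K" by (rule I ab)+
      show ?thesis
        unfolding q(2)[OF ab] eT(2)[OF ab] linear_hom_smult[OF k_coalgebra.counit_linear[OF B] c(1) ab(2)]
        using c by (simp add: ground_def)
    qed
  qed
  show "comult B (?q X) = sw ?TC ?BB X (\<lambda>x y. ?tB (?q x) (?q y))"
  proof (rule linear_ext[OF mA mB _ _ _ X])
    show "(\<lambda>X. comult B (?q X)) \<in> linear_hom K ?T ?BB" by (rule linear_hom_comp[OF lB q(1)])
    show "(\<lambda>X. sw ?TC ?BB X (\<lambda>x y. ?tB (?q x) (?q y))) \<in> linear_hom K ?T ?BB"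
      by (rule I | assumption)+
    fix a b assume ab: "a \<in> carrier A" "b \<in> carrier B"
    have ea: "counit A a \<in> carrier K" by (rule I ab)+
    have "sw ?TC ?BB (?t a b) (\<lambda>x y. ?tB (?q x) (?q y))
      = sw A ?BB a (\<lambda>a1 a2. sw B ?BB b (\<lambda>b1 b2. ?tB (?q (?t a1 b1)) (?q (?t a2 b2))))"
      by (rule sw_tensor) (rule I ab | assumption)+
    also have "\<dots> = sw A ?BB a (\<lambda>a1 a2. sw B ?BB b (\<lambda>b1 b2. counit A a1 \<odot>\<^bsub>?BB\<^esub> (counit A a2 \<odot>\<^bsub>?BB\<^esub> ?tB b1 b2)))"
      by (rule sw_cong) (rule sw_cong I ab | assumption | (simp add: q(2) tens_smult_left tens_smult_right mB
        smult_closed' counit_closed[OF A] smult_left_commute tensor_alg_module tens_closed; fail))+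
    also have "\<dots> = sw A ?BB a (\<lambda>a1 a2. counit A a1 \<odot>\<^bsub>?BB\<^esub> (counit A a2 \<odot>\<^bsub>?BB\<^esub> sw B ?BB b (\<lambda>b1 b2. ?tB b1 b2)))"
      by (rule sw_cong) (rule I ab | assumption | (rule sym, rule sw_push[where V="?BB" and
        h="\<lambda>x. counit A k1 \<odot>\<^bsub>?BB\<^esub> (counit A k2 \<odot>\<^bsub>?BB\<^esub> x)" for k1 k2]))+
    also have "\<dots> = sw A ?BB a (\<lambda>a1 a2. counit A a1 \<odot>\<^bsub>?BB\<^esub> (counit A a2 \<odot>\<^bsub>?BB\<^esub> comult B b))"
      unfolding sw_tens[OF cB ab(2)] ..
    also have "\<dots> = counit A a \<odot>\<^bsub>?BB\<^esub> comult B b"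
      by (rule sw_counit_left) (rule I ab linear_hom_closed[OF lB] | assumption)+
    also have "\<dots> = comult B (?q (?t a b))"
      unfolding q(2)[OF ab] linear_hom_smult[OF lB ea ab(2)] ..
    finally show "comult B (?q (?t a b)) = sw ?TC ?BB (?t a b) (\<lambda>x y. ?tB (?q x) (?q y))" ..
  qed
qed

text \<open>
  The reason why the components of a map into \<open>A \<otimes> B\<close> determine it if it is a coalgebra map: the counits
  remove exactly the superfluous legs, in either order.
\<close>

lemma tensor_fst_snd:
  assumes A: "k_coalgebra K A" and B: "k_coalgebra K B" and X: "X \<in> carrier (tensor_alg K A B)"
  shows "sw (tensor_coalg K A B) (tensor_alg K A B) X
      (\<lambda>x y. tens K A B (tensor_fst A B x) (tensor_snd A B y)) = X" (is ?P)
    and "sw (tensor_coalg K A B) (tensor_alg K A B) X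
      (\<lambda>x y. tens K A B (tensor_fst A B y) (tensor_snd A B x)) = X" (is ?Q)
proof -
  let ?T = "tensor_alg K A B" and ?TC = "tensor_coalg K A B" and ?t = "tens K A B"
    and ?p = "tensor_fst A B" and ?q = "tensor_snd A B"
  note mA = coalgebra_module[OF A] and mB = coalgebra_module[OF B]
    and cA = coalgebra_comultiplication[OF A] and cB = coalgebra_comultiplication[OF B]
  note cT = tensor_coalg_comultiplication[OF cA cB]
  note p = tensor_fst_linear[OF A B] and q = tensor_snd_linear[OF A B]
  note I = sw_tensor_closed lin_sw_tensor lin_sw_tensor_param lin_intros
    linear_hom_comp[OF p(1)] linear_hom_closed[OF p(1)]
    linear_hom_comp[OF q(1)] linear_hom_closed[OF q(1)]
    mA mB cA cB cT A B
  note S = p(2) q(2) tens_smult_left tens_smult_right mA mB smult_closed' counit_closed[OF A]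
    counit_closed[OF B] smult_left_commute tensor_alg_module tens_closed
  show ?P
  proof (rule linear_ext[OF mA mB _ linear_hom_id _ X])
    show "(\<lambda>X. sw ?TC ?T X (\<lambda>x y. ?t (?p x) (?q y))) \<in> linear_hom K ?T ?T"
      by (rule I | assumption)+
    fix a b assume ab: "a \<in> carrier A" "b \<in> carrier B"
    have "sw ?TC ?T (?t a b) (\<lambda>x y. ?t (?p x) (?q y))
      = sw A ?T a (\<lambda>a1 a2. sw B ?T b (\<lambda>b1 b2. ?t (?p (?t a1 b1)) (?q (?t a2 b2))))" (is "?l = _")
      by (rule sw_tensor) (rule I ab | assumption)+
    also have "\<dots> = sw A ?T a (\<lambda>a1 a2. sw B ?T b (\<lambda>b1 b2. counit B b1 \<odot>\<^bsub>?T\<^esub> (counit A a2 \<odot>\<^bsub>?T\<^esub> ?t a1 b2)))"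
      by (rule sw_cong) (rule sw_cong I ab | assumption | (simp add: S; fail))+
    also have "\<dots> = sw A ?T a (\<lambda>a1 a2. counit A a2 \<odot>\<^bsub>?T\<^esub> ?t a1 b)"
      by (rule sw_cong) (rule sw_counit_left I ab | assumption)+
    also have "\<dots> = ?t a b" (is "_ = ?r")
      by (rule sw_counit_right) (rule I ab | assumption)+
    finally show "?l = ?r" .
  qed
  show ?Q
  proof (rule linear_ext[OF mA mB _ linear_hom_id _ X])
    show "(\<lambda>X. sw ?TC ?T X (\<lambda>x y. ?t (?p y) (?q x))) \<in> linear_hom K ?T ?T"
      by (rule I | assumption)+
    fix a b assume ab: "a \<in> carrier A" "b \<in> carrier B"
    have "sw ?TC ?T (?t a b) (\<lambda>x y. ?t (?p y) (?q x))
      = sw A ?T a (\<lambda>a1 a2. sw B ?T b (\<lambda>b1 b2. ?t (?p (?t a2 b2)) (?q (?t a1 b1))))" (is "?l = _")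
      by (rule sw_tensor) (rule I ab | assumption)+
    also have "\<dots> = sw A ?T a (\<lambda>a1 a2. sw B ?T b (\<lambda>b1 b2. counit B b2 \<odot>\<^bsub>?T\<^esub> (counit A a1 \<odot>\<^bsub>?T\<^esub> ?t a2 b1)))"
      by (rule sw_cong) (rule sw_cong I ab | assumption | (simp add: S; fail))+
    also have "\<dots> = sw A ?T a (\<lambda>a1 a2. counit A a1 \<odot>\<^bsub>?T\<^esub> ?t a2 b)"
      by (rule sw_cong) (rule sw_counit_right I ab | assumption)+
    also have "\<dots> = ?t a b" (is "_ = ?r")
      by (rule sw_counit_left) (rule I ab | assumption)+
    finally show "?l = ?r" .
  qed
qed

subsection \<open>Commuting pairs of coalgebra maps\<close>

context
  fixes C :: "('k, 'c, 'o) hopf_scheme" and A :: "('k, 'a, 'm) hopf_scheme" and B :: "('k, 'b, 'l) hopf_scheme"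
  assumes C: "k_coalgebra K C" and A: "k_coalgebra K A" and B: "k_coalgebra K B"
begin

private lemma m: "module K C" "module K A" "module K B"
  using A B C by (simp_all add: coalgebra_module)

private lemma c: "comultiplication K C" "comultiplication K A" "comultiplication K B"
  "comultiplication K (tensor_coalg K A B)"
  using A B C by (simp_all add: coalgebra_comultiplication tensor_coalgebra)

private abbreviation "U \<equiv> tensor_alg K A B"
private abbreviation "UC \<equiv> tensor_coalg K A B"
private abbreviation "UU \<equiv> tensor_alg K U U"
private abbreviation "u \<equiv> tens K A B"
private abbreviation "tU \<equiv> tens K U U"

lemma commuting_sw:
  assumes f: "f \<in> linear_hom K C A" and g: "g \<in> linear_hom K C B" and fg: "commuting K C A B f g"
    and V: "module K V" and M: "bilin K A B V M" and x: "x \<in> carrier C"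
  shows "sw C V x (\<lambda>c1 c2. M (f c1) (g c2)) = sw C V x (\<lambda>c1 c2. M (f c2) (g c1))"
proof -
  note M' = tlift_linear[OF m(2,3) V M]
  note I = lin_intros m c V x linear_hom_comp[OF f] linear_hom_closed[OF f]
    linear_hom_comp[OF g] linear_hom_closed[OF g]
    linear_hom_comp[OF bilin_left[OF M]] linear_hom_comp[OF bilin_right[OF M]] M'
  have "sw C V x (\<lambda>c1 c2. M (f c1) (g c2)) = sw C V x (\<lambda>c1 c2. tlift V M (u (f c1) (g c2)))"
    by (rule sym, rule sw_cong) (rule I | assumption)+
  also have "\<dots> = tlift V M (sw C U x (\<lambda>c1 c2. u (f c1) (g c2)))"
    by (rule sym, rule sw_push) (rule I | assumption)+
  also have "sw C U x (\<lambda>c1 c2. u (f c1) (g c2)) = sw C U x (\<lambda>c1 c2. u (f c2) (g c1))"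
    using fg x unfolding commuting_def by blast
  also have "tlift V M \<dots> = sw C V x (\<lambda>c1 c2. tlift V M (u (f c2) (g c1)))"
    by (rule sw_push) (rule I | assumption)+
  also have "\<dots> = sw C V x (\<lambda>c1 c2. M (f c2) (g c1))"
    by (rule sw_cong) (rule I | assumption)+
  finally show ?thesis .
qed

text \<open>
  The bilinear map \<open>(a, b) \<mapsto> b \<otimes> a\<close> exchanges the two sides of the condition.
\<close>

lemma commuting_flip:
  assumes f: "f \<in> linear_hom K C A" and g: "g \<in> linear_hom K C B" and fg: "commuting K C A B f g"
  shows "commuting K C B A g f"
  unfolding commuting_def
proof (intro ballI)
  fix x assume x: "x \<in> carrier C"
  show "sw C (tensor_alg K B A) x (\<lambda>c1 c2. tens K B A (g c1) (f c2))
    = sw C (tensor_alg K B A) x (\<lambda>c1 c2. tens K B A (g c2) (f c1))"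
    by (rule sym, rule commuting_sw[OF f g fg, where M="\<lambda>a b. tens K B A b a"])
       (rule lin_intros m x | assumption)+
qed

lemma pairing_linear:
  assumes f: "f \<in> linear_hom K C A" and g: "g \<in> linear_hom K C B"
  shows "pairing K C A B f g \<in> linear_hom K C U"
proof -
  note I = lin_intros m c linear_hom_comp[OF f] linear_hom_closed[OF f]
    linear_hom_comp[OF g] linear_hom_closed[OF g]
  have "(\<lambda>c. pairing K C A B f g c) \<in> linear_hom K C U"
    unfolding pairing_def by (rule I | assumption)+
  then show ?thesis by simp
qed

lemma pairing_fst_snd:
  assumes f: "f \<in> coalg_hom K C A" and g: "g \<in> coalg_hom K C B" and x: "x \<in> carrier C"
  shows "tensor_fst A B (pairing K C A B f g x) = f x" (is ?F)
    and "tensor_snd A B (pairing K C A B f g x) = g x" (is ?S)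
proof -
  note fl = coalg_hom_lin[OF f] and gl = coalg_hom_lin[OF g]
  note p = tensor_fst_linear[OF A B] and q = tensor_snd_linear[OF A B]
  note I = lin_intros m c x linear_hom_comp[OF fl] linear_hom_closed[OF fl] fl gl
    linear_hom_comp[OF gl] linear_hom_closed[OF gl] A B C p(1) q(1)
    linear_hom_comp[OF p(1)] linear_hom_comp[OF q(1)]
  note S = p(2) q(2) linear_hom_closed[OF fl] linear_hom_closed[OF gl]
    coalg_hom_counit[OF f] coalg_hom_counit[OF g]
  have "tensor_fst A B (pairing K C A B f g x) = sw C A x (\<lambda>c1 c2. tensor_fst A B (u (f c1) (g c2)))"
    unfolding pairing_def by (rule sw_push) (rule I | assumption)+
  also have "\<dots> = sw C A x (\<lambda>c1 c2. counit C c2 \<odot>\<^bsub>A\<^esub> f c1)"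
    by (rule sw_cong) (rule I | assumption | (simp add: S; fail))+
  also have "\<dots> = f x"
    by (rule sw_counit_right) (rule I | assumption)+
  finally show ?F .
  have "tensor_snd A B (pairing K C A B f g x) = sw C B x (\<lambda>c1 c2. tensor_snd A B (u (f c1) (g c2)))"
    unfolding pairing_def by (rule sw_push) (rule I | assumption)+
  also have "\<dots> = sw C B x (\<lambda>c1 c2. counit C c1 \<odot>\<^bsub>B\<^esub> g c2)"
    by (rule sw_cong) (rule I | assumption | (simp add: S; fail))+
  also have "\<dots> = g x"
    by (rule sw_counit_left) (rule I | assumption)+
  finally show ?S .
qed

text \<open>
  Comparing \<open>\<Delta>(f(c\<^sub>1) \<otimes> g(c\<^sub>2))\<close> with the required value, the four legs occur as \<open>f g\<close> on \<open>(1, 3)\<close> and \<open>(2, 4)\<close>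
  in one case and on \<open>(1, 2)\<close> and \<open>(3, 4)\<close> in the other. The two differ by the middle legs, on which \<open>f\<close> and \<open>g\<close>
  commute.
\<close>

lemma pairing_coalg_hom:
  assumes f: "f \<in> coalg_hom K C A" and g: "g \<in> coalg_hom K C B" and fg: "commuting K C A B f g"
  shows "pairing K C A B f g \<in> coalg_hom K C UC"
proof (rule coalg_homI, unfold tensor_coalg_simps)
  let ?p = "pairing K C A B f g"
  note fl = coalg_hom_lin[OF f] and gl = coalg_hom_lin[OF g]
  note pl = pairing_linear[OF fl gl]
  have D: "comult UC \<in> linear_hom K U UU"
    using c(4) unfolding comultiplication_def tensor_coalg_simps by simp
  note I = lin_intros m c linear_hom_comp[OF fl] linear_hom_closed[OF fl]
    linear_hom_comp[OF gl] linear_hom_closed[OF gl] pl linear_hom_comp[OF pl] linear_hom_closed[OF pl]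
    linear_hom_comp[OF D] linear_hom_closed[OF D] D A B C
  show "?p \<in> linear_hom K C U" by (rule pl)
  fix x assume x: "x \<in> carrier C"
  have pt: "?p x \<in> carrier U" by (rule I x)+
  show "counit UC (?p x) = counit C x"
    using coalg_hom_counit[OF tensor_fst_coalg_hom[OF A B], of "?p x"] pt
    by (simp add: tensor_coalg_simps pairing_fst_snd[OF f g x] coalg_hom_counit[OF f x])
  have "comult UC (?p x) = sw C UU x (\<lambda>x y. comult UC (u (f x) (g y)))"
    unfolding pairing_def by (rule sw_push) (rule I x | assumption)+
  also have "\<dots> = sw C UU x (\<lambda>x y. sw C UU x (\<lambda>c1 c2. sw C UU y (\<lambda>c3 c4.
      tU (u (f c1) (g c3)) (u (f c2) (g c4)))))"
  proof (rule sw_cong)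
    fix x y assume xy: "x \<in> carrier C" "y \<in> carrier C"
    have "comult UC (u (f x) (g y)) = sw UC UU (u (f x) (g y)) (\<lambda>x y. tU x y)" (is "?l = _")
      by (rule sym, rule sw_tens[OF c(4), unfolded tensor_coalg_simps]) (rule I xy)+
    also have "\<dots> = sw A UU (f x) (\<lambda>a1 a2. sw B UU (g y) (\<lambda>b1 b2. tU (u a1 b1) (u a2 b2)))"
      by (rule sw_tensor) (rule I xy | assumption)+
    also have "\<dots> = sw C UU x (\<lambda>c1 c2. sw B UU (g y) (\<lambda>b1 b2. tU (u (f c1) b1) (u (f c2) b2)))"
      by (rule sw_coalg_hom[OF c(1,2) _ f]) (rule I xy | assumption)+
    also have "\<dots> = sw C UU x (\<lambda>c1 c2. sw C UU y (\<lambda>c3 c4. tU (u (f c1) (g c3)) (u (f c2) (g c4))))" (is "_ = ?r")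
      by (rule sw_cong) (rule I xy sw_coalg_hom[OF c(1,3) _ g] | assumption)+
    finally show "?l = ?r" .
  qed (rule I x | assumption)+
  also have "\<dots> = sw C UU x (\<lambda>c1 y. sw C UU y (\<lambda>w c4. sw C UU w (\<lambda>c2 c3.
      tU (u (f c1) (g c3)) (u (f c2) (g c4)))))"
    by (rule sw_middle) (rule I x | assumption)+
  \<comment> \<open>The two middle legs are exchanged: \<open>f\<close> and \<open>g\<close> commute on \<open>w\<close>.\<close>
  also have "\<dots> = sw C UU x (\<lambda>c1 y. sw C UU y (\<lambda>w c4. sw C UU w (\<lambda>c2 c3.
      tU (u (f c1) (g c2)) (u (f c3) (g c4)))))"
  proof -
    have "sw C UU w (\<lambda>c2 c3. tU (u (f c1) (g c3)) (u (f c2) (g c4))) =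
        sw C UU w (\<lambda>c2 c3. tU (u (f c1) (g c2)) (u (f c3) (g c4)))"
      if that: "c1 \<in> carrier C" "w \<in> carrier C" "c4 \<in> carrier C" for c1 w c4
      by (rule commuting_sw[OF fl gl fg, where M="\<lambda>p q. tU (u (f c1) q) (u p (g c4))"])
         (rule I that | assumption)+
    note * = this
    show ?thesis by (rule sw_cong) (rule * sw_cong I x | assumption)+
  qed
  also have "\<dots> = sw C UU x (\<lambda>x y. sw C UU x (\<lambda>c1 c2. sw C UU y (\<lambda>c3 c4.
      tU (u (f c1) (g c2)) (u (f c3) (g c4)))))"
    by (rule sym, rule sw_middle) (rule I x | assumption)+
  also have "\<dots> = sw C UU x (\<lambda>x y. tU (?p x) (?p y))"
  proof (rule sw_cong)
    fix x y assume xy: "x \<in> carrier C" "y \<in> carrier C"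
    have "sw C UU x (\<lambda>c1 c2. sw C UU y (\<lambda>c3 c4. tU (u (f c1) (g c2)) (u (f c3) (g c4))))
      = sw C UU x (\<lambda>c1 c2. tU (u (f c1) (g c2)) (?p y))" (is "?l = _")
    proof (rule sw_cong)
      fix c1 c2 assume c12: "c1 \<in> carrier C" "c2 \<in> carrier C"
      show "sw C UU y (\<lambda>c3 c4. tU (u (f c1) (g c2)) (u (f c3) (g c4))) = tU (u (f c1) (g c2)) (?p y)"
        unfolding pairing_def
        by (rule sym, rule sw_push[where V=U and h="\<lambda>z. tU (u (f c1) (g c2)) z"])
           (rule I xy c12 | assumption)+
    qed (rule I xy | assumption)+
    also have "\<dots> = tU (?p x) (?p y)" (is "_ = ?r")
      unfolding pairing_def[of K C A B f g x]
      by (rule sym, rule sw_push[where V=U and h="\<lambda>z. tU z (?p y)"]) (rule I xy | assumption)+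
    finally show "?l = ?r" .
  qed (rule I x | assumption)+
  finally show "comult UC (?p x) = sw C UU x (\<lambda>x y. tU (?p x) (?p y))" .
qed

text \<open>
  The projections of \<open>A \<otimes> B\<close> commute and recover every element from its legs; composing with \<open>h\<close> transfers
  both properties.
\<close>

lemma coalg_hom_components:
  assumes h: "h \<in> coalg_hom K C UC"
  shows "(\<lambda>x. tensor_fst A B (h x)) \<in> coalg_hom K C A"
    and "(\<lambda>x. tensor_snd A B (h x)) \<in> coalg_hom K C B"
    and "commuting K C A B (\<lambda>x. tensor_fst A B (h x)) (\<lambda>x. tensor_snd A B (h x))"
    and "\<And>x. x \<in> carrier C \<Longrightarrow>
      h x = pairing K C A B (\<lambda>x. tensor_fst A B (h x)) (\<lambda>x. tensor_snd A B (h x)) x"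
proof -
  let ?p = "tensor_fst A B" and ?q = "tensor_snd A B"
  show "(\<lambda>x. ?p (h x)) \<in> coalg_hom K C A" "(\<lambda>x. ?q (h x)) \<in> coalg_hom K C B"
    by (rule coalg_hom_comp[OF c(1,4) _ h tensor_fst_coalg_hom[OF A B]]
        coalg_hom_comp[OF c(1,4) _ h tensor_snd_coalg_hom[OF A B]] m)+
  note p = tensor_fst_linear[OF A B] and q = tensor_snd_linear[OF A B]
  note I = lin_intros p(1) linear_hom_comp[OF p(1)] linear_hom_closed[OF p(1)]
    linear_hom_comp[OF q(1)] linear_hom_closed[OF q(1)] m c
  have 1: "h x = sw C U x (\<lambda>x y. u (?p (h x)) (?q (h y)))"
    and 2: "h x = sw C U x (\<lambda>x y. u (?p (h y)) (?q (h x)))" if x: "x \<in> carrier C" for x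
  proof -
    have hx: "h x \<in> carrier U" using coalg_hom_closed[OF h x] by (simp add: tensor_coalg_simps)
    have "h x = sw UC U (h x) (\<lambda>x y. u (?p x) (?q y))" (is "?l = _")
      using tensor_fst_snd(1)[OF A B hx] ..
    also have "\<dots> = sw C U x (\<lambda>x y. u (?p (h x)) (?q (h y)))" (is "_ = ?r")
      by (rule sw_coalg_hom[OF c(1,4) _ h x], unfold tensor_coalg_simps) (rule I | assumption)+
    finally show "?l = ?r" .
    have "h x = sw UC U (h x) (\<lambda>x y. u (?p y) (?q x))" (is "?l = _")
      using tensor_fst_snd(2)[OF A B hx] ..
    also have "\<dots> = sw C U x (\<lambda>x y. u (?p (h y)) (?q (h x)))" (is "_ = ?r")
      by (rule sw_coalg_hom[OF c(1,4) _ h x], unfold tensor_coalg_simps) (rule I | assumption)+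
    finally show "?l = ?r" .
  qed
  then show "commuting K C A B (\<lambda>x. ?p (h x)) (\<lambda>x. ?q (h x))"
    unfolding commuting_def by metis
  show "h x = pairing K C A B (\<lambda>x. ?p (h x)) (\<lambda>x. ?q (h x)) x" if "x \<in> carrier C" for x
    unfolding pairing_def by (rule 1[OF that])
qed

lemma pairing_cong:
  assumes f: "f \<in> linear_hom K C A" and g: "g \<in> linear_hom K C B" and x: "x \<in> carrier C"
    and "\<And>x. x \<in> carrier C \<Longrightarrow> f' x = f x" "\<And>x. x \<in> carrier C \<Longrightarrow> g' x = g x"
  shows "pairing K C A B f' g' x = pairing K C A B f g x"
proof -
  note I = lin_intros m c linear_hom_comp[OF f] linear_hom_closed[OF f]
    linear_hom_comp[OF g] linear_hom_closed[OF g]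
  show ?thesis
    unfolding pairing_def by (rule sw_cong) (rule I x | assumption | (simp add: assms; fail))+
qed

lemma coalg_hom_tensor_eqI:
  assumes h: "h \<in> coalg_hom K C UC" and h': "h' \<in> coalg_hom K C UC"
    and "\<And>x. x \<in> carrier C \<Longrightarrow> tensor_fst A B (h x) = tensor_fst A B (h' x)"
    and "\<And>x. x \<in> carrier C \<Longrightarrow> tensor_snd A B (h x) = tensor_snd A B (h' x)"
    and x: "x \<in> carrier C"
  shows "h x = h' x"
proof -
  note k = coalg_hom_components[OF h'] 
  show ?thesis
    unfolding coalg_hom_components(4)[OF h x] k(4)[OF x]
    by (rule pairing_cong[OF coalg_hom_lin[OF k(1)] coalg_hom_lin[OF k(2)] x assms(3,4)])
qed

end

lemma coalg_hom_cong_on: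
  assumes C: "k_coalgebra K C" and D: "k_coalgebra K D" and f: "f \<in> coalg_hom K C D"
    and eq: "\<And>c. c \<in> carrier C \<Longrightarrow> g c = f c"
  shows "g \<in> coalg_hom K C D"
proof (rule coalg_homI)
  note m = C D coalgebra_module[OF C] coalgebra_module[OF D] coalgebra_comultiplication[OF C]
    linear_hom_comp[OF coalg_hom_lin[OF f]] linear_hom_closed[OF coalg_hom_lin[OF f]]
  show "g \<in> linear_hom K C D"
    by (rule linear_hom_cong_on[OF coalg_hom_lin[OF f] m(3) eq])
  fix c assume c: "c \<in> carrier C"
  show "comult D (g c) = sw C (tensor_alg K D D) c (\<lambda>c1 c2. tens K D D (g c1) (g c2))"
    unfolding eq[OF c] coalg_hom_comult[OF f c]
    by (rule sym, rule sw_cong) (rule lin_intros m c | assumption | (simp add: eq; fail))+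
  show "counit D (g c) = counit C c"
    by (simp add: eq c coalg_hom_counit[OF f])
qed

lemma commuting_cong_on:
  assumes C: "k_coalgebra K C" and A: "k_coalgebra K A" and B: "k_coalgebra K B"
    and f: "f \<in> linear_hom K C A" and g: "g \<in> linear_hom K C B" and fg: "commuting K C A B f g"
    and eq: "\<And>c. c \<in> carrier C \<Longrightarrow> f' c = f c" "\<And>c. c \<in> carrier C \<Longrightarrow> g' c = g c"
  shows "commuting K C A B f' g'"
  unfolding commuting_def
proof (intro ballI)
  fix c assume c: "c \<in> carrier C"
  note m = coalgebra_module[OF A] coalgebra_module[OF B] coalgebra_module[OF C] coalgebra_comultiplication[OF C]
    linear_hom_comp[OF f] linear_hom_closed[OF f] linear_hom_comp[OF g] linear_hom_closed[OF g] c
  let ?T = "tensor_alg K A B"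
  have "sw C ?T c (\<lambda>c1 c2. tens K A B (f' c1) (g' c2)) = sw C ?T c (\<lambda>c1 c2. tens K A B (f c1) (g c2))" (is "?l = _")
    by (rule sw_cong) (rule lin_intros m | assumption | (simp add: eq; fail))+
  also have "\<dots> = sw C ?T c (\<lambda>c1 c2. tens K A B (f c2) (g c1))"
    using fg c unfolding commuting_def by blast
  also have "\<dots> = sw C ?T c (\<lambda>c1 c2. tens K A B (f' c2) (g' c1))" (is "_ = ?r")
    by (rule sym, rule sw_cong) (rule lin_intros m | assumption | (simp add: eq; fail))+
  finally show "?l = ?r" .
qed

text \<open>
  Agreement of the components suffices on pure tensors, since the components are linear.
\<close>

lemma coalg_hom_eq_on_tensors:
  assumes C: "k_coalgebra K C" and D: "k_coalgebra K D" and A: "k_coalgebra K A" and B: "k_coalgebra K B"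
    and h: "h \<in> coalg_hom K (tensor_coalg K C D) (tensor_coalg K A B)"
    and h': "h' \<in> coalg_hom K (tensor_coalg K C D) (tensor_coalg K A B)"
    and fst: "\<And>c d. \<lbrakk>c \<in> carrier C; d \<in> carrier D\<rbrakk>
      \<Longrightarrow> tensor_fst A B (h (tens K C D c d)) = tensor_fst A B (h' (tens K C D c d))"
    and snd: "\<And>c d. \<lbrakk>c \<in> carrier C; d \<in> carrier D\<rbrakk>
      \<Longrightarrow> tensor_snd A B (h (tens K C D c d)) = tensor_snd A B (h' (tens K C D c d))"
    and X: "X \<in> carrier (tensor_alg K C D)"
  shows "h X = h' X"
proof -
  note m = coalgebra_module[OF C] coalgebra_module[OF D]
  note l = coalg_hom_lin[OF h, unfolded tensor_coalg_simps] coalg_hom_lin[OF h', unfolded tensor_coalg_simps]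
  show ?thesis
  proof (rule coalg_hom_tensor_eqI[OF tensor_coalgebra[OF C D] A B h h'], unfold tensor_coalg_simps)
    fix Y assume Y: "Y \<in> carrier (tensor_alg K C D)"
    show "tensor_fst A B (h Y) = tensor_fst A B (h' Y)"
      by (rule linear_ext[OF m linear_hom_comp[OF tensor_fst_linear(1)[OF A B] l(1)]
            linear_hom_comp[OF tensor_fst_linear(1)[OF A B] l(2)] fst Y])
    show "tensor_snd A B (h Y) = tensor_snd A B (h' Y)"
      by (rule linear_ext[OF m linear_hom_comp[OF tensor_snd_linear(1)[OF A B] l(1)]
            linear_hom_comp[OF tensor_snd_linear(1)[OF A B] l(2)] snd Y])
  qed (rule X)
qed

end

section \<open>The multiplication of a bicrossed product\<close>

context over_ring
begin

lemma tensor_group_lift: "group_lift (tensor_group K A B) = tlift (tensor_alg K A B)"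
  unfolding tlift_def by (rule group_lift_cong_structure) (simp_all add: tensor_alg_def Let_def)

lemma tensor_alg_mult:
  "X \<otimes>\<^bsub>tensor_alg K A B\<^esub> Y = tlift (tensor_alg K A B) (\<lambda>a b. tlift (tensor_alg K A B) (\<lambda>c d.
      tens K A B (a \<otimes>\<^bsub>A\<^esub> c) (b \<otimes>\<^bsub>B\<^esub> d)) Y) X"
  unfolding tensor_group_lift[symmetric] by (simp add: tensor_alg_def Let_def)

lemma
  assumes B: "k_bialgebra K B"
  shows bialgebra_algebra: "k_algebra K B" and bialgebra_coalgebra: "k_coalgebra K B"
  using B by (simp_all add: k_bialgebra_def)

lemma sw_mult:
  assumes B: "k_bialgebra K B" and V: "module K V" and f: "bilin K B B V f"
    and a: "a \<in> carrier B" and b: "b \<in> carrier B"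
  shows "sw B V (a \<otimes>\<^bsub>B\<^esub> b) f
    = sw B V a (\<lambda>a1 a2. sw B V b (\<lambda>b1 b2. f (a1 \<otimes>\<^bsub>B\<^esub> b1) (a2 \<otimes>\<^bsub>B\<^esub> b2)))"
proof -
  let ?BB = "tensor_alg K B B"
  note aB = bialgebra_algebra[OF B] and cB = coalgebra_comultiplication[OF bialgebra_coalgebra[OF B]]
    and mB = coalgebra_module[OF bialgebra_coalgebra[OF B]]
  note f' = tlift_linear[OF mB mB V f]
  note I = lin_intros aB cB mB V a b linear_hom_comp[OF bilin_left[OF f]] linear_hom_comp[OF bilin_right[OF f]] f'
  have "comult B (a \<otimes>\<^bsub>B\<^esub> b) = comult B a \<otimes>\<^bsub>?BB\<^esub> comult B b"
    using k_bialgebra.comult_alg_hom[OF B] a b unfolding alg_hom_def ring_hom_def by blast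
  also have "\<dots> = sw B ?BB a (\<lambda>a1 a2. sw B ?BB b (\<lambda>b1 b2.
      tens K B B (a1 \<otimes>\<^bsub>B\<^esub> b1) (a2 \<otimes>\<^bsub>B\<^esub> b2)))"
    by (simp add: tensor_alg_mult sweedler2_def)
  finally have "sw B V (a \<otimes>\<^bsub>B\<^esub> b) f = tlift V f (sw B ?BB a (\<lambda>a1 a2. sw B ?BB b (\<lambda>b1 b2.
      tens K B B (a1 \<otimes>\<^bsub>B\<^esub> b1) (a2 \<otimes>\<^bsub>B\<^esub> b2))))"
    by (simp add: sweedler2_def)
  also have "\<dots> = sw B V a (\<lambda>a1 a2. sw B V b (\<lambda>b1 b2. tlift V f (tens K B B (a1 \<otimes>\<^bsub>B\<^esub> b1) (a2 \<otimes>\<^bsub>B\<^esub> b2))))"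
    by (rule sw_push2) (rule I | assumption)+
  also have "\<dots> = sw B V a (\<lambda>a1 a2. sw B V b (\<lambda>b1 b2. f (a1 \<otimes>\<^bsub>B\<^esub> b1) (a2 \<otimes>\<^bsub>B\<^esub> b2)))"
    by (rule sw_cong) (rule sw_cong I | assumption)+
  finally show ?thesis .
qed

lemma sw_one:
  assumes B: "k_bialgebra K B" and V: "module K V" and f: "bilin K B B V f"
  shows "sw B V \<one>\<^bsub>B\<^esub> f = f \<one>\<^bsub>B\<^esub> \<one>\<^bsub>B\<^esub>"
proof -
  interpret B: k_bialgebra K B by fact
  have "comult B \<one>\<^bsub>B\<^esub> = tens K B B \<one>\<^bsub>B\<^esub> \<one>\<^bsub>B\<^esub>"
    using B.comult_alg_hom unfolding alg_hom_def ring_hom_def by (simp add: tensor_alg_def Let_def)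
  then show ?thesis
    using tlift_linear(2)[OF _ _ V f] coalgebra_module[OF bialgebra_coalgebra[OF B]]
    by (simp add: sweedler2_def)
qed

lemma counit_mult:
  assumes B: "k_bialgebra K B" and "a \<in> carrier B" "b \<in> carrier B"
  shows "counit B (a \<otimes>\<^bsub>B\<^esub> b) = counit B a \<otimes>\<^bsub>K\<^esub> counit B b"
  using k_bialgebra.counit_alg_hom[OF B] assms(2,3) unfolding alg_hom_def ring_hom_def
  by (simp add: ground_def)

lemma counit_one: "k_bialgebra K B \<Longrightarrow> counit B \<one>\<^bsub>B\<^esub> = \<one>\<^bsub>K\<^esub>"
  using k_bialgebra.counit_alg_hom[of K B] unfolding alg_hom_def ring_hom_def
  by (simp add: ground_def)

end

sublocale matched_pair \<subseteq> over_ring K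
  by (unfold_locales)

context matched_pair
begin

abbreviation "T \<equiv> tensor_alg K A H"
abbreviation "TC \<equiv> tensor_coalg K A H"
abbreviation "HA \<equiv> tensor_coalg K H A"
abbreviation "t \<equiv> tens K A H"
abbreviation "fstT \<equiv> tensor_fst A H"
abbreviation "sndT \<equiv> tensor_snd A H"
abbreviation "B \<equiv> bicrossed"

abbreviation mult_A (infixl \<open>\<cdot>\<close> 70) where "a \<cdot> b \<equiv> a \<otimes>\<^bsub>A\<^esub> b"
abbreviation mult_H (infixl \<open>\<star>\<close> 70) where "h \<star> g \<equiv> h \<otimes>\<^bsub>H\<^esub> g"
abbreviation bmult (infixl \<open>\<bullet>\<close> 70) where "X \<bullet> Y \<equiv> X \<otimes>\<^bsub>B\<^esub> Y"

lemmas bialgs = A.k_bialgebra_axioms H.k_bialgebra_axioms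
lemmas algs = A.k_algebra_axioms H.k_algebra_axioms
lemmas coalgs = A.k_coalgebra_axioms H.k_coalgebra_axioms
lemmas TC_coalgebra = tensor_coalgebra[OF coalgs]
lemmas HA_coalgebra = tensor_coalgebra[OF coalgs(2,1)]
lemmas comults = coalgs[THEN coalgebra_comultiplication]
  TC_coalgebra[THEN coalgebra_comultiplication] HA_coalgebra[THEN coalgebra_comultiplication]
lemmas mods = coalgs[THEN coalgebra_module]

lemma lact_linear: "lact \<in> linear_hom K (tensor_alg K H A) A"
  and ract_linear: "ract \<in> linear_hom K (tensor_alg K H A) H"
  using coalg_hom_lin[OF lact_coalg_hom] coalg_hom_lin[OF ract_coalg_hom]
  by (simp_all add: tensor_coalg_simps)

lemmas fst_linear = tensor_fst_linear[OF coalgs]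
lemmas snd_linear = tensor_snd_linear[OF coalgs]

lemma ones_closed: "\<one>\<^bsub>A\<^esub> \<in> carrier A" "\<one>\<^bsub>H\<^esub> \<in> carrier H" by simp_all

lemmas intros0 = sw_tensor_closed lin_sw_tensor lin_sw_tensor_param lin_intros
  linear_hom_comp[OF lact_linear] linear_hom_closed[OF lact_linear]
  linear_hom_comp[OF ract_linear] linear_hom_closed[OF ract_linear]
  linear_hom_comp[OF fst_linear(1)] linear_hom_closed[OF fst_linear(1)]
  linear_hom_comp[OF snd_linear(1)] linear_hom_closed[OF snd_linear(1)]
  ones_closed algs coalgs TC_coalgebra HA_coalgebra comults mods

text \<open>
  The map \<open>h \<otimes> a \<mapsto> (h\<^sub>1 \<triangleright> a\<^sub>1) \<otimes> (h\<^sub>2 \<triangleleft> a\<^sub>2)\<close> that moves \<open>h\<close> past \<open>a\<close>. The multiplication of the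
  bicrossed product is this map followed by multiplication in \<open>A\<close> from the left and in \<open>H\<close> from the
  right.
\<close>

definition cross where "cross = pairing K HA A H lact ract"

lemma cross_linear: "cross \<in> linear_hom K (tensor_alg K H A) T"
  using pairing_linear[OF HA_coalgebra coalgs, of lact ract] lact_linear ract_linear
  unfolding cross_def tensor_coalg_simps by simp

lemma cross_tens:
  assumes "h \<in> carrier H" "a \<in> carrier A"
  shows "cross (tens K H A h a) = sw H T h (\<lambda>h1 h2. sw A T a (\<lambda>a1 a2. t (h1 \<triangleright> a1) (h2 \<triangleleft> a2)))"
  unfolding cross_def pairing_def
  by (rule sw_tensor) (rule assms intros0 lact_linear ract_linear | assumption)+

text \<open>
  This is the last axiom of a matched pair, with the two factors exchanged.
\<close>

lemma actions_commuting: "commuting K HA A H lact ract"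
proof -
  let ?HA = "tensor_alg K H A"
  have "commuting K HA H A ract lact"
    unfolding commuting_def tensor_coalg_simps
  proof (intro ballI)
    fix X assume X: "X \<in> carrier ?HA"
    show "sw HA ?HA X (\<lambda>x y. tens K H A (ract x) (lact y))
      = sw HA ?HA X (\<lambda>x y. tens K H A (ract y) (lact x))" (is "?f X = ?g X")
    proof (rule linear_ext[OF mods(2,1) _ _ _ X, of ?f ?HA ?g])
      show "?f \<in> linear_hom K ?HA ?HA" "?g \<in> linear_hom K ?HA ?HA"
        by (rule intros0 lact_linear ract_linear | assumption)+
      fix h a assume ha: "h \<in> carrier H" "a \<in> carrier A"
      have "?f (tens K H A h a)
        = sw H ?HA h (\<lambda>h1 h2. sw A ?HA a (\<lambda>a1 a2. tens K H A (h1 \<triangleleft> a1) (h2 \<triangleright> a2)))" (is "?l = _")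
        by (rule sw_tensor) (rule ha intros0 lact_linear ract_linear | assumption)+
      also have "\<dots> = sw H ?HA h (\<lambda>h1 h2. sw A ?HA a (\<lambda>a1 a2. tens K H A (h2 \<triangleleft> a2) (h1 \<triangleright> a1)))"
        by (rule compat[OF ha])
      also have "\<dots> = ?g (tens K H A h a)" (is "_ = ?r")
        by (rule sym, rule sw_tensor) (rule ha intros0 lact_linear ract_linear | assumption)+
      finally show "?l = ?r" .
    qed
  qed
  then show ?thesis
    using lact_linear ract_linear
    by (intro commuting_flip[OF HA_coalgebra coalgs(2,1)]) (simp_all add: tensor_coalg_simps)
qed

lemma cross_coalg_hom: "cross \<in> coalg_hom K HA TC"
  unfolding cross_def
  by (rule pairing_coalg_hom[OF HA_coalgebra coalgs lact_coalg_hom ract_coalg_hom actions_commuting])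

lemma cross_fst_snd:
  assumes "X \<in> carrier (tensor_alg K H A)"
  shows "fstT (cross X) = lact X" "sndT (cross X) = ract X"
  unfolding cross_def
  using pairing_fst_snd[OF HA_coalgebra coalgs lact_coalg_hom ract_coalg_hom, of X] assms
  by (simp_all add: tensor_coalg_simps)

text \<open>
  The two-sided action \<open>a \<cdot> Z \<cdot> g\<close> of \<open>A\<close> and \<open>H\<close> on \<open>A \<otimes> H\<close>.
\<close>

definition outer where "outer a g = tlift T (\<lambda>c h. t (a \<cdot> c) (h \<star> g))"

lemma outer_tens:
  "\<lbrakk>a \<in> carrier A; g \<in> carrier H; c \<in> carrier A; h \<in> carrier H\<rbrakk>
    \<Longrightarrow> outer a g (t c h) = t (a \<cdot> c) (h \<star> g)"
  unfolding outer_def by (rule tlift_linear(2)[OF mods]) (rule intros0 | assumption)+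

lemma lin_outer:
  "\<lbrakk>a \<in> carrier A; g \<in> carrier H; F \<in> linear_hom K X T\<rbrakk> \<Longrightarrow> (\<lambda>x. outer a g (F x)) \<in> linear_hom K X T"
  unfolding outer_def by (rule intros0 | assumption)+

lemma lin_outer_left:
  "\<lbrakk>F \<in> linear_hom K X A; g \<in> carrier H; Z \<in> carrier T\<rbrakk> \<Longrightarrow> (\<lambda>x. outer (F x) g Z) \<in> linear_hom K X T"
  by (rule linear_hom_comp[of "\<lambda>a. outer a g Z" A]; assumption?)
     (unfold outer_def, rule tlift_param[OF mods], (rule intros0 | assumption)+)

lemma lin_outer_right:
  "\<lbrakk>a \<in> carrier A; F \<in> linear_hom K X H; Z \<in> carrier T\<rbrakk> \<Longrightarrow> (\<lambda>x. outer a (F x) Z) \<in> linear_hom K X T"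
  by (rule linear_hom_comp[of "\<lambda>g. outer a g Z" H]; assumption?)
     (unfold outer_def, rule tlift_param[OF mods], (rule intros0 | assumption)+)

lemma outer_closed:
  "\<lbrakk>a \<in> carrier A; g \<in> carrier H; Z \<in> carrier T\<rbrakk> \<Longrightarrow> outer a g Z \<in> carrier T"
  unfolding outer_def by (rule intros0 | assumption)+

lemma bicrossed_sel:
  "carrier B = carrier T" "one B = t \<one>\<^bsub>A\<^esub> \<one>\<^bsub>H\<^esub>" "zero B = zero T" "add B = add T" "smult B = smult T"
  "comult B = comult TC" "counit B = counit TC"
  by (simp_all add: bicrossed_def Let_def tensor_coalg_sel) (simp_all add: tensor_alg_def Let_def)

lemma bicrossed_mult_def:
  "X \<bullet> Y = tlift T (\<lambda>a h. tlift T (\<lambda>c g. sw H T h (\<lambda>h1 h2. sw A T c (\<lambda>c1 c2.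
     t (a \<cdot> (h1 \<triangleright> c1)) ((h2 \<triangleleft> c2) \<star> g)))) Y) X"
proof -
  have "X \<bullet> Y = tlift TC (\<lambda>a h. tlift TC (\<lambda>c g. sw H TC h (\<lambda>h1 h2. sw A TC c (\<lambda>c1 c2.
     t (a \<cdot> (h1 \<triangleright> c1)) ((h2 \<triangleleft> c2) \<star> g)))) Y) X"
    by (simp add: bicrossed_def Let_def)
  then show ?thesis unfolding tensor_coalg_simps .
qed

lemma bmult_inner_bilin:
  "\<lbrakk>a \<in> carrier A; h \<in> carrier H\<rbrakk> \<Longrightarrow> bilin K A H T (\<lambda>c g. sw H T h (\<lambda>h1 h2. sw A T c (\<lambda>c1 c2.
     t (a \<cdot> (h1 \<triangleright> c1)) ((h2 \<triangleleft> c2) \<star> g))))"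
  by (rule intros0 | assumption)+

lemma bmult_outer_bilin:
  assumes "Y \<in> carrier T"
  shows "bilin K A H T (\<lambda>a h. tlift T (\<lambda>c g. sw H T h (\<lambda>h1 h2. sw A T c (\<lambda>c1 c2.
     t (a \<cdot> (h1 \<triangleright> c1)) ((h2 \<triangleleft> c2) \<star> g)))) Y)"
  by (rule bilinI; rule tlift_param[OF mods]) (rule intros0 assms | assumption)+

lemma bilin_bmult: "bilin K T T T (\<lambda>X Y. X \<bullet> Y)"
  unfolding bicrossed_mult_def
proof (rule bilinI)
  fix X assume X: "X \<in> carrier T"
  show "(\<lambda>Y. tlift T (\<lambda>a h. tlift T (\<lambda>c g. sw H T h (\<lambda>h1 h2. sw A T c (\<lambda>c1 c2.
     t (a \<cdot> (h1 \<triangleright> c1)) ((h2 \<triangleleft> c2) \<star> g)))) Y) X) \<in> linear_hom K T T"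
    by (rule tlift_param[OF mods _ _ X bmult_outer_bilin])
       (rule tensor_alg_module mods tlift_linear(1) bmult_inner_bilin | assumption)+
next
  fix Y assume Y: "Y \<in> carrier T"
  show "(\<lambda>X. tlift T (\<lambda>a h. tlift T (\<lambda>c g. sw H T h (\<lambda>h1 h2. sw A T c (\<lambda>c1 c2.
     t (a \<cdot> (h1 \<triangleright> c1)) ((h2 \<triangleleft> c2) \<star> g)))) Y) X) \<in> linear_hom K T T"
    using tlift_linear(1)[OF mods _ bmult_outer_bilin[OF Y]] by (simp add: tensor_alg_module mods)
qed

lemmas lin_bmult = linear_hom_comp[OF bilin_left[OF bilin_bmult]] linear_hom_comp[OF bilin_right[OF bilin_bmult]]
  bilin_closed[OF bilin_bmult]

lemmas intros1 = lin_bmult lin_outer lin_outer_left lin_outer_right outer_closed intros0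
  linear_hom_comp[OF cross_linear] linear_hom_closed[OF cross_linear]

lemma bmult_tens:
  assumes "a \<in> carrier A" "h \<in> carrier H" "c \<in> carrier A" "g \<in> carrier H"
  shows "t a h \<bullet> t c g = sw H T h (\<lambda>h1 h2. sw A T c (\<lambda>c1 c2.
     t (a \<cdot> (h1 \<triangleright> c1)) ((h2 \<triangleleft> c2) \<star> g)))" (is "_ = ?R")
    and "t a h \<bullet> t c g = outer a g (cross (tens K H A h c))"
proof -
  have T: "module K T" by (rule intros0)+
  have cg: "t c g \<in> carrier T" by (rule intros0 assms)+
  show 1: "t a h \<bullet> t c g = ?R"
    unfolding bicrossed_mult_def tlift_linear(2)[OF mods T bmult_outer_bilin[OF cg] assms(1,2)]
    by (rule tlift_linear(2)[OF mods T bmult_inner_bilin[OF assms(1,2)] assms(3,4)])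
  have "outer a g (cross (tens K H A h c))
    = sw H T h (\<lambda>h1 h2. sw A T c (\<lambda>c1 c2. outer a g (t (h1 \<triangleright> c1) (h2 \<triangleleft> c2))))"
    unfolding cross_tens[OF assms(2,3)]
    by (rule sw_push2[where h="\<lambda>x. outer a g x"]) (rule intros1 assms | assumption)+
  also have "\<dots> = ?R"
    by (rule sw_cong) (rule outer_tens sw_cong intros1 assms | assumption)+
  finally show "t a h \<bullet> t c g = outer a g (cross (tens K H A h c))" using 1 by simp
qed

subsection \<open>Multiplication and the coalgebra structure\<close>

text \<open>
  The comultiplications of \<open>A\<close> and \<open>H\<close> are multiplicative; what remains is to bring the four sums over
  \<open>a\<close>, \<open>c\<close>, \<open>h\<close>, \<open>g\<close> into the same order.
\<close>

lemma sw_outer: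
  assumes V: "module K V" and f: "bilin K T T V f" and a: "a \<in> carrier A" and g: "g \<in> carrier H"
    and Z: "Z \<in> carrier T"
  shows "sw TC V (outer a g Z) f
    = sw A V a (\<lambda>a1 a2. sw H V g (\<lambda>g1 g2. sw TC V Z (\<lambda>z1 z2.
        f (outer a1 g1 z1) (outer a2 g2 z2))))" (is "?L Z = ?R Z")
proof (rule linear_ext[OF mods _ _ _ Z, where f="?L" and g="?R"])
  note I = intros1 V a g linear_hom_comp[OF bilin_left[OF f]] linear_hom_comp[OF bilin_right[OF f]]
    bilin_closed[OF f]
  show "?L \<in> linear_hom K T V" "?R \<in> linear_hom K T V"
    by (rule I f | assumption)+
  fix c h assume ch: "c \<in> carrier A" "h \<in> carrier H"
  let ?F = "\<lambda>a1 a2 c1 c2 h1 h2 g1 g2. f (t (a1 \<cdot> c1) (h1 \<star> g1)) (t (a2 \<cdot> c2) (h2 \<star> g2))"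
  have "?L (t c h) = sw TC V (t (a \<cdot> c) (h \<star> g)) f"
    by (simp add: outer_tens a g ch)
  also have "\<dots> = sw A V (a \<cdot> c) (\<lambda>a1 a2. sw H V (h \<star> g) (\<lambda>g1 g2. f (t a1 g1) (t a2 g2)))"
    by (rule sw_tensor[OF _ _ _ f]) (rule I ch | assumption)+
  also have "\<dots> = sw A V a (\<lambda>a1 a2. sw A V c (\<lambda>c1 c2. sw H V (h \<star> g) (\<lambda>g1 g2. f (t (a1 \<cdot> c1) g1) (t (a2 \<cdot> c2) g2))))"
    by (rule sw_mult) (rule I ch bialgs | assumption)+
  also have "\<dots> = sw A V a (\<lambda>a1 a2. sw A V c (\<lambda>c1 c2. sw H V h (\<lambda>h1 h2. sw H V g (\<lambda>g1 g2. ?F a1 a2 c1 c2 h1 h2 g1 g2))))"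
    by (rule sw_cong) (rule sw_mult sw_cong I ch bialgs | assumption)+
  also have "\<dots> = sw A V a (\<lambda>a1 a2. sw A V c (\<lambda>c1 c2. sw H V g (\<lambda>g1 g2. sw H V h (\<lambda>h1 h2. ?F a1 a2 c1 c2 h1 h2 g1 g2))))"
    by (rule sw_cong) (rule sw_swap sw_cong I ch | assumption)+
  also have "\<dots> = sw A V a (\<lambda>a1 a2. sw H V g (\<lambda>g1 g2. sw A V c (\<lambda>c1 c2. sw H V h (\<lambda>h1 h2. ?F a1 a2 c1 c2 h1 h2 g1 g2))))"
    by (rule sw_cong) (rule sw_swap I ch | assumption)+
  also have "\<dots> = sw A V a (\<lambda>a1 a2. sw H V g (\<lambda>g1 g2. sw A V c (\<lambda>c1 c2. sw H V h (\<lambda>h1 h2.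
      f (outer a1 g1 (t c1 h1)) (outer a2 g2 (t c2 h2))))))"
    by (rule sw_cong) (rule sw_cong I ch | assumption | (simp add: outer_tens; fail))+
  also have "\<dots> = ?R (t c h)"
    by (rule sw_cong) (rule sw_tensor[symmetric] sw_cong I ch | assumption)+
  finally show "?L (t c h) = ?R (t c h)" .
qed

text \<open>
  \<open>\<Delta>\<close> is multiplicative on the bicrossed product because the multiplication is composed of maps that
  respect \<open>\<Delta>\<close>: the map \<open>cross\<close>, as a pairing of commuting coalgebra maps, and the two-sided action.
\<close>

lemma sw_bmult:
  assumes V: "module K V" and f: "bilin K T T V f" and X: "X \<in> carrier T" and Y: "Y \<in> carrier T"
  shows "sw TC V (X \<bullet> Y) f
    = sw TC V X (\<lambda>x1 x2. sw TC V Y (\<lambda>y1 y2. f (x1 \<bullet> y1) (x2 \<bullet> y2)))"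
    (is "?L X Y = ?R X Y")
proof -
  note I = intros1 V linear_hom_comp[OF bilin_left[OF f]] linear_hom_comp[OF bilin_right[OF f]]
    bilin_closed[OF f]
  have pure: "?L (t a h) (t c g) = ?R (t a h) (t c g)"
    if e: "a \<in> carrier A" "h \<in> carrier H" "c \<in> carrier A" "g \<in> carrier H" for a h c g
  proof -
    let ?F = "\<lambda>a1 h1 c1 g1 a2 h2 c2 g2. f (t a1 h1 \<bullet> t c1 g1) (t a2 h2 \<bullet> t c2 g2)"
    have "?L (t a h) (t c g) = sw A V a (\<lambda>a1 a2. sw H V g (\<lambda>g1 g2.
        sw TC V (cross (tens K H A h c)) (\<lambda>z1 z2. f (outer a1 g1 z1) (outer a2 g2 z2))))"
      unfolding bmult_tens(2)[OF e] by (rule sw_outer[OF V f]) (rule I e)+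
    also have "\<dots> = sw A V a (\<lambda>a1 a2. sw H V g (\<lambda>g1 g2. sw HA V (tens K H A h c) (\<lambda>z1 z2.
        f (outer a1 g1 (cross z1)) (outer a2 g2 (cross z2)))))"
      by (rule sw_cong) (rule sw_coalg_hom[OF _ _ _ cross_coalg_hom, unfolded tensor_coalg_simps] sw_cong I e | assumption)+
    also have "\<dots> = sw A V a (\<lambda>a1 a2. sw H V g (\<lambda>g1 g2. sw H V h (\<lambda>h1 h2. sw A V c (\<lambda>c1 c2.
        f (outer a1 g1 (cross (tens K H A h1 c1))) (outer a2 g2 (cross (tens K H A h2 c2)))))))"
      by (rule sw_cong) (rule sw_tensor sw_cong I e cross_linear | assumption)+
    also have "\<dots> = sw A V a (\<lambda>a1 a2. sw H V g (\<lambda>g1 g2. sw H V h (\<lambda>h1 h2. sw A V c (\<lambda>c1 c2. ?F a1 h1 c1 g1 a2 h2 c2 g2))))"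
      by (rule sw_cong) (rule sw_cong I e | assumption | (simp add: bmult_tens(2); fail))+
    also have "\<dots> = sw A V a (\<lambda>a1 a2. sw H V h (\<lambda>h1 h2. sw H V g (\<lambda>g1 g2. sw A V c (\<lambda>c1 c2. ?F a1 h1 c1 g1 a2 h2 c2 g2))))"
      by (rule sw_cong) (rule sw_swap I e | assumption)+
    also have "\<dots> = sw A V a (\<lambda>a1 a2. sw H V h (\<lambda>h1 h2. sw A V c (\<lambda>c1 c2. sw H V g (\<lambda>g1 g2. ?F a1 h1 c1 g1 a2 h2 c2 g2))))"
      by (rule sw_cong) (rule sw_swap sw_cong I e | assumption)+
    also have "\<dots> = sw A V a (\<lambda>a1 a2. sw H V h (\<lambda>h1 h2. sw TC V (t c g) (\<lambda>y1 y2.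
        f (t a1 h1 \<bullet> y1) (t a2 h2 \<bullet> y2))))"
      by (rule sw_cong) (rule sw_tensor[symmetric] sw_cong I e | assumption)+
    also have "\<dots> = ?R (t a h) (t c g)"
      by (rule sym, rule sw_tensor) (rule I e | assumption)+
    finally show ?thesis .
  qed
  have "?L (t a h) Y = ?R (t a h) Y" if ah: "a \<in> carrier A" "h \<in> carrier H" for a h
  proof (rule linear_ext[OF mods _ _ _ Y, where f="?L (t a h)" and g="?R (t a h)"])
    show "?L (t a h) \<in> linear_hom K T V" "?R (t a h) \<in> linear_hom K T V"
      by (rule I f ah | assumption)+
  qed (rule pure[OF ah])
  note 1 = this
  show ?thesis
  proof (rule linear_ext[OF mods _ _ _ X, where f="\<lambda>X. ?L X Y" and g="\<lambda>X. ?R X Y"])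
    show "(\<lambda>X. ?L X Y) \<in> linear_hom K T V" "(\<lambda>X. ?R X Y) \<in> linear_hom K T V"
      by (rule I f Y | assumption)+
  qed (rule 1)
qed

lemma mult_smult:
  assumes "k_algebra K D" "k \<in> carrier K" "a \<in> carrier D" "b \<in> carrier D"
  shows "(k \<odot>\<^bsub>D\<^esub> a) \<otimes>\<^bsub>D\<^esub> b = k \<odot>\<^bsub>D\<^esub> (a \<otimes>\<^bsub>D\<^esub> b)"
    "a \<otimes>\<^bsub>D\<^esub> (k \<odot>\<^bsub>D\<^esub> b) = k \<odot>\<^bsub>D\<^esub> (a \<otimes>\<^bsub>D\<^esub> b)"
  using assms by (simp_all add: k_algebra.smult_mult_left k_algebra.smult_mult_right)

lemma counits: "a \<in> carrier A \<Longrightarrow> counit A a \<in> carrier K" "h \<in> carrier H \<Longrightarrow> counit H h \<in> carrier K"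
  by (rule counit_closed[OF coalgs(1)] counit_closed[OF coalgs(2)]; assumption)+

lemma counit_TC: "counit TC \<in> linear_hom K T (ground K)"
  "\<And>a h. \<lbrakk>a \<in> carrier A; h \<in> carrier H\<rbrakk> \<Longrightarrow> counit TC (t a h) = counit A a \<otimes>\<^bsub>K\<^esub> counit H h"
  using tensor_counit[OF coalgs] by auto

lemmas intros = intros1 counits linear_hom_comp[OF counit_TC(1)]
  linear_hom_closed[OF counit_TC(1), unfolded carrier_ground]

lemma T_module: "module K T" by (rule intros)+

lemma t_closed: "\<lbrakk>a \<in> carrier A; h \<in> carrier H\<rbrakk> \<Longrightarrow> t a h \<in> carrier T"
  by (rule intros | assumption)+

lemma actions_closed: "\<lbrakk>h \<in> carrier H; a \<in> carrier A\<rbrakk> \<Longrightarrow> h \<triangleright> a \<in> carrier A"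
  "\<lbrakk>h \<in> carrier H; a \<in> carrier A\<rbrakk> \<Longrightarrow> h \<triangleleft> a \<in> carrier H"
  by (rule intros | assumption)+

lemma actions_smult:
  assumes "h \<in> carrier H" "a \<in> carrier A" "k \<in> carrier K"
  shows "(k \<odot>\<^bsub>H\<^esub> h) \<triangleright> a = k \<odot>\<^bsub>A\<^esub> (h \<triangleright> a)" "h \<triangleright> (k \<odot>\<^bsub>A\<^esub> a) = k \<odot>\<^bsub>A\<^esub> (h \<triangleright> a)"
    "(k \<odot>\<^bsub>H\<^esub> h) \<triangleleft> a = k \<odot>\<^bsub>H\<^esub> (h \<triangleleft> a)" "h \<triangleleft> (k \<odot>\<^bsub>A\<^esub> a) = k \<odot>\<^bsub>H\<^esub> (h \<triangleleft> a)"
  using assms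
  by (simp_all add: tens_smult_left tens_smult_right mods tens_closed
      linear_hom_smult[OF lact_linear] linear_hom_smult[OF ract_linear])

lemma fst_snd_outer:
  assumes a: "a \<in> carrier A" and g: "g \<in> carrier H" and Z: "Z \<in> carrier T"
  shows "fstT (outer a g Z) = counit H g \<odot>\<^bsub>A\<^esub> (a \<cdot> fstT Z)" (is ?F)
    and "sndT (outer a g Z) = counit A a \<odot>\<^bsub>H\<^esub> (sndT Z \<star> g)" (is ?S)
    and "counit TC (outer a g Z) = counit A a \<otimes>\<^bsub>K\<^esub> counit TC Z \<otimes>\<^bsub>K\<^esub> counit H g" (is ?E)
proof -
  note S = outer_tens fst_linear(2) snd_linear(2) counit_mult bialgs algs a g mult_closed
    mult_smult counits module.smult_assoc1[OF mods(1), symmetric] module.smult_assoc1[OF mods(2), symmetric] scalar_ac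
  show ?F
  proof (rule linear_ext[OF mods _ _ _ Z])
    show "(\<lambda>Z. fstT (outer a g Z)) \<in> linear_hom K T A"
      "(\<lambda>Z. counit H g \<odot>\<^bsub>A\<^esub> (a \<cdot> fstT Z)) \<in> linear_hom K T A"
      by (rule intros a g | assumption)+
  qed (simp add: S)
  show ?S
  proof (rule linear_ext[OF mods _ _ _ Z])
    show "(\<lambda>Z. sndT (outer a g Z)) \<in> linear_hom K T H"
      "(\<lambda>Z. counit A a \<odot>\<^bsub>H\<^esub> (sndT Z \<star> g)) \<in> linear_hom K T H"
      by (rule intros a g | assumption)+
  qed (simp add: S)
  show ?E
  proof (rule linear_ext[OF mods _ _ _ Z])
    show "(\<lambda>Z. counit TC (outer a g Z)) \<in> linear_hom K T (ground K)"
      "(\<lambda>Z. counit A a \<otimes>\<^bsub>K\<^esub> counit TC Z \<otimes>\<^bsub>K\<^esub> counit H g) \<in> linear_hom K T (ground K)"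
      by (rule lin_ground_left lin_ground_right intros a g | assumption)+
  qed (simp add: S counit_TC(2) linear_hom_closed[OF counit_TC(1), unfolded carrier_ground])
qed

lemma bmult_ext:
  assumes "module K V"
    and "\<And>Y. Y \<in> carrier T \<Longrightarrow> (\<lambda>X. f X Y) \<in> linear_hom K T V"
    and "\<And>X. X \<in> carrier T \<Longrightarrow> (\<lambda>Y. f X Y) \<in> linear_hom K T V"
    and "\<And>Y. Y \<in> carrier T \<Longrightarrow> (\<lambda>X. g X Y) \<in> linear_hom K T V"
    and "\<And>X. X \<in> carrier T \<Longrightarrow> (\<lambda>Y. g X Y) \<in> linear_hom K T V"
    and eq: "\<And>a h c k. \<lbrakk>a \<in> carrier A; h \<in> carrier H; c \<in> carrier A; k \<in> carrier H\<rbrakk>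
      \<Longrightarrow> f (t a h) (t c k) = g (t a h) (t c k)"
    and X: "X \<in> carrier T" and Y: "Y \<in> carrier T"
  shows "f X Y = g X Y"
proof -
  have "f (t a h) Y = g (t a h) Y" if "a \<in> carrier A" "h \<in> carrier H" for a h
    by (rule linear_ext[OF mods assms(3,5) eq Y]) (rule t_closed that | assumption)+
  then show ?thesis
    by (intro linear_ext[OF mods assms(2)[OF Y] assms(4)[OF Y] _ X]) auto
qed

lemma counit_bmult:
  assumes "X \<in> carrier T" "Y \<in> carrier T"
  shows "counit TC (X \<bullet> Y) = counit TC X \<otimes>\<^bsub>K\<^esub> counit TC Y"
proof (rule bmult_ext[where V="ground K", OF _ _ _ _ _ _ assms])
  fix a h c g assume e: "a \<in> carrier A" "h \<in> carrier H" "c \<in> carrier A" "g \<in> carrier H"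
  have hc: "tens K H A h c \<in> carrier (tensor_alg K H A)" by (rule intros e)+
  have "counit TC (cross (tens K H A h c)) = counit H h \<otimes>\<^bsub>K\<^esub> counit A c"
    using coalg_hom_counit[OF cross_coalg_hom, unfolded tensor_coalg_simps, OF hc] tensor_counit(2)[OF coalgs(2,1) e(2,3)]
    by simp
  then show "counit TC (t a h \<bullet> t c g) = counit TC (t a h) \<otimes>\<^bsub>K\<^esub> counit TC (t c g)"
    using e linear_hom_closed[OF cross_linear hc]
    by (simp add: bmult_tens(2) fst_snd_outer counit_TC(2) counits scalar_ac linear_hom_closed[OF counit_TC(1), unfolded carrier_ground])
qed (rule lin_ground_left lin_ground_right intros | assumption)+

lemma counit_ones: "counit A \<one>\<^bsub>A\<^esub> = \<one>\<^bsub>K\<^esub>" "counit H \<one>\<^bsub>H\<^esub> = \<one>\<^bsub>K\<^esub>"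
  by (simp_all add: counit_one bialgs)

lemmas bmult_eval = actions_smult actions_closed counits mult_smult algs smult_closed' mods mult_closed
  smult_left_commute fst_linear snd_linear counit_ones
  module.smult_one[OF mods(1)] module.smult_one[OF mods(2)]

lemma fst_snd_bmult_tens:
  assumes e: "a \<in> carrier A" "h \<in> carrier H" "c \<in> carrier A" "g \<in> carrier H"
  shows "fstT (t a h \<bullet> t c g) = counit H g \<odot>\<^bsub>A\<^esub> (a \<cdot> (h \<triangleright> c))"
    and "sndT (t a h \<bullet> t c g) = counit A a \<odot>\<^bsub>H\<^esub> ((h \<triangleleft> c) \<star> g)"
proof -
  have hc: "tens K H A h c \<in> carrier (tensor_alg K H A)" by (rule intros e)+
  show "fstT (t a h \<bullet> t c g) = counit H g \<odot>\<^bsub>A\<^esub> (a \<cdot> (h \<triangleright> c))"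
    "sndT (t a h \<bullet> t c g) = counit A a \<odot>\<^bsub>H\<^esub> ((h \<triangleleft> c) \<star> g)"
    using e linear_hom_closed[OF cross_linear hc]
    by (simp_all add: bmult_tens(2) fst_snd_outer cross_fst_snd hc)
qed

lemma fst_bmult:
  assumes "X \<in> carrier T" "Y \<in> carrier T"
  shows "fstT (X \<bullet> Y) = sw TC A X (\<lambda>x1 x2. fstT x1 \<cdot> (sndT x2 \<triangleright> fstT Y))"
proof (rule bmult_ext[where V=A, OF _ _ _ _ _ _ assms])
  fix a h c g assume e: "a \<in> carrier A" "h \<in> carrier H" "c \<in> carrier A" "g \<in> carrier H"
  let ?c = "counit H g \<odot>\<^bsub>A\<^esub> c"
  have "sw TC A (t a h) (\<lambda>x1 x2. fstT x1 \<cdot> (sndT x2 \<triangleright> fstT (t c g)))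
    = sw A A a (\<lambda>a1 a2. sw H A h (\<lambda>h1 h2. fstT (t a1 h1) \<cdot> (sndT (t a2 h2) \<triangleright> fstT (t c g))))" (is "?l = _")
    by (rule sw_tensor) (rule intros e | assumption)+
  also have "\<dots> = sw A A a (\<lambda>a1 a2. sw H A h (\<lambda>h1 h2. counit H h1 \<odot>\<^bsub>A\<^esub> (counit A a2 \<odot>\<^bsub>A\<^esub> (a1 \<cdot> (h2 \<triangleright> ?c)))))"
    by (rule sw_cong) (rule sw_cong intros e | assumption | (simp add: bmult_eval e; fail))+
  also have "\<dots> = sw A A a (\<lambda>a1 a2. counit A a2 \<odot>\<^bsub>A\<^esub> (a1 \<cdot> (h \<triangleright> ?c)))"
    by (rule sw_cong) (rule sw_counit_left intros e | assumption)+
  also have "\<dots> = a \<cdot> (h \<triangleright> ?c)"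
    by (rule sw_counit_right) (rule intros e | assumption)+
  also have "\<dots> = fstT (t a h \<bullet> t c g)"
    by (simp add: fst_snd_bmult_tens bmult_eval e)
  finally show "fstT (t a h \<bullet> t c g) = ?l" ..
qed (rule intros | assumption)+

lemma snd_bmult:
  assumes "X \<in> carrier T" "Y \<in> carrier T"
  shows "sndT (X \<bullet> Y) = sw TC H Y (\<lambda>y1 y2. (sndT X \<triangleleft> fstT y1) \<star> sndT y2)"
proof (rule bmult_ext[where V=H, OF _ _ _ _ _ _ assms])
  fix a h c g assume e: "a \<in> carrier A" "h \<in> carrier H" "c \<in> carrier A" "g \<in> carrier H"
  let ?h = "counit A a \<odot>\<^bsub>H\<^esub> h"
  have "sw TC H (t c g) (\<lambda>y1 y2. (sndT (t a h) \<triangleleft> fstT y1) \<star> sndT y2)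
    = sw A H c (\<lambda>c1 c2. sw H H g (\<lambda>g1 g2. (sndT (t a h) \<triangleleft> fstT (t c1 g1)) \<star> sndT (t c2 g2)))" (is "?l = _")
    by (rule sw_tensor) (rule intros e | assumption)+
  also have "\<dots> = sw A H c (\<lambda>c1 c2. sw H H g (\<lambda>g1 g2. counit H g1 \<odot>\<^bsub>H\<^esub> (counit A c2 \<odot>\<^bsub>H\<^esub> ((?h \<triangleleft> c1) \<star> g2))))"
    by (rule sw_cong) (rule sw_cong intros e | assumption | (simp add: bmult_eval e; fail))+
  also have "\<dots> = sw A H c (\<lambda>c1 c2. counit A c2 \<odot>\<^bsub>H\<^esub> ((?h \<triangleleft> c1) \<star> g))"
    by (rule sw_cong) (rule sw_counit_left intros e | assumption)+
  also have "\<dots> = (?h \<triangleleft> c) \<star> g"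
    by (rule sw_counit_right) (rule intros e | assumption)+
  also have "\<dots> = sndT (t a h \<bullet> t c g)"
    by (simp add: fst_snd_bmult_tens bmult_eval e)
  finally show "sndT (t a h \<bullet> t c g) = ?l" ..
qed (rule intros | assumption)+

text \<open>
  The first component of a product depends on the right factor only through its first component.
  This allows the right factor to be taken from \<open>A\<close> in the proof of associativity.
\<close>

lemma fst_bmult_fst:
  assumes "X \<in> carrier T" "Y \<in> carrier T"
  shows "fstT (X \<bullet> Y) = fstT (X \<bullet> t (fstT Y) \<one>\<^bsub>H\<^esub>)"
  by (rule bmult_ext[where V=A, OF _ _ _ _ _ _ assms])
     (rule intros | assumption | (simp add: fst_snd_bmult_tens bmult_eval; fail))+

lemma snd_bmult_snd:
  assumes "X \<in> carrier T" "Y \<in> carrier T"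
  shows "sndT (X \<bullet> Y) = sndT (t \<one>\<^bsub>A\<^esub> (sndT X) \<bullet> Y)"
  by (rule bmult_ext[where V=H, OF _ _ _ _ _ _ assms])
     (rule intros | assumption | (simp add: fst_snd_bmult_tens bmult_eval; fail))+

subsection \<open>Unit and associativity\<close>

text \<open>
  One of the two actions is trivial by the unit axioms, and the counit absorbs a leg.
\<close>

lemma cross_one:
  "a \<in> carrier A \<Longrightarrow> cross (tens K H A \<one>\<^bsub>H\<^esub> a) = t a \<one>\<^bsub>H\<^esub>"
  "h \<in> carrier H \<Longrightarrow> cross (tens K H A h \<one>\<^bsub>A\<^esub>) = t \<one>\<^bsub>A\<^esub> h"
proof -
  assume a: "a \<in> carrier A"
  have "cross (tens K H A \<one>\<^bsub>H\<^esub> a) = sw A T a (\<lambda>a1 a2. t (\<one>\<^bsub>H\<^esub> \<triangleright> a1) (\<one>\<^bsub>H\<^esub> \<triangleleft> a2))" (is "?l = _")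
    unfolding cross_tens[OF ones_closed(2) a] by (rule sw_one[OF bialgs(2)]) (rule intros a | assumption)+
  also have "\<dots> = sw A T a (\<lambda>a1 a2. counit A a2 \<odot>\<^bsub>T\<^esub> t a1 \<one>\<^bsub>H\<^esub>)"
    by (rule sw_cong) (rule intros a | assumption |
      (simp add: lact_one ract_unit tens_smult_right mods counits; fail))+
  also have "\<dots> = t a \<one>\<^bsub>H\<^esub>" (is "_ = ?r")
    by (rule sw_counit_right) (rule intros a | assumption)+
  finally show "?l = ?r" .
next
  assume h: "h \<in> carrier H"
  have "cross (tens K H A h \<one>\<^bsub>A\<^esub>) = sw H T h (\<lambda>h1 h2. t (h1 \<triangleright> \<one>\<^bsub>A\<^esub>) (h2 \<triangleleft> \<one>\<^bsub>A\<^esub>))" (is "?l = _")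
    unfolding cross_tens[OF h ones_closed(1)]
    by (rule sw_cong) (rule sw_one[OF bialgs(1)] intros h | assumption)+
  also have "\<dots> = sw H T h (\<lambda>h1 h2. counit H h1 \<odot>\<^bsub>T\<^esub> t \<one>\<^bsub>A\<^esub> h2)"
    by (rule sw_cong) (rule intros h | assumption |
      (simp add: lact_unit ract_one tens_smult_left mods counits; fail))+
  also have "\<dots> = t \<one>\<^bsub>A\<^esub> h" (is "_ = ?r")
    by (rule sw_counit_left) (rule intros h | assumption)+
  finally show "?l = ?r" .
qed

lemma bmult_simps:
  "\<lbrakk>a \<in> carrier A; c \<in> carrier A; g \<in> carrier H\<rbrakk> \<Longrightarrow> t a \<one>\<^bsub>H\<^esub> \<bullet> t c g = t (a \<cdot> c) g"
  "\<lbrakk>a \<in> carrier A; h \<in> carrier H; g \<in> carrier H\<rbrakk> \<Longrightarrow> t a h \<bullet> t \<one>\<^bsub>A\<^esub> g = t a (h \<star> g)"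
  by (simp_all add: bmult_tens(2) cross_one outer_tens)

text \<open>
  The relation that links the subalgebras \<open>A\<close> and \<open>H\<close> of the bicrossed product.
\<close>

lemma bmult_cross:
  assumes "h \<in> carrier H" "c \<in> carrier A"
  shows "t \<one>\<^bsub>A\<^esub> h \<bullet> t c \<one>\<^bsub>H\<^esub> = cross (tens K H A h c)"
proof -
  have "outer \<one>\<^bsub>A\<^esub> \<one>\<^bsub>H\<^esub> Z = Z" if "Z \<in> carrier T" for Z
    by (rule linear_ext[OF mods _ linear_hom_id _ that]) (rule intros | simp add: outer_tens)+
  then show ?thesis
    using assms by (simp add: bmult_tens(2) linear_hom_closed[OF cross_linear] tens_closed mods)
qed

lemma bmult_one:
  assumes "X \<in> carrier T"
  shows "t \<one>\<^bsub>A\<^esub> \<one>\<^bsub>H\<^esub> \<bullet> X = X" "X \<bullet> t \<one>\<^bsub>A\<^esub> \<one>\<^bsub>H\<^esub> = X"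
  by (rule linear_ext[OF mods _ linear_hom_id _ assms], (rule intros)+, simp add: bmult_simps)+

text \<open>
  By \<open>fst_bmult_fst\<close> the third factor may be taken to be \<open>b \<otimes> 1\<close>. On pure tensors the first component is then
  the expression \<open>a (h \<triangleright> (c (g \<triangleright> b)))\<close>, and the axiom for the left action on a product, applied to
  \<open>c\<close> and \<open>g \<triangleright> b\<close>, is precisely the formula for the product of the first two factors.
\<close>

lemma fst_bmult_assoc:
  assumes X: "X \<in> carrier T" and Y: "Y \<in> carrier T" and Z: "Z \<in> carrier T"
  shows "fstT ((X \<bullet> Y) \<bullet> Z) = fstT (X \<bullet> (Y \<bullet> Z))"
proof -
  let ?e = "\<lambda>b. t b \<one>\<^bsub>H\<^esub>"
  have pure: "fstT ((X \<bullet> Y) \<bullet> ?e b) = fstT (X \<bullet> (Y \<bullet> ?e b))" if b: "b \<in> carrier A" for b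
  proof (rule bmult_ext[where V=A, OF _ _ _ _ _ _ X Y])
    fix a h c g assume e: "a \<in> carrier A" "h \<in> carrier H" "c \<in> carrier A" "g \<in> carrier H"
    have "fstT ((t a h \<bullet> t c g) \<bullet> ?e b)
      = sw H A h (\<lambda>h1 h2. sw A A c (\<lambda>c1 c2. fstT (t (a \<cdot> (h1 \<triangleright> c1)) ((h2 \<triangleleft> c2) \<star> g) \<bullet> ?e b)))"
      unfolding bmult_tens(1)[OF e]
      by (rule sw_push2[where h="\<lambda>x. fstT (x \<bullet> ?e b)"]) (rule intros e b | assumption)+
    also have "\<dots> = sw H A h (\<lambda>h1 h2. sw A A c (\<lambda>c1 c2. a \<cdot> ((h1 \<triangleright> c1) \<cdot> ((h2 \<triangleleft> c2) \<triangleright> (g \<triangleright> b)))))"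
      by (rule sw_cong) (rule sw_cong intros e b | assumption |
        (simp add: fst_snd_bmult_tens bmult_eval lact_mult A.m_assoc e b; fail))+
    also have "\<dots> = a \<cdot> sw H A h (\<lambda>h1 h2. sw A A c (\<lambda>c1 c2. (h1 \<triangleright> c1) \<cdot> ((h2 \<triangleleft> c2) \<triangleright> (g \<triangleright> b))))"
      by (rule sym, rule sw_push2[where h="\<lambda>x. a \<cdot> x"]) (rule intros e b | assumption)+
    also have "\<dots> = a \<cdot> (h \<triangleright> (c \<cdot> (g \<triangleright> b)))"
      using lact_prod[of h c "g \<triangleright> b"] e b by (simp add: actions_closed)
    also have "\<dots> = fstT (t a h \<bullet> (t c g \<bullet> ?e b))"
      using e b by (simp add: fst_bmult_fst[of "t a h" "t c g \<bullet> ?e b"] t_closed lin_bmult(3) fst_snd_bmult_tens bmult_eval)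
    finally show "fstT ((t a h \<bullet> t c g) \<bullet> ?e b) = fstT (t a h \<bullet> (t c g \<bullet> ?e b))" .
  qed (rule intros b | assumption)+
  have c: "X \<bullet> Y \<in> carrier T" "Y \<bullet> Z \<in> carrier T" "fstT Z \<in> carrier A" "Y \<bullet> ?e (fstT Z) \<in> carrier T"
    by (rule intros X Y Z)+
  show ?thesis
    unfolding fst_bmult_fst[OF c(1) Z] pure[OF c(3)] fst_bmult_fst[OF X c(4)] fst_bmult_fst[OF X c(2)]
      fst_bmult_fst[OF Y Z, symmetric] ..
qed

text \<open>
  The mirror image, with the first factor replaced by \<open>1 \<otimes> k\<close> and the axiom for the right action on a
  product.
\<close>

lemma snd_bmult_assoc:
  assumes X: "X \<in> carrier T" and Y: "Y \<in> carrier T" and Z: "Z \<in> carrier T"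
  shows "sndT ((X \<bullet> Y) \<bullet> Z) = sndT (X \<bullet> (Y \<bullet> Z))"
proof -
  let ?e = "\<lambda>k. t \<one>\<^bsub>A\<^esub> k"
  have pure: "sndT (?e k \<bullet> (Y \<bullet> Z)) = sndT ((?e k \<bullet> Y) \<bullet> Z)" if k: "k \<in> carrier H" for k
  proof (rule bmult_ext[where V=H, OF _ _ _ _ _ _ Y Z])
    fix a h c g assume e: "a \<in> carrier A" "h \<in> carrier H" "c \<in> carrier A" "g \<in> carrier H"
    have "sndT (?e k \<bullet> (t a h \<bullet> t c g))
      = sw H H h (\<lambda>h1 h2. sw A H c (\<lambda>c1 c2. sndT (?e k \<bullet> t (a \<cdot> (h1 \<triangleright> c1)) ((h2 \<triangleleft> c2) \<star> g))))"
      unfolding bmult_tens(1)[OF e]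
      by (rule sw_push2[where h="\<lambda>x. sndT (?e k \<bullet> x)"]) (rule intros e k | assumption)+
    also have "\<dots> = sw H H h (\<lambda>h1 h2. sw A H c (\<lambda>c1 c2. (((k \<triangleleft> a) \<triangleleft> (h1 \<triangleright> c1)) \<star> (h2 \<triangleleft> c2)) \<star> g))"
      by (rule sw_cong) (rule sw_cong intros e k | assumption |
        (simp add: fst_snd_bmult_tens bmult_eval ract_mult H.m_assoc e k; fail))+
    also have "\<dots> = sw H H h (\<lambda>h1 h2. sw A H c (\<lambda>c1 c2. ((k \<triangleleft> a) \<triangleleft> (h1 \<triangleright> c1)) \<star> (h2 \<triangleleft> c2))) \<star> g"
      by (rule sym, rule sw_push2[where h="\<lambda>x. x \<star> g"]) (rule intros e k | assumption)+
    also have "\<dots> = (((k \<triangleleft> a) \<star> h) \<triangleleft> c) \<star> g"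
      using ract_prod[of "k \<triangleleft> a" h c] e k by (simp add: actions_closed)
    also have "\<dots> = sndT ((?e k \<bullet> t a h) \<bullet> t c g)"
      using e k by (simp add: snd_bmult_snd[of "?e k \<bullet> t a h" "t c g"] t_closed lin_bmult(3) fst_snd_bmult_tens bmult_eval)
    finally show "sndT (?e k \<bullet> (t a h \<bullet> t c g)) = sndT ((?e k \<bullet> t a h) \<bullet> t c g)" .
  qed (rule intros k | assumption)+
  have c: "X \<bullet> Y \<in> carrier T" "Y \<bullet> Z \<in> carrier T" "sndT X \<in> carrier H" "?e (sndT X) \<bullet> Y \<in> carrier T"
    by (rule intros X Y Z)+
  show ?thesis
    unfolding snd_bmult_snd[OF X c(2)] pure[OF c(3)] snd_bmult_snd[OF c(4) Z] snd_bmult_snd[OF c(1) Z]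
      snd_bmult_snd[OF X Y, symmetric] ..
qed

text \<open>
  The two sides respect \<open>\<Delta>\<close> in all three arguments, hence are rebuilt from their components.
\<close>

lemma bmult_assoc:
  assumes X: "X \<in> carrier T" and Y: "Y \<in> carrier T" and Z: "Z \<in> carrier T"
  shows "(X \<bullet> Y) \<bullet> Z = X \<bullet> (Y \<bullet> Z)"
proof -
  note I = intros X Y Z
  have c: "(X \<bullet> Y) \<bullet> Z \<in> carrier T" "X \<bullet> (Y \<bullet> Z) \<in> carrier T" by (rule I)+
  let ?f = "\<lambda>s u. t (fstT s) (sndT u)"
  have "(X \<bullet> Y) \<bullet> Z = sw TC T ((X \<bullet> Y) \<bullet> Z) ?f"
    using tensor_fst_snd(1)[OF coalgs c(1)] ..
  also have "\<dots> = sw TC T (X \<bullet> Y) (\<lambda>p1 p2. sw TC T Z (\<lambda>z1 z2. ?f (p1 \<bullet> z1) (p2 \<bullet> z2)))"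
    by (rule sw_bmult) (rule I | assumption)+
  also have "\<dots> = sw TC T X (\<lambda>x1 x2. sw TC T Y (\<lambda>y1 y2. sw TC T Z (\<lambda>z1 z2.
      ?f ((x1 \<bullet> y1) \<bullet> z1) ((x2 \<bullet> y2) \<bullet> z2))))"
    by (rule sw_bmult) (rule I | assumption)+
  also have "\<dots> = sw TC T X (\<lambda>x1 x2. sw TC T Y (\<lambda>y1 y2. sw TC T Z (\<lambda>z1 z2.
      ?f (x1 \<bullet> (y1 \<bullet> z1)) (x2 \<bullet> (y2 \<bullet> z2)))))"
    by (rule sw_tensor_cong) (rule sw_tensor_cong I | assumption | (simp add: fst_bmult_assoc snd_bmult_assoc; fail))+
  also have "\<dots> = sw TC T X (\<lambda>x1 x2. sw TC T (Y \<bullet> Z) (\<lambda>q1 q2. ?f (x1 \<bullet> q1) (x2 \<bullet> q2)))"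
    by (rule sw_tensor_cong) (rule sw_bmult[symmetric] I | assumption)+
  also have "\<dots> = sw TC T (X \<bullet> (Y \<bullet> Z)) ?f"
    by (rule sw_bmult[symmetric]) (rule I | assumption)+
  also have "\<dots> = X \<bullet> (Y \<bullet> Z)"
    by (rule tensor_fst_snd(1)[OF coalgs c(2)])
  finally show ?thesis .
qed

subsection \<open>Products of coalgebra maps\<close>

definition prod_map where "prod_map f g = tlift T (\<lambda>c d. f c \<bullet> g d)"

context
  fixes C :: "('k, 'c, 'o) hopf_scheme" and D :: "('k, 'd, 'q) hopf_scheme"
  assumes C: "k_coalgebra K C" and D: "k_coalgebra K D"
begin

lemma prod_map_linear:
  assumes f: "f \<in> linear_hom K C T" and g: "g \<in> linear_hom K D T"
  shows "prod_map f g \<in> linear_hom K (tensor_alg K C D) T"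
    and "\<And>c d. \<lbrakk>c \<in> carrier C; d \<in> carrier D\<rbrakk> \<Longrightarrow> prod_map f g (tens K C D c d) = f c \<bullet> g d"
proof -
  note mC = coalgebra_module[OF C] and mD = coalgebra_module[OF D]
  have "bilin K C D T (\<lambda>c d. f c \<bullet> g d)"
    by (rule f g linear_hom_closed[OF f] linear_hom_closed[OF g] intros | assumption)+
  note l = tlift_linear[OF mC mD T_module this]
  show "prod_map f g \<in> linear_hom K (tensor_alg K C D) T"
    "\<And>c d. \<lbrakk>c \<in> carrier C; d \<in> carrier D\<rbrakk> \<Longrightarrow> prod_map f g (tens K C D c d) = f c \<bullet> g d"
    unfolding prod_map_def by (rule l; assumption)+
qed

text \<open>
  A product of coalgebra maps is the composite of \<open>f \<otimes> g\<close> with a multiplication that respects \<open>\<Delta>\<close>.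
\<close>

lemma prod_map_coalg_hom:
  assumes f: "f \<in> coalg_hom K C TC" and g: "g \<in> coalg_hom K D TC"
  shows "prod_map f g \<in> coalg_hom K (tensor_coalg K C D) TC"
proof -
  note fl = coalg_hom_lin[OF f, unfolded tensor_coalg_simps] and gl = coalg_hom_lin[OF g, unfolded tensor_coalg_simps]
  let ?h = "prod_map f g" and ?CD = "tensor_coalg K C D" and ?tC = "tens K C D"
  note h = prod_map_linear[OF fl gl]
  note mC = coalgebra_module[OF C] and mD = coalgebra_module[OF D]
    and cC = coalgebra_comultiplication[OF C] and cD = coalgebra_comultiplication[OF D]
  note cCD = coalgebra_comultiplication[OF tensor_coalgebra[OF C D]]
  let ?TT = "tensor_alg K T T" and ?tT = "tens K T T"
  have DT: "comult TC \<in> linear_hom K T ?TT"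
    using comults(3) unfolding comultiplication_def tensor_coalg_simps by simp
  note I = intros mC mD cC cD cCD C D linear_hom_comp[OF fl] linear_hom_closed[OF fl] linear_hom_comp[OF gl] linear_hom_closed[OF gl]
    linear_hom_comp[OF h(1)] linear_hom_closed[OF h(1)] linear_hom_comp[OF DT] linear_hom_closed[OF DT]
  show ?thesis
  proof (rule coalg_homI, unfold tensor_coalg_simps)
    show "?h \<in> linear_hom K (tensor_alg K C D) T" by (rule h(1))
    fix X assume X: "X \<in> carrier (tensor_alg K C D)"
    show "comult TC (?h X) = sw ?CD ?TT X (\<lambda>x y. ?tT (?h x) (?h y))"
    proof (rule linear_ext[OF mC mD _ _ _ X])
      show "(\<lambda>X. comult TC (?h X)) \<in> linear_hom K (tensor_alg K C D) ?TT"
        "(\<lambda>X. sw ?CD ?TT X (\<lambda>x y. ?tT (?h x) (?h y))) \<in> linear_hom K (tensor_alg K C D) ?TT"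
        by (rule I | assumption)+
      fix c d assume cd: "c \<in> carrier C" "d \<in> carrier D"
      have "comult TC (?h (?tC c d)) = sw TC ?TT (f c \<bullet> g d) (\<lambda>x y. ?tT x y)" (is "?l = _")
        unfolding h(2)[OF cd]
        by (rule sw_tens[OF comults(3), unfolded tensor_coalg_simps, symmetric]) (rule I cd)+
      also have "\<dots> = sw TC ?TT (f c) (\<lambda>x1 x2. sw TC ?TT (g d) (\<lambda>y1 y2. ?tT (x1 \<bullet> y1) (x2 \<bullet> y2)))"
        by (rule sw_bmult) (rule I cd | assumption)+
      also have "\<dots> = sw C ?TT c (\<lambda>c1 c2. sw TC ?TT (g d) (\<lambda>y1 y2. ?tT (f c1 \<bullet> y1) (f c2 \<bullet> y2)))"
        by (rule sw_coalg_hom[OF _ _ _ f], unfold tensor_coalg_simps) (rule I cd | assumption)+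
      also have "\<dots> = sw C ?TT c (\<lambda>c1 c2. sw D ?TT d (\<lambda>d1 d2. ?tT (f c1 \<bullet> g d1) (f c2 \<bullet> g d2)))"
        by (rule sw_cong) (rule sw_coalg_hom[OF _ _ _ g, unfolded tensor_coalg_simps] I cd | assumption)+
      also have "\<dots> = sw C ?TT c (\<lambda>c1 c2. sw D ?TT d (\<lambda>d1 d2. ?tT (?h (?tC c1 d1)) (?h (?tC c2 d2))))"
        by (rule sw_cong) (rule sw_cong I cd | assumption | (simp add: h(2); fail))+
      also have "\<dots> = sw ?CD ?TT (?tC c d) (\<lambda>x y. ?tT (?h x) (?h y))" (is "_ = ?r")
        by (rule sw_tensor[symmetric]) (rule I h(1) cd | assumption)+
      finally show "?l = ?r" .
    qed
    show "counit TC (?h X) = counit ?CD X"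
    proof (rule linear_ext[OF mC mD _ tensor_counit(1)[OF C D] _ X])
      show "(\<lambda>X. counit TC (?h X)) \<in> linear_hom K (tensor_alg K C D) (ground K)" by (rule I h(1))+
      show "counit TC (?h (?tC c d)) = counit ?CD (?tC c d)" if cd: "c \<in> carrier C" "d \<in> carrier D" for c d
        using cd by (simp add: h(2) counit_bmult linear_hom_closed[OF fl] linear_hom_closed[OF gl]
          coalg_hom_counit[OF f] coalg_hom_counit[OF g] tensor_counit(2)[OF C D])
    qed
  qed
qed

lemma fst_snd_prod:
  assumes f: "f \<in> coalg_hom K C TC" and g: "g \<in> coalg_hom K D TC" and c: "c \<in> carrier C" and d: "d \<in> carrier D"
  shows "fstT (f c \<bullet> g d) = sw C A c (\<lambda>c1 c2. fstT (f c1) \<cdot> (sndT (f c2) \<triangleright> fstT (g d)))"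
    and "sndT (f c \<bullet> g d) = sw D H d (\<lambda>d1 d2. (sndT (f c) \<triangleleft> fstT (g d1)) \<star> sndT (g d2))"
proof -
  note fl = coalg_hom_lin[OF f, unfolded tensor_coalg_simps] and gl = coalg_hom_lin[OF g, unfolded tensor_coalg_simps]
  note mC = coalgebra_module[OF C] and mD = coalgebra_module[OF D]
    and cC = coalgebra_comultiplication[OF C] and cD = coalgebra_comultiplication[OF D]
  note I = intros mC mD cC cD c d linear_hom_comp[OF fl] linear_hom_closed[OF fl] linear_hom_comp[OF gl] linear_hom_closed[OF gl]
  have e: "f c \<in> carrier T" "g d \<in> carrier T" by (rule I)+
  show "fstT (f c \<bullet> g d) = sw C A c (\<lambda>c1 c2. fstT (f c1) \<cdot> (sndT (f c2) \<triangleright> fstT (g d)))"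
    unfolding fst_bmult[OF e]
    by (rule sw_coalg_hom[OF _ _ _ f], unfold tensor_coalg_simps) (rule I | assumption)+
  show "sndT (f c \<bullet> g d) = sw D H d (\<lambda>d1 d2. (sndT (f c) \<triangleleft> fstT (g d1)) \<star> sndT (g d2))"
    unfolding snd_bmult[OF e]
    by (rule sw_coalg_hom[OF _ _ _ g], unfold tensor_coalg_simps) (rule I | assumption)+
qed

end

lemma inclusion_coalg_hom:
  "(\<lambda>a. t a \<one>\<^bsub>H\<^esub>) \<in> coalg_hom K A TC" "(\<lambda>h. t \<one>\<^bsub>A\<^esub> h) \<in> coalg_hom K H TC"
proof -
  let ?TT = "tensor_alg K T T" and ?tT = "tens K T T"
  show "(\<lambda>a. t a \<one>\<^bsub>H\<^esub>) \<in> coalg_hom K A TC"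
  proof (rule coalg_homI, unfold tensor_coalg_simps)
    show "(\<lambda>a. t a \<one>\<^bsub>H\<^esub>) \<in> linear_hom K A T" by (rule intros)+
    fix a assume a: "a \<in> carrier A"
    show "counit TC (t a \<one>\<^bsub>H\<^esub>) = counit A a"
      using a counits(1)[OF a] by (simp add: counit_TC(2) counit_one bialgs)
    have "comult TC (t a \<one>\<^bsub>H\<^esub>) = sw TC ?TT (t a \<one>\<^bsub>H\<^esub>) (\<lambda>x y. ?tT x y)" (is "?l = _")
      by (rule sw_tens[OF comults(3), unfolded tensor_coalg_simps, symmetric]) (rule intros a)+
    also have "\<dots> = sw A ?TT a (\<lambda>a1 a2. sw H ?TT \<one>\<^bsub>H\<^esub> (\<lambda>h1 h2. ?tT (t a1 h1) (t a2 h2)))"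
      by (rule sw_tensor) (rule intros a | assumption)+
    also have "\<dots> = sw A ?TT a (\<lambda>a1 a2. ?tT (t a1 \<one>\<^bsub>H\<^esub>) (t a2 \<one>\<^bsub>H\<^esub>))" (is "_ = ?r")
      by (rule sw_cong) (rule sw_one[OF bialgs(2)] intros a | assumption)+
    finally show "?l = ?r" .
  qed
  show "(\<lambda>h. t \<one>\<^bsub>A\<^esub> h) \<in> coalg_hom K H TC"
  proof (rule coalg_homI, unfold tensor_coalg_simps)
    show "(\<lambda>h. t \<one>\<^bsub>A\<^esub> h) \<in> linear_hom K H T" by (rule intros)+
    fix h assume h: "h \<in> carrier H"
    show "counit TC (t \<one>\<^bsub>A\<^esub> h) = counit H h"
      using h counits(2)[OF h] by (simp add: counit_TC(2) counit_one bialgs)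
    have "comult TC (t \<one>\<^bsub>A\<^esub> h) = sw TC ?TT (t \<one>\<^bsub>A\<^esub> h) (\<lambda>x y. ?tT x y)" (is "?l = _")
      by (rule sw_tens[OF comults(3), unfolded tensor_coalg_simps, symmetric]) (rule intros h)+
    also have "\<dots> = sw A ?TT \<one>\<^bsub>A\<^esub> (\<lambda>a1 a2. sw H ?TT h (\<lambda>h1 h2. ?tT (t a1 h1) (t a2 h2)))"
      by (rule sw_tensor) (rule intros h | assumption)+
    also have "\<dots> = sw H ?TT h (\<lambda>h1 h2. ?tT (t \<one>\<^bsub>A\<^esub> h1) (t \<one>\<^bsub>A\<^esub> h2))" (is "_ = ?r")
      by (rule sw_one[OF bialgs(1)]) (rule intros h | assumption)+
    finally show "?l = ?r" .
  qed
qed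

lemma fst_snd_prod_components:
  assumes C: "k_coalgebra K C" and D: "k_coalgebra K D"
    and f: "f \<in> coalg_hom K C TC" and g: "g \<in> coalg_hom K D TC"
    and f1: "\<And>c. c \<in> carrier C \<Longrightarrow> f1 c = fstT (f c)" and f2: "\<And>c. c \<in> carrier C \<Longrightarrow> f2 c = sndT (f c)"
    and g1: "\<And>d. d \<in> carrier D \<Longrightarrow> g1 d = fstT (g d)" and g2: "\<And>d. d \<in> carrier D \<Longrightarrow> g2 d = sndT (g d)"
    and c: "c \<in> carrier C" and d: "d \<in> carrier D"
  shows "fstT (f c \<bullet> g d) = sw C A c (\<lambda>c1 c2. f1 c1 \<cdot> (f2 c2 \<triangleright> g1 d))"
    and "sndT (f c \<bullet> g d) = sw D H d (\<lambda>d1 d2. (f2 c \<triangleleft> g1 d1) \<star> g2 d2)"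
proof -
  note fl = coalg_hom_lin[OF f, unfolded tensor_coalg_simps] and gl = coalg_hom_lin[OF g, unfolded tensor_coalg_simps]
  note I = intros C D coalgebra_module[OF C] coalgebra_module[OF D] coalgebra_comultiplication[OF C]
    coalgebra_comultiplication[OF D] c d linear_hom_comp[OF fl] linear_hom_closed[OF fl]
    linear_hom_comp[OF gl] linear_hom_closed[OF gl]
  show "fstT (f c \<bullet> g d) = sw C A c (\<lambda>c1 c2. f1 c1 \<cdot> (f2 c2 \<triangleright> g1 d))"
    unfolding fst_snd_prod(1)[OF C D f g c d]
    by (rule sym, rule sw_cong) (rule I | assumption | (simp add: f1 f2 g1 d; fail))+
  show "sndT (f c \<bullet> g d) = sw D H d (\<lambda>d1 d2. (f2 c \<triangleleft> g1 d1) \<star> g2 d2)"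
    unfolding fst_snd_prod(2)[OF C D f g c d]
    by (rule sym, rule sw_cong) (rule I | assumption | (simp add: f2 g1 g2 c; fail))+
qed

text \<open>
  Both \<open>f(ab)\<close> and \<open>f(a) f(b)\<close> depend on \<open>a\<close> and \<open>b\<close> compatibly with \<open>\<Delta>\<close>, so each is rebuilt from its components.
\<close>

lemma multiplicativeI:
  assumes D: "k_bialgebra K D" and f: "f \<in> coalg_hom K D TC"
    and fst: "\<And>a b. \<lbrakk>a \<in> carrier D; b \<in> carrier D\<rbrakk> \<Longrightarrow> fstT (f (a \<otimes>\<^bsub>D\<^esub> b)) = fstT (f a \<bullet> f b)"
    and snd: "\<And>a b. \<lbrakk>a \<in> carrier D; b \<in> carrier D\<rbrakk> \<Longrightarrow> sndT (f (a \<otimes>\<^bsub>D\<^esub> b)) = sndT (f a \<bullet> f b)"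
    and ab: "a \<in> carrier D" "b \<in> carrier D"
  shows "f (a \<otimes>\<^bsub>D\<^esub> b) = f a \<bullet> f b"
proof -
  note kD = bialgebra_coalgebra[OF D]
  note fl = coalg_hom_lin[OF f, unfolded tensor_coalg_simps]
  note I = intros D kD bialgebra_algebra[OF D] coalgebra_module[OF kD] coalgebra_comultiplication[OF kD] ab
    linear_hom_comp[OF fl] linear_hom_closed[OF fl]
  have c: "f (a \<otimes>\<^bsub>D\<^esub> b) \<in> carrier T" "f a \<bullet> f b \<in> carrier T" by (rule I)+
  let ?s = "\<lambda>x y. t (fstT x) (sndT y)"
  have "f (a \<otimes>\<^bsub>D\<^esub> b) = sw TC T (f (a \<otimes>\<^bsub>D\<^esub> b)) ?s"
    by (rule tensor_fst_snd(1)[OF coalgs c(1), symmetric])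
  also have "\<dots> = sw D T (a \<otimes>\<^bsub>D\<^esub> b) (\<lambda>x y. ?s (f x) (f y))"
    by (rule sw_coalg_hom[OF _ _ _ f], unfold tensor_coalg_simps) (rule I | assumption)+
  also have "\<dots> = sw D T a (\<lambda>a1 a2. sw D T b (\<lambda>b1 b2. ?s (f (a1 \<otimes>\<^bsub>D\<^esub> b1)) (f (a2 \<otimes>\<^bsub>D\<^esub> b2))))"
    by (rule sw_mult) (rule I | assumption)+
  also have "\<dots> = sw D T a (\<lambda>a1 a2. sw D T b (\<lambda>b1 b2. ?s (f a1 \<bullet> f b1) (f a2 \<bullet> f b2)))"
    by (rule sw_cong) (rule sw_cong I | assumption | (simp add: fst snd; fail))+
  also have "\<dots> = sw D T a (\<lambda>a1 a2. sw TC T (f b) (\<lambda>y1 y2. ?s (f a1 \<bullet> y1) (f a2 \<bullet> y2)))"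
    by (rule sw_cong) (rule I sw_coalg_hom[OF _ _ _ f, unfolded tensor_coalg_simps, symmetric] | assumption)+
  also have "\<dots> = sw TC T (f a) (\<lambda>x1 x2. sw TC T (f b) (\<lambda>y1 y2. ?s (x1 \<bullet> y1) (x2 \<bullet> y2)))"
    by (rule sym, rule sw_coalg_hom[OF _ _ _ f], unfold tensor_coalg_simps) (rule I | assumption)+
  also have "\<dots> = sw TC T (f a \<bullet> f b) ?s"
    by (rule sw_bmult[symmetric]) (rule I | assumption)+
  also have "\<dots> = f a \<bullet> f b"
    by (rule tensor_fst_snd(1)[OF coalgs c(2)])
  finally show ?thesis .
qed

end

section \<open>Morphisms of bicrossed products\<close>

locale two_matched_pairs =
  over_ring K + two_hopf_actions K A H lact ract A' H' lact' ract' +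
  dom: matched_pair K A H lact ract + cod: matched_pair K A' H' lact' ract'
  for K :: "('k, 'n) ring_scheme"
    and A :: "('k, 'a, 'm) hopf_scheme" and H :: "('k, 'h, 'l) hopf_scheme"
    and lact :: "('h, 'a) tensor \<Rightarrow> 'a" and ract :: "('h, 'a) tensor \<Rightarrow> 'h"
    and A' :: "('k, 'a2, 'm2) hopf_scheme" and H' :: "('k, 'h2, 'l2) hopf_scheme"
    and lact' :: "('h2, 'a2) tensor \<Rightarrow> 'a2" and ract' :: "('h2, 'a2) tensor \<Rightarrow> 'h2"
begin

notation dom.mult_A (infixl \<open>\<cdot>\<close> 70) and dom.mult_H (infixl \<open>\<star>\<close> 70) and dom.bmult (infixl \<open>\<bullet>\<close> 70)
  and cod.mult_A (infixl \<open>\<cdot>''\<close> 70) and cod.mult_H (infixl \<open>\<star>''\<close> 70) and cod.bmult (infixl \<open>\<bullet>''\<close> 70)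

lemma bicrossed_coalg_hom: "coalg_hom K dom.B cod.B = coalg_hom K dom.TC cod.TC"
  and bicrossed_linear_hom: "linear_hom K dom.B cod.B = linear_hom K dom.T cod.T"
proof -
  show l: "linear_hom K dom.B cod.B = linear_hom K dom.T cod.T"
    by (intro linear_hom_cong_structure dom.bicrossed_sel cod.bicrossed_sel)
  note E = tensor_group_cong_structure[OF cod.bicrossed_sel(1,4,5) cod.bicrossed_sel(1,4,5)]
  have t: "tlift (tensor_alg K cod.B cod.B) = tlift (tensor_alg K cod.T cod.T)"
    by (rule tlift_cong_structure) (simp_all add: tensor_alg_def[of K cod.B] tensor_alg_def[of K cod.T] E Let_def)
  show "coalg_hom K dom.B cod.B = coalg_hom K dom.TC cod.TC"
    unfolding coalg_hom_def tensor_coalg_simps sweedler2_def l t E dom.bicrossed_sel cod.bicrossed_sel ..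
qed

text \<open>
  The bicrossed product has the coalgebra structure of the tensor product, so only the
  multiplication and the unit refer to the matched pairs.
\<close>

lemma hopf_hom_iff:
  "\<psi> \<in> hopf_hom K dom.B cod.B \<longleftrightarrow> \<psi> \<in> extensional (carrier dom.T) \<and> \<psi> \<in> coalg_hom K dom.TC cod.TC \<and>
    (\<forall>X\<in>carrier dom.T. \<forall>Y\<in>carrier dom.T. \<psi> (X \<bullet> Y) = \<psi> X \<bullet>' \<psi> Y) \<and>
    \<psi> (dom.t \<one>\<^bsub>A\<^esub> \<one>\<^bsub>H\<^esub>) = cod.t \<one>\<^bsub>A'\<^esub> \<one>\<^bsub>H'\<^esub>"
  using coalg_hom_lin[of \<psi> dom.TC cod.TC]
  unfolding hopf_hom_def alg_hom_def ring_hom_def bicrossed_coalg_hom bicrossed_linear_hom tensor_coalg_simps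
    dom.bicrossed_sel cod.bicrossed_sel
  by (auto simp: linear_hom_def)

context
  fixes u :: "'a \<Rightarrow> 'a2" and p :: "'a \<Rightarrow> 'h2" and r :: "'h \<Rightarrow> 'a2" and v :: "'h \<Rightarrow> 'h2"
    and \<alpha> :: "'a \<Rightarrow> ('a2, 'h2) tensor" and \<beta> :: "'h \<Rightarrow> ('a2, 'h2) tensor"
  assumes \<alpha>: "\<alpha> \<in> coalg_hom K A cod.TC" and \<beta>: "\<beta> \<in> coalg_hom K H cod.TC"
    and u_eq: "\<forall>a\<in>carrier A. u a = cod.fstT (\<alpha> a)" and p_eq: "\<forall>a\<in>carrier A. p a = cod.sndT (\<alpha> a)"
    and r_eq: "\<forall>h\<in>carrier H. r h = cod.fstT (\<beta> h)" and v_eq: "\<forall>h\<in>carrier H. v h = cod.sndT (\<beta> h)"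
begin

private lemmas u = bspec[OF u_eq] and p = bspec[OF p_eq] and r = bspec[OF r_eq] and v = bspec[OF v_eq]

lemma component_coalg_homs:
  "u \<in> coalg_hom K A A'" "p \<in> coalg_hom K A H'" "r \<in> coalg_hom K H A'" "v \<in> coalg_hom K H H'"
  using coalg_hom_cong_on[OF dom.coalgs(1) cod.coalgs(1) coalg_hom_components(1)[OF dom.coalgs(1) cod.coalgs \<alpha>] u]
    coalg_hom_cong_on[OF dom.coalgs(1) cod.coalgs(2) coalg_hom_components(2)[OF dom.coalgs(1) cod.coalgs \<alpha>] p]
    coalg_hom_cong_on[OF dom.coalgs(2) cod.coalgs(1) coalg_hom_components(1)[OF dom.coalgs(2) cod.coalgs \<beta>] r]
    coalg_hom_cong_on[OF dom.coalgs(2) cod.coalgs(2) coalg_hom_components(2)[OF dom.coalgs(2) cod.coalgs \<beta>] v]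
  by blast+

lemma component_commuting: "commuting K A A' H' u p" "commuting K H A' H' r v"
proof -
  note a = coalg_hom_components[OF dom.coalgs(1) cod.coalgs \<alpha>]
    and b = coalg_hom_components[OF dom.coalgs(2) cod.coalgs \<beta>]
  show "commuting K A A' H' u p"
    by (rule commuting_cong_on[OF dom.coalgs(1) cod.coalgs coalg_hom_lin[OF a(1)] coalg_hom_lin[OF a(2)] a(3) u p])
  show "commuting K H A' H' r v"
    by (rule commuting_cong_on[OF dom.coalgs(2) cod.coalgs coalg_hom_lin[OF b(1)] coalg_hom_lin[OF b(2)] b(3) r v])
qed

lemma component_pairing:
  "a \<in> carrier A \<Longrightarrow> \<alpha> a = sw A cod.T a (\<lambda>a1 a2. cod.t (u a1) (p a2))"
  "h \<in> carrier H \<Longrightarrow> \<beta> h = sw H cod.T h (\<lambda>h1 h2. cod.t (r h1) (v h2))"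
proof -
  note a = coalg_hom_components[OF dom.coalgs(1) cod.coalgs \<alpha>]
    and b = coalg_hom_components[OF dom.coalgs(2) cod.coalgs \<beta>]
  show "\<alpha> a = sw A cod.T a (\<lambda>a1 a2. cod.t (u a1) (p a2))" if "a \<in> carrier A"
    using a(4)[OF that] pairing_cong[OF dom.coalgs(1) cod.coalgs coalg_hom_lin[OF a(1)] coalg_hom_lin[OF a(2)] that u p]
    by (simp add: pairing_def)
  show "\<beta> h = sw H cod.T h (\<lambda>h1 h2. cod.t (r h1) (v h2))" if "h \<in> carrier H"
    using b(4)[OF that] pairing_cong[OF dom.coalgs(2) cod.coalgs coalg_hom_lin[OF b(1)] coalg_hom_lin[OF b(2)] that r v]
    by (simp add: pairing_def)
qed

text \<open>
  These are the expressions on the left of the last two conditions on a quadruple and on the right of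
  the four preceding ones; the last two occur in the calculation of the remaining expressions.
\<close>

lemma products_of_components:
  "\<lbrakk>a \<in> carrier A; b \<in> carrier A\<rbrakk> \<Longrightarrow> cod.fstT (\<alpha> a \<bullet>' \<alpha> b)
    = sw A A' a (\<lambda>a1 a2. u a1 \<cdot>' (p a2 \<triangleright>' u b))"
  "\<lbrakk>a \<in> carrier A; b \<in> carrier A\<rbrakk> \<Longrightarrow> cod.sndT (\<alpha> a \<bullet>' \<alpha> b)
    = sw A H' b (\<lambda>b1 b2. (p a \<triangleleft>' u b1) \<star>' p b2)"
  "\<lbrakk>h \<in> carrier H; g \<in> carrier H\<rbrakk> \<Longrightarrow> cod.fstT (\<beta> h \<bullet>' \<beta> g)
    = sw H A' h (\<lambda>h1 h2. r h1 \<cdot>' (v h2 \<triangleright>' r g))"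
  "\<lbrakk>h \<in> carrier H; g \<in> carrier H\<rbrakk> \<Longrightarrow> cod.sndT (\<beta> h \<bullet>' \<beta> g)
    = sw H H' g (\<lambda>g1 g2. (v h \<triangleleft>' r g1) \<star>' v g2)"
  "\<lbrakk>h \<in> carrier H; b \<in> carrier A\<rbrakk> \<Longrightarrow> cod.fstT (\<beta> h \<bullet>' \<alpha> b)
    = sw H A' h (\<lambda>h1 h2. r h1 \<cdot>' (v h2 \<triangleright>' u b))"
  "\<lbrakk>h \<in> carrier H; b \<in> carrier A\<rbrakk> \<Longrightarrow> cod.sndT (\<beta> h \<bullet>' \<alpha> b)
    = sw A H' b (\<lambda>b1 b2. (v h \<triangleleft>' u b1) \<star>' p b2)"
  "\<lbrakk>a \<in> carrier A; h \<in> carrier H\<rbrakk> \<Longrightarrow> cod.fstT (\<alpha> a \<bullet>' \<beta> h)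
    = sw A A' a (\<lambda>a1 a2. u a1 \<cdot>' (p a2 \<triangleright>' r h))"
  "\<lbrakk>a \<in> carrier A; h \<in> carrier H\<rbrakk> \<Longrightarrow> cod.sndT (\<alpha> a \<bullet>' \<beta> h)
    = sw H H' h (\<lambda>h1 h2. (p a \<triangleleft>' r h1) \<star>' v h2)"
  by (rule cod.fst_snd_prod_components dom.coalgs \<alpha> \<beta> u p r v | assumption)+

lemmas component_lin = component_coalg_homs[THEN coalg_hom_lin]

lemmas component_intros =
  linear_hom_comp[OF component_lin(1)] linear_hom_closed[OF component_lin(1)]
  linear_hom_comp[OF component_lin(2)] linear_hom_closed[OF component_lin(2)]
  linear_hom_comp[OF component_lin(3)] linear_hom_closed[OF component_lin(3)]
  linear_hom_comp[OF component_lin(4)] linear_hom_closed[OF component_lin(4)]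
  linear_hom_comp[OF coalg_hom_lin[OF \<alpha>, unfolded tensor_coalg_simps]]
  linear_hom_closed[OF coalg_hom_lin[OF \<alpha>, unfolded tensor_coalg_simps]]
  linear_hom_comp[OF coalg_hom_lin[OF \<beta>, unfolded tensor_coalg_simps]]
  linear_hom_closed[OF coalg_hom_lin[OF \<beta>, unfolded tensor_coalg_simps]]
  dom.intros cod.intros

text \<open>
  Both factors are written as pairings of their components, and the product of pure tensors is
  evaluated. Its inner sums run over the legs of \<open>p(x)\<close> and \<open>r(y)\<close>, which are images of the legs of
  \<open>x\<close> and \<open>y\<close>.
\<close>

lemma product_formula:
  assumes a: "a \<in> carrier A" and h: "h \<in> carrier H"
  shows "\<alpha> a \<bullet>' \<beta> h = sweedler3 A cod.T a (\<lambda>a1 a2 a3. sweedler3 H cod.T h (\<lambda>h1 h2 h3.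
    cod.t (u a1 \<cdot>' (p a2 \<triangleright>' r h1)) ((p a3 \<triangleleft>' r h2) \<star>' v h3)))"
proof -
  note I = component_intros a h
  let ?E = "\<lambda>a1 a2 a3 h1 h2 h3. cod.t (u a1 \<cdot>' (p a2 \<triangleright>' r h1)) ((p a3 \<triangleleft>' r h2) \<star>' v h3)"
  have "\<alpha> a \<bullet>' \<beta> h = sw A cod.T a (\<lambda>a1 x. cod.t (u a1) (p x) \<bullet>' \<beta> h)"
    unfolding component_pairing(1)[OF a]
    by (rule sw_push[where V=cod.T and h="\<lambda>z. z \<bullet>' \<beta> h"]) (rule I | assumption)+
  also have "\<dots> = sw A cod.T a (\<lambda>a1 x. sw H cod.T h (\<lambda>y h3. cod.t (u a1) (p x) \<bullet>' cod.t (r y) (v h3)))"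
  proof (rule sw_cong)
    fix a1 x assume x: "a1 \<in> carrier A" "x \<in> carrier A"
    show "cod.t (u a1) (p x) \<bullet>' \<beta> h = sw H cod.T h (\<lambda>y h3. cod.t (u a1) (p x) \<bullet>' cod.t (r y) (v h3))"
      unfolding component_pairing(2)[OF h]
      by (rule sw_push[where V=cod.T and h="\<lambda>z. cod.t (u a1) (p x) \<bullet>' z"]) (rule I x | assumption)+
  qed (rule I | assumption)+
  also have "\<dots> = sw A cod.T a (\<lambda>a1 x. sw H cod.T h (\<lambda>y h3. sw H' cod.T (p x) (\<lambda>g1 g2. sw A' cod.T (r y) (\<lambda>c1 c2.
      cod.t (u a1 \<cdot>' (g1 \<triangleright>' c1)) ((g2 \<triangleleft>' c2) \<star>' v h3)))))"
    by (rule sw_cong) (rule cod.bmult_tens(1) sw_cong I | assumption)+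
  also have "\<dots> = sw A cod.T a (\<lambda>a1 x. sw H cod.T h (\<lambda>y h3. sw A cod.T x (\<lambda>a2 a3. sw A' cod.T (r y) (\<lambda>c1 c2.
      cod.t (u a1 \<cdot>' (p a2 \<triangleright>' c1)) ((p a3 \<triangleleft>' c2) \<star>' v h3)))))"
    by (rule sw_cong) (rule sw_coalg_hom[OF _ _ _ component_coalg_homs(2)] sw_cong I | assumption)+
  also have "\<dots> = sw A cod.T a (\<lambda>a1 x. sw H cod.T h (\<lambda>y h3. sw A cod.T x (\<lambda>a2 a3. sw H cod.T y (\<lambda>h1 h2.
      ?E a1 a2 a3 h1 h2 h3))))"
    by (rule sw_cong) (rule sw_coalg_hom[OF _ _ _ component_coalg_homs(3)] sw_cong I | assumption)+
  also have "\<dots> = sw A cod.T a (\<lambda>a1 x. sw A cod.T x (\<lambda>a2 a3. sw H cod.T h (\<lambda>y h3. sw H cod.T y (\<lambda>h1 h2.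
      ?E a1 a2 a3 h1 h2 h3))))"
    by (rule sw_cong) (rule sw_swap I | assumption)+
  also have "\<dots> = sw A cod.T a (\<lambda>x a3. sw A cod.T x (\<lambda>a1 a2.
      sw H cod.T h (\<lambda>y h3. sw H cod.T y (\<lambda>h1 h2. ?E a1 a2 a3 h1 h2 h3))))"
    by (rule sw_coassoc[symmetric]) (rule I | assumption)+
  finally show ?thesis unfolding sweedler3_def .
qed

text \<open>
  These are the right-hand sides of the last two conditions on a quadruple. Since the actions are
  coalgebra maps on \<open>H \<otimes> A\<close>, the calculation takes place over the single element \<open>h \<otimes> b\<close> of that coalgebra and
  is expanded only at the end.
\<close>

lemma crossed_product_components:
  assumes h: "h \<in> carrier H" and b: "b \<in> carrier A"
  shows "cod.fstT (cod.prod_map \<alpha> \<beta> (dom.cross (tens K H A h b))) =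
      sweedler3 H A' h (\<lambda>h1 h2 h3. sweedler3 A A' b (\<lambda>b1 b2 b3.
        u (h1 \<triangleright> b1) \<cdot>' (p (h2 \<triangleright> b2) \<triangleright>' r (h3 \<triangleleft> b3))))" (is ?F)
    and "cod.sndT (cod.prod_map \<alpha> \<beta> (dom.cross (tens K H A h b))) =
      sweedler3 H H' h (\<lambda>h1 h2 h3. sweedler3 A H' b (\<lambda>b1 b2 b3.
        (p (h1 \<triangleright> b1) \<triangleleft>' r (h2 \<triangleleft> b2)) \<star>' v (h3 \<triangleleft> b3)))" (is ?S)
proof -
  let ?HA = "tensor_alg K H A" and ?z = "tens K H A h b" and ?psi = "cod.prod_map \<alpha> \<beta>"
  note al = coalg_hom_lin[OF \<alpha>, unfolded tensor_coalg_simps] and bl = coalg_hom_lin[OF \<beta>, unfolded tensor_coalg_simps]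
  note psi = cod.prod_map_linear[OF dom.coalgs al bl]
  note I = component_intros h b linear_hom_comp[OF psi(1)] linear_hom_closed[OF psi(1)] dom.lact_linear dom.ract_linear
  have z: "?z \<in> carrier ?HA" by (rule I)+
  have cross: "dom.cross ?z = sw dom.HA dom.T ?z (\<lambda>x y. dom.t (lact x) (ract y))"
    unfolding dom.cross_def pairing_def ..
  have "cod.fstT (?psi (dom.cross ?z)) = sw dom.HA A' ?z (\<lambda>x y. cod.fstT (?psi (dom.t (lact x) (ract y))))"
    unfolding cross by (rule sw_tensor_push[where V=dom.T and h="\<lambda>Z. cod.fstT (?psi Z)"]) (rule I | assumption)+
  also have "\<dots> = sw dom.HA A' ?z (\<lambda>x z3. sw dom.HA A' x (\<lambda>z1 z2.
      u (lact z1) \<cdot>' (p (lact z2) \<triangleright>' r (ract z3))))"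
  proof (rule sw_tensor_cong)
    fix x y assume xy: "x \<in> carrier ?HA" "y \<in> carrier ?HA"
    have c: "lact x \<in> carrier A" "ract y \<in> carrier H" by (rule I xy)+
    have "cod.fstT (?psi (dom.t (lact x) (ract y))) = sw A A' (lact x) (\<lambda>a1 a2. u a1 \<cdot>' (p a2 \<triangleright>' r (ract y)))" (is "?l = _")
      unfolding psi(2)[OF c] by (rule products_of_components(7)[OF c])
    also have "\<dots> = sw dom.HA A' x (\<lambda>z1 z2. u (lact z1) \<cdot>' (p (lact z2) \<triangleright>' r (ract y)))" (is "_ = ?r")
      by (rule sw_from_tensor[OF _ _ _ dom.lact_coalg_hom]) (rule I xy | assumption)+
    finally show "?l = ?r" .
  qed (rule I | assumption)+
  also have "\<dots> = sweedler3 dom.HA A' ?z (\<lambda>z1 z2 z3. u (lact z1) \<cdot>' (p (lact z2) \<triangleright>' r (ract z3)))"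
    unfolding sweedler3_def ..
  also have "\<dots> = sweedler3 H A' h (\<lambda>h1 h2 h3. sweedler3 A A' b (\<lambda>b1 b2 b3.
        u (h1 \<triangleright> b1) \<cdot>' (p (h2 \<triangleright> b2) \<triangleright>' r (h3 \<triangleleft> b3))))"
    by (rule sweedler3_tensor) (rule I | assumption)+
  finally show ?F .
  have "cod.sndT (?psi (dom.cross ?z)) = sw dom.HA H' ?z (\<lambda>x y. cod.sndT (?psi (dom.t (lact x) (ract y))))"
    unfolding cross by (rule sw_tensor_push[where V=dom.T and h="\<lambda>Z. cod.sndT (?psi Z)"]) (rule I | assumption)+
  also have "\<dots> = sw dom.HA H' ?z (\<lambda>z1 y. sw dom.HA H' y (\<lambda>z2 z3.
      (p (lact z1) \<triangleleft>' r (ract z2)) \<star>' v (ract z3)))"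
  proof (rule sw_tensor_cong)
    fix x y assume xy: "x \<in> carrier ?HA" "y \<in> carrier ?HA"
    have c: "lact x \<in> carrier A" "ract y \<in> carrier H" by (rule I xy)+
    have "cod.sndT (?psi (dom.t (lact x) (ract y))) = sw H H' (ract y) (\<lambda>h1 h2. (p (lact x) \<triangleleft>' r h1) \<star>' v h2)" (is "?l = _")
      unfolding psi(2)[OF c] by (rule products_of_components(8)[OF c])
    also have "\<dots> = sw dom.HA H' y (\<lambda>z2 z3. (p (lact x) \<triangleleft>' r (ract z2)) \<star>' v (ract z3))" (is "_ = ?r")
      by (rule sw_from_tensor[OF _ _ _ dom.ract_coalg_hom]) (rule I xy | assumption)+
    finally show "?l = ?r" .
  qed (rule I | assumption)+
  \<comment> \<open>The second component splits the right leg, whereas threefold sums split the left leg.\<close>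
  also have "\<dots> = sw dom.HA H' ?z (\<lambda>x z3. sw dom.HA H' x (\<lambda>z1 z2.
      (p (lact z1) \<triangleleft>' r (ract z2)) \<star>' v (ract z3)))"
    by (rule tensor_coalg_coassoc[symmetric]) (rule I | assumption)+
  also have "\<dots> = sweedler3 dom.HA H' ?z (\<lambda>z1 z2 z3. (p (lact z1) \<triangleleft>' r (ract z2)) \<star>' v (ract z3))"
    unfolding sweedler3_def ..
  also have "\<dots> = sweedler3 H H' h (\<lambda>h1 h2 h3. sweedler3 A H' b (\<lambda>b1 b2 b3.
        (p (h1 \<triangleright> b1) \<triangleleft>' r (h2 \<triangleleft> b2)) \<star>' v (h3 \<triangleleft> b3)))"
    by (rule sweedler3_tensor) (rule I | assumption)+
  finally show ?S .
qed

text \<open>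
  Each of the three identities is an equality of maps that respect \<open>\<Delta>\<close> and take values in
  \<open>A' \<otimes> H'\<close>; for the exchange identity this holds because \<open>cross\<close> and products of coalgebra maps are
  coalgebra maps. The identity is therefore equivalent to the pair of equations between its components,
  and these are conditions on the quadruple.
\<close>

lemma compatible_iff:
  "(u, p, r, v) \<in> compatible_quadruples \<longleftrightarrow>
    u \<in> unitary_coalg_hom K A A' \<and> p \<in> unitary_coalg_hom K A H' \<and>
    r \<in> unitary_coalg_hom K H A' \<and> v \<in> unitary_coalg_hom K H H' \<and>
    (\<forall>a\<in>carrier A. \<forall>b\<in>carrier A. \<alpha> (a \<cdot> b) = \<alpha> a \<bullet>' \<alpha> b) \<and>
    (\<forall>h\<in>carrier H. \<forall>g\<in>carrier H. \<beta> (h \<star> g) = \<beta> h \<bullet>' \<beta> g) \<and>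
    (\<forall>h\<in>carrier H. \<forall>b\<in>carrier A. \<beta> h \<bullet>' \<alpha> b = cod.prod_map \<alpha> \<beta> (dom.cross (tens K H A h b)))"
    (is "_ \<longleftrightarrow> ?u \<and> ?p \<and> ?r \<and> ?v \<and> ?A \<and> ?H \<and> ?X")
proof -
  note al = coalg_hom_lin[OF \<alpha>, unfolded tensor_coalg_simps] and bl = coalg_hom_lin[OF \<beta>, unfolded tensor_coalg_simps]
  note S = products_of_components crossed_product_components u[of "a \<cdot> b" for a b] p[of "a \<cdot> b" for a b]
    r[of "h \<star> g" for h g] v[of "h \<star> g" for h g] mult_closed dom.algs
  let ?eqs = "(\<forall>a\<in>carrier A. \<forall>b\<in>carrier A. cod.fstT (\<alpha> (a \<cdot> b)) = cod.fstT (\<alpha> a \<bullet>' \<alpha> b)) \<and>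
    (\<forall>a\<in>carrier A. \<forall>b\<in>carrier A. cod.sndT (\<alpha> (a \<cdot> b)) = cod.sndT (\<alpha> a \<bullet>' \<alpha> b)) \<and>
    (\<forall>h\<in>carrier H. \<forall>g\<in>carrier H. cod.fstT (\<beta> (h \<star> g)) = cod.fstT (\<beta> h \<bullet>' \<beta> g)) \<and>
    (\<forall>h\<in>carrier H. \<forall>g\<in>carrier H. cod.sndT (\<beta> (h \<star> g)) = cod.sndT (\<beta> h \<bullet>' \<beta> g)) \<and>
    (\<forall>h\<in>carrier H. \<forall>b\<in>carrier A. cod.fstT (\<beta> h \<bullet>' \<alpha> b) = cod.fstT (cod.prod_map \<alpha> \<beta> (dom.cross (tens K H A h b)))) \<and>
    (\<forall>h\<in>carrier H. \<forall>b\<in>carrier A. cod.sndT (\<beta> h \<bullet>' \<alpha> b) = cod.sndT (cod.prod_map \<alpha> \<beta> (dom.cross (tens K H A h b))))"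
  have 1: "(u, p, r, v) \<in> compatible_quadruples \<longleftrightarrow> ?u \<and> ?p \<and> ?r \<and> ?v \<and> ?eqs"
    unfolding compatible_quadruples_def mem_Collect_eq prod.case
    using component_commuting by (simp add: S commuting_def conj_assoc)
  have "?A \<and> ?H \<and> ?X" if eqs: ?eqs
  proof (intro conjI ballI)
    show "\<alpha> (a \<cdot> b) = \<alpha> a \<bullet>' \<alpha> b" if "a \<in> carrier A" "b \<in> carrier A" for a b
      by (rule cod.multiplicativeI[OF dom.bialgs(1) \<alpha> _ _ that]) (use eqs in blast)+
    show "\<beta> (h \<star> g) = \<beta> h \<bullet>' \<beta> g" if "h \<in> carrier H" "g \<in> carrier H" for h g
      by (rule cod.multiplicativeI[OF dom.bialgs(2) \<beta> _ _ that]) (use eqs in blast)+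
    fix h b assume hb: "h \<in> carrier H" "b \<in> carrier A"
    note pm = cod.prod_map_linear(2)[OF dom.coalgs(2,1) bl al]
    have "cod.prod_map \<beta> \<alpha> (tens K H A h b) = cod.prod_map \<alpha> \<beta> (dom.cross (tens K H A h b))"
    proof (rule coalg_hom_eq_on_tensors[OF dom.coalgs(2,1) cod.coalgs])
      show "cod.prod_map \<beta> \<alpha> \<in> coalg_hom K dom.HA cod.TC"
        by (rule cod.prod_map_coalg_hom[OF dom.coalgs(2,1) \<beta> \<alpha>])
      show "(\<lambda>X. cod.prod_map \<alpha> \<beta> (dom.cross X)) \<in> coalg_hom K dom.HA cod.TC"
        by (rule coalg_hom_comp[OF _ _ _ dom.cross_coalg_hom cod.prod_map_coalg_hom[OF dom.coalgs \<alpha> \<beta>]])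
          (rule dom.comults coalgebra_module[OF cod.TC_coalgebra])+
    qed (use eqs hb in \<open>simp_all add: pm tens_closed dom.mods\<close>)
    then show "\<beta> h \<bullet>' \<alpha> b = cod.prod_map \<alpha> \<beta> (dom.cross (tens K H A h b))" by (simp add: pm hb)
  qed
  moreover have ?eqs if "?A \<and> ?H \<and> ?X" using that by simp
  ultimately have 2: "?eqs \<longleftrightarrow> ?A \<and> ?H \<and> ?X" by (rule iffI)
  show ?thesis by (simp only: 1 2)
qed

end

definition morphism_of where
  "morphism_of = (\<lambda>(u, p, r, v). restrict (cod.prod_map (pairing K A A' H' u p) (pairing K H A' H' r v)) (carrier dom.T))"

definition quadruple_of where
  "quadruple_of \<psi> =
    (restrict (\<lambda>a. cod.fstT (\<psi> (dom.t a \<one>\<^bsub>H\<^esub>))) (carrier A), restrict (\<lambda>a. cod.sndT (\<psi> (dom.t a \<one>\<^bsub>H\<^esub>))) (carrier A),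
     restrict (\<lambda>h. cod.fstT (\<psi> (dom.t \<one>\<^bsub>A\<^esub> h))) (carrier H), restrict (\<lambda>h. cod.sndT (\<psi> (dom.t \<one>\<^bsub>A\<^esub> h))) (carrier H))"

text \<open>
  Multiplicativity of \<open>\<psi>\<close> is the calculation
  \<open>\<alpha>(a) (\<beta>(h) \<alpha>(c)) \<beta>(g) = (\<alpha>(a) \<beta>(h)) (\<alpha>(c) \<beta>(g))\<close>. By the exchange identity the middle factor is \<open>\<psi>\<close>
  applied to \<open>cross(h \<otimes> c)\<close>; since \<open>\<alpha>\<close> and \<open>\<beta>\<close> are multiplicative, \<open>\<psi>\<close> turns the two-sided action
  into multiplication by \<open>\<alpha>(a)\<close> and \<open>\<beta>(g)\<close>.
\<close>

lemma morphism_of_quadruple: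
  assumes q: "(u, p, r, v) \<in> compatible_quadruples"
  shows "morphism_of (u, p, r, v) \<in> hopf_hom K dom.B cod.B" (is ?hom)
    and "quadruple_of (morphism_of (u, p, r, v)) = (u, p, r, v)" (is ?inv)
    and "\<And>a h. \<lbrakk>a \<in> carrier A; h \<in> carrier H\<rbrakk> \<Longrightarrow> morphism_of (u, p, r, v) (dom.t a h) =
      sweedler3 A cod.T a (\<lambda>a1 a2 a3. sweedler3 H cod.T h (\<lambda>h1 h2 h3.
        cod.t (u a1 \<cdot>' (p a2 \<triangleright>' r h1)) ((p a3 \<triangleleft>' r h2) \<star>' v h3)))"
proof -
  from q have uprv: "u \<in> coalg_hom K A A'" "p \<in> coalg_hom K A H'" "r \<in> coalg_hom K H A'" "v \<in> coalg_hom K H H'"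
    and ext: "u \<in> extensional (carrier A)" "p \<in> extensional (carrier A)" "r \<in> extensional (carrier H)" "v \<in> extensional (carrier H)"
    and unit: "u \<one>\<^bsub>A\<^esub> = \<one>\<^bsub>A'\<^esub>" "p \<one>\<^bsub>A\<^esub> = \<one>\<^bsub>H'\<^esub>" "r \<one>\<^bsub>H\<^esub> = \<one>\<^bsub>A'\<^esub>" "v \<one>\<^bsub>H\<^esub> = \<one>\<^bsub>H'\<^esub>"
    and comm: "commuting K A A' H' u p" "commuting K H A' H' r v"
    unfolding compatible_quadruples_def unitary_coalg_hom_def commuting_def by auto
  define \<alpha> where "\<alpha> = pairing K A A' H' u p"
  define \<beta> where "\<beta> = pairing K H A' H' r v"
  let ?psi = "cod.prod_map \<alpha> \<beta>"
  have \<alpha>: "\<alpha> \<in> coalg_hom K A cod.TC"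
    unfolding \<alpha>_def by (rule pairing_coalg_hom[OF dom.coalgs(1) cod.coalgs uprv(1,2) comm(1)])
  have \<beta>: "\<beta> \<in> coalg_hom K H cod.TC"
    unfolding \<beta>_def by (rule pairing_coalg_hom[OF dom.coalgs(2) cod.coalgs uprv(3,4) comm(2)])
  have comps: "u a = cod.fstT (\<alpha> a)" "p a = cod.sndT (\<alpha> a)" if "a \<in> carrier A" for a
    unfolding \<alpha>_def using pairing_fst_snd[OF dom.coalgs(1) cod.coalgs uprv(1,2) that] by simp_all
  have comps': "r h = cod.fstT (\<beta> h)" "v h = cod.sndT (\<beta> h)" if "h \<in> carrier H" for h
    unfolding \<beta>_def using pairing_fst_snd[OF dom.coalgs(2) cod.coalgs uprv(3,4) that] by simp_all
  have all_comps: "\<forall>a\<in>carrier A. u a = cod.fstT (\<alpha> a)" "\<forall>a\<in>carrier A. p a = cod.sndT (\<alpha> a)"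
    "\<forall>h\<in>carrier H. r h = cod.fstT (\<beta> h)" "\<forall>h\<in>carrier H. v h = cod.sndT (\<beta> h)"
    using comps comps' by blast+
  note al = coalg_hom_lin[OF \<alpha>, unfolded tensor_coalg_simps] and bl = coalg_hom_lin[OF \<beta>, unfolded tensor_coalg_simps]
  note cl = linear_hom_closed[OF al] linear_hom_closed[OF bl]
  note psi = cod.prod_map_linear[OF dom.coalgs al bl]
  note psiC = cod.prod_map_coalg_hom[OF dom.coalgs \<alpha> \<beta>]
  have one: "\<alpha> \<one>\<^bsub>A\<^esub> = cod.t \<one>\<^bsub>A'\<^esub> \<one>\<^bsub>H'\<^esub>" "\<beta> \<one>\<^bsub>H\<^esub> = cod.t \<one>\<^bsub>A'\<^esub> \<one>\<^bsub>H'\<^esub>"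
  proof -
    note I = component_intros[OF \<alpha> \<beta> all_comps]
    show "\<alpha> \<one>\<^bsub>A\<^esub> = cod.t \<one>\<^bsub>A'\<^esub> \<one>\<^bsub>H'\<^esub>"
      unfolding \<alpha>_def pairing_def unit(1,2)[symmetric]
      by (rule sw_one[OF dom.bialgs(1)]) (rule I | assumption)+
    show "\<beta> \<one>\<^bsub>H\<^esub> = cod.t \<one>\<^bsub>A'\<^esub> \<one>\<^bsub>H'\<^esub>"
      unfolding \<beta>_def pairing_def unit(3,4)[symmetric]
      by (rule sw_one[OF dom.bialgs(2)]) (rule I | assumption)+
  qed
  from q[unfolded compatible_iff[OF \<alpha> \<beta> all_comps]]
  have amult: "\<And>a b. \<lbrakk>a \<in> carrier A; b \<in> carrier A\<rbrakk> \<Longrightarrow> \<alpha> (a \<cdot> b) = \<alpha> a \<bullet>' \<alpha> b"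
    and bmult: "\<And>h g. \<lbrakk>h \<in> carrier H; g \<in> carrier H\<rbrakk> \<Longrightarrow> \<beta> (h \<star> g) = \<beta> h \<bullet>' \<beta> g"
    and exchange: "\<And>h b. \<lbrakk>h \<in> carrier H; b \<in> carrier A\<rbrakk> \<Longrightarrow> \<beta> h \<bullet>' \<alpha> b = ?psi (dom.cross (tens K H A h b))"
    by blast+
  have psi_outer: "?psi (dom.outer a g Z) = \<alpha> a \<bullet>' (?psi Z \<bullet>' \<beta> g)"
    if e: "a \<in> carrier A" "g \<in> carrier H" and Z: "Z \<in> carrier dom.T" for a g Z
  proof (rule linear_ext[OF dom.mods _ _ _ Z])
    note I = linear_hom_comp[OF psi(1)] linear_hom_closed[OF psi(1)] cl dom.intros cod.intros e
    show "(\<lambda>Z. ?psi (dom.outer a g Z)) \<in> linear_hom K dom.T cod.T"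
      "(\<lambda>Z. \<alpha> a \<bullet>' (?psi Z \<bullet>' \<beta> g)) \<in> linear_hom K dom.T cod.T"
      by (rule I)+
  qed (simp add: dom.outer_tens psi(2) e amult bmult mult_closed dom.algs cl cod.bmult_assoc cod.lin_bmult(3))
  have mult: "?psi (X \<bullet> Y) = ?psi X \<bullet>' ?psi Y" if XY: "X \<in> carrier dom.T" "Y \<in> carrier dom.T" for X Y
  proof (rule dom.bmult_ext[where V="cod.T", OF _ _ _ _ _ _ XY])
    note I = linear_hom_comp[OF psi(1)] linear_hom_closed[OF psi(1)] dom.intros cod.intros
    show "module K cod.T" by (rule I)+
    fix Z assume Z: "Z \<in> carrier dom.T"
    show "(\<lambda>X. ?psi (X \<bullet> Z)) \<in> linear_hom K dom.T cod.T"
      "(\<lambda>X. ?psi (Z \<bullet> X)) \<in> linear_hom K dom.T cod.T"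
      "(\<lambda>X. ?psi X \<bullet>' ?psi Z) \<in> linear_hom K dom.T cod.T"
      "(\<lambda>X. ?psi Z \<bullet>' ?psi X) \<in> linear_hom K dom.T cod.T"
      by (rule I Z)+
  next
    fix a h c g assume e: "a \<in> carrier A" "h \<in> carrier H" "c \<in> carrier A" "g \<in> carrier H"
    have "?psi (dom.t a h \<bullet> dom.t c g) = \<alpha> a \<bullet>' ((\<beta> h \<bullet>' \<alpha> c) \<bullet>' \<beta> g)" (is "?l = _")
      using e by (simp add: dom.bmult_tens(2) psi_outer exchange linear_hom_closed[OF dom.cross_linear] tens_closed dom.mods)
    also have "\<dots> = ?psi (dom.t a h) \<bullet>' ?psi (dom.t c g)" (is "_ = ?r")
      using e by (simp add: psi(2) cl cod.bmult_assoc cod.lin_bmult(3))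
    finally show "?l = ?r" .
  qed
  have M: "morphism_of (u, p, r, v) = restrict ?psi (carrier dom.T)"
    unfolding morphism_of_def \<alpha>_def \<beta>_def by simp
  have MX: "morphism_of (u, p, r, v) X = ?psi X" if "X \<in> carrier dom.T" for X
    unfolding M using that by simp
  have psi_left: "?psi (dom.t a \<one>\<^bsub>H\<^esub>) = \<alpha> a" if "a \<in> carrier A" for a
    using that by (simp add: psi(2) one cod.bmult_one cl)
  have psi_right: "?psi (dom.t \<one>\<^bsub>A\<^esub> h) = \<beta> h" if "h \<in> carrier H" for h
    using that by (simp add: psi(2) one cod.bmult_one cl)
  show ?hom
    unfolding hopf_hom_iff
  proof (intro conjI ballI)
    show "morphism_of (u, p, r, v) \<in> extensional (carrier dom.T)" unfolding M by simp
    show "morphism_of (u, p, r, v) \<in> coalg_hom K dom.TC cod.TC"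
      by (rule coalg_hom_cong_on[OF dom.TC_coalgebra cod.TC_coalgebra psiC]) (simp add: tensor_coalg_simps MX)
    show "morphism_of (u, p, r, v) (X \<bullet> Y) = morphism_of (u, p, r, v) X \<bullet>' morphism_of (u, p, r, v) Y"
      if "X \<in> carrier dom.T" "Y \<in> carrier dom.T" for X Y
      using that by (simp add: MX mult dom.lin_bmult(3))
    show "morphism_of (u, p, r, v) (dom.t \<one>\<^bsub>A\<^esub> \<one>\<^bsub>H\<^esub>) = cod.t \<one>\<^bsub>A'\<^esub> \<one>\<^bsub>H'\<^esub>"
      by (simp add: MX dom.t_closed psi_left one)
  qed
  show ?inv
    unfolding quadruple_of_def prod.inject
    by (intro conjI; rule extensionalityI[OF restrict_extensional])
       (use ext in \<open>simp_all add: MX dom.t_closed psi_left psi_right comps comps'\<close>)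
  show "morphism_of (u, p, r, v) (dom.t a h) = sweedler3 A cod.T a (\<lambda>a1 a2 a3. sweedler3 H cod.T h (\<lambda>h1 h2 h3.
      cod.t (u a1 \<cdot>' (p a2 \<triangleright>' r h1)) ((p a3 \<triangleleft>' r h2) \<star>' v h3)))"
    if "a \<in> carrier A" "h \<in> carrier H" for a h
    using product_formula[OF \<alpha> \<beta> all_comps that] that by (simp add: MX dom.t_closed psi(2))
qed

text \<open>
  The restrictions of \<open>\<psi>\<close> to \<open>A\<close> and \<open>H\<close> inherit multiplicativity, and the exchange identity is the
  image of the relation between \<open>A\<close> and \<open>H\<close> in the bicrossed product.
\<close>

lemma quadruple_of_morphism:
  assumes "\<psi> \<in> hopf_hom K dom.B cod.B"
  shows "quadruple_of \<psi> \<in> compatible_quadruples" and "morphism_of (quadruple_of \<psi>) = \<psi>"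
proof -
  from assms have ext: "\<psi> \<in> extensional (carrier dom.T)" and co: "\<psi> \<in> coalg_hom K dom.TC cod.TC"
    and mult: "\<And>X Y. \<lbrakk>X \<in> carrier dom.T; Y \<in> carrier dom.T\<rbrakk> \<Longrightarrow> \<psi> (X \<bullet> Y) = \<psi> X \<bullet>' \<psi> Y"
    and one: "\<psi> (dom.t \<one>\<^bsub>A\<^esub> \<one>\<^bsub>H\<^esub>) = cod.t \<one>\<^bsub>A'\<^esub> \<one>\<^bsub>H'\<^esub>"
    unfolding hopf_hom_iff by auto
  define \<alpha> where "\<alpha> = (\<lambda>a. \<psi> (dom.t a \<one>\<^bsub>H\<^esub>))"
  define \<beta> where "\<beta> = (\<lambda>h. \<psi> (dom.t \<one>\<^bsub>A\<^esub> h))"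
  have \<alpha>: "\<alpha> \<in> coalg_hom K A cod.TC" unfolding \<alpha>_def
    by (rule coalg_hom_comp[OF _ _ _ dom.inclusion_coalg_hom(1) co]) (rule dom.comults coalgebra_module[OF cod.TC_coalgebra])+
  have \<beta>: "\<beta> \<in> coalg_hom K H cod.TC" unfolding \<beta>_def
    by (rule coalg_hom_comp[OF _ _ _ dom.inclusion_coalg_hom(2) co]) (rule dom.comults coalgebra_module[OF cod.TC_coalgebra])+
  define u where "u = restrict (\<lambda>a. cod.fstT (\<alpha> a)) (carrier A)"
  define p where "p = restrict (\<lambda>a. cod.sndT (\<alpha> a)) (carrier A)"
  define r where "r = restrict (\<lambda>h. cod.fstT (\<beta> h)) (carrier H)"
  define v where "v = restrict (\<lambda>h. cod.sndT (\<beta> h)) (carrier H)"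
  have q: "quadruple_of \<psi> = (u, p, r, v)"
    unfolding quadruple_of_def u_def p_def r_def v_def \<alpha>_def \<beta>_def ..
  have comps: "u a = cod.fstT (\<alpha> a)" "p a = cod.sndT (\<alpha> a)" if "a \<in> carrier A" for a
    using that by (simp_all add: u_def p_def)
  have comps': "r h = cod.fstT (\<beta> h)" "v h = cod.sndT (\<beta> h)" if "h \<in> carrier H" for h
    using that by (simp_all add: r_def v_def)
  have all_comps: "\<forall>a\<in>carrier A. u a = cod.fstT (\<alpha> a)" "\<forall>a\<in>carrier A. p a = cod.sndT (\<alpha> a)"
    "\<forall>h\<in>carrier H. r h = cod.fstT (\<beta> h)" "\<forall>h\<in>carrier H. v h = cod.sndT (\<beta> h)"
    using comps comps' by blast+
  note al = coalg_hom_lin[OF \<alpha>, unfolded tensor_coalg_simps] and bl = coalg_hom_lin[OF \<beta>, unfolded tensor_coalg_simps]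
  note psi = cod.prod_map_linear[OF dom.coalgs al bl]
  note co_lin = coalg_hom_lin[OF co, unfolded tensor_coalg_simps]
  have prod_eq: "cod.prod_map \<alpha> \<beta> X = \<psi> X" if "X \<in> carrier dom.T" for X
  proof (rule linear_ext[OF dom.mods psi(1) co_lin _ that])
    fix a h assume ah: "a \<in> carrier A" "h \<in> carrier H"
    have "\<alpha> a \<bullet>' \<beta> h = \<psi> (dom.t a \<one>\<^bsub>H\<^esub> \<bullet> dom.t \<one>\<^bsub>A\<^esub> h)"
      unfolding \<alpha>_def \<beta>_def using ah by (simp add: mult dom.t_closed)
    then show "cod.prod_map \<alpha> \<beta> (dom.t a h) = \<psi> (dom.t a h)"
      using ah by (simp add: psi(2) dom.bmult_simps)
  qed
  have amult: "\<alpha> (a \<cdot> b) = \<alpha> a \<bullet>' \<alpha> b" if "a \<in> carrier A" "b \<in> carrier A" for a b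
    unfolding \<alpha>_def using that mult[of "dom.t a \<one>\<^bsub>H\<^esub>" "dom.t b \<one>\<^bsub>H\<^esub>"] by (simp add: dom.t_closed dom.bmult_simps)
  have bmult: "\<beta> (h \<star> g) = \<beta> h \<bullet>' \<beta> g" if "h \<in> carrier H" "g \<in> carrier H" for h g
    unfolding \<beta>_def using that mult[of "dom.t \<one>\<^bsub>A\<^esub> h" "dom.t \<one>\<^bsub>A\<^esub> g"] by (simp add: dom.t_closed dom.bmult_simps)
  have exchange: "\<beta> h \<bullet>' \<alpha> b = cod.prod_map \<alpha> \<beta> (dom.cross (tens K H A h b))"
    if hb: "h \<in> carrier H" "b \<in> carrier A" for h b
  proof -
    have "\<beta> h \<bullet>' \<alpha> b = \<psi> (dom.cross (tens K H A h b))"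
      using hb mult[of "dom.t \<one>\<^bsub>A\<^esub> h" "dom.t b \<one>\<^bsub>H\<^esub>"]
      by (simp add: \<alpha>_def \<beta>_def dom.t_closed dom.bmult_cross)
    then show ?thesis
      using hb by (simp add: prod_eq linear_hom_closed[OF dom.cross_linear] tens_closed dom.mods)
  qed
  note homs = component_coalg_homs[OF \<alpha> \<beta> all_comps]
  have ones: "cod.fstT (cod.t \<one>\<^bsub>A'\<^esub> \<one>\<^bsub>H'\<^esub>) = \<one>\<^bsub>A'\<^esub>" "cod.sndT (cod.t \<one>\<^bsub>A'\<^esub> \<one>\<^bsub>H'\<^esub>) = \<one>\<^bsub>H'\<^esub>"
    by (simp_all add: cod.fst_linear(2) cod.snd_linear(2) counit_one[OF cod.bialgs(1)] counit_one[OF cod.bialgs(2)]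
        module.smult_one[OF cod.mods(1)] module.smult_one[OF cod.mods(2)])
  have unitary: "u \<in> unitary_coalg_hom K A A'" "p \<in> unitary_coalg_hom K A H'"
    "r \<in> unitary_coalg_hom K H A'" "v \<in> unitary_coalg_hom K H H'"
    unfolding unitary_coalg_hom_def using homs
    by (simp_all add: comps comps' \<alpha>_def \<beta>_def one ones) (simp_all add: u_def p_def r_def v_def)
  show CQ: "quadruple_of \<psi> \<in> compatible_quadruples"
    unfolding q compatible_iff[OF \<alpha> \<beta> all_comps]
    by (intro conjI ballI unitary amult bmult exchange)
  show "morphism_of (quadruple_of \<psi>) = \<psi>"
  proof (rule extensionalityI[OF _ ext])
    show "morphism_of (quadruple_of \<psi>) \<in> extensional (carrier dom.T)"
      unfolding q morphism_of_def by simp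
    fix X assume X: "X \<in> carrier dom.T"
    show "morphism_of (quadruple_of \<psi>) X = \<psi> X"
    proof (rule linear_ext[OF dom.mods _ co_lin _ X])
      note M = morphism_of_quadruple[OF CQ[unfolded q]]
      show "morphism_of (quadruple_of \<psi>) \<in> linear_hom K dom.T cod.T"
        using M(1) coalg_hom_lin unfolding q hopf_hom_iff tensor_coalg_simps[symmetric] by blast
      show "morphism_of (quadruple_of \<psi>) (dom.t a h) = \<psi> (dom.t a h)" if ah: "a \<in> carrier A" "h \<in> carrier H" for a h
        using product_formula[OF \<alpha> \<beta> all_comps ah] M(3)[OF ah] prod_eq[OF dom.t_closed[OF ah]] psi(2)[OF ah]
        by (simp add: q)
    qed
  qed
qed

end

theorem theorem2p2:
  fixes K :: "('k, 'n) ring_scheme"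
    and A :: "('k, 'a, 'm) hopf_scheme" and H :: "('k, 'h, 'l) hopf_scheme"
    and lact :: "('h, 'a) tensor \<Rightarrow> 'a" and ract :: "('h, 'a) tensor \<Rightarrow> 'h"
    and A' :: "('k, 'a2, 'm2) hopf_scheme" and H' :: "('k, 'h2, 'l2) hopf_scheme"
    and lact' :: "('h2, 'a2) tensor \<Rightarrow> 'a2" and ract' :: "('h2, 'a2) tensor \<Rightarrow> 'h2"
  assumes "matched_pair K A H lact ract"
    and "matched_pair K A' H' lact' ract'"
  shows "\<exists>\<Psi>. bij_betw \<Psi>
            (two_hopf_actions.compatible_quadruples K A H lact ract A' H' lact' ract')
            (hopf_hom K (bicrossed_product K A H lact ract)
                        (bicrossed_product K A' H' lact' ract')) \<and>
          (\<forall>(u, p, r, v) \<in> two_hopf_actions.compatible_quadruples K A H lact ract A' H' lact' ract'.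
             \<forall>a\<in>carrier A. \<forall>h\<in>carrier H.
               \<Psi> (u, p, r, v) (tens K A H a h) =
                 sweedler3 A (tensor_alg K A' H') a (\<lambda>a1 a2 a3.
                 sweedler3 H (tensor_alg K A' H') h (\<lambda>h1 h2 h3.
                   tens K A' H'
                     (u a1 \<otimes>\<^bsub>A'\<^esub> lact' (tens K H' A' (p a2) (r h1)))
                     (ract' (tens K H' A' (p a3) (r h2)) \<otimes>\<^bsub>H'\<^esub> v h3))))"
proof -
  interpret two_matched_pairs K A H lact ract A' H' lact' ract'
  proof -
    interpret dom: matched_pair K A H lact ract by (rule assms(1))
    show "two_matched_pairs K A H lact ract A' H' lact' ract'"
      by (intro two_matched_pairs.intro assms dom.over_ring_axioms)
  qed
  show ?thesis
  proof (intro exI conjI)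
    show "bij_betw morphism_of compatible_quadruples (hopf_hom K dom.B cod.B)"
      by (rule bij_betw_byWitness[where f'=quadruple_of])
         (auto simp: morphism_of_quadruple quadruple_of_morphism)
    show "\<forall>(u, p, r, v) \<in> compatible_quadruples. \<forall>a\<in>carrier A. \<forall>h\<in>carrier H.
        morphism_of (u, p, r, v) (dom.t a h) = sweedler3 A cod.T a (\<lambda>a1 a2 a3. sweedler3 H cod.T h (\<lambda>h1 h2 h3.
          cod.t (u a1 \<otimes>\<^bsub>A'\<^esub> (p a2 \<triangleright>' r h1)) ((p a3 \<triangleleft>' r h2) \<otimes>\<^bsub>H'\<^esub> v h3)))"
      by (auto simp: morphism_of_quadruple(3))
  qed
qed

end
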